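(* Let $K$ be a nontrivial knot and let $D$ be a diagram of $K$ which is minimal with respect to crossings, i.e. $c(D)=c(K)$. Then $$1+\sqrt{1+c(D)}\le b(D)\le c(D).$$
   Context: A knot is the isotopy class of a tame oriented embedded circle in $S^3$. A knot diagram $D$ is a regular planar projection of a representative of the knot, with finitely many transverse double points (crossings) and over/under information at each; each crossing $x$ corresponds to two points of $D$, an overcrossing $x_+$ and an undercrossing $x_-$. $D$ is a diagram of $K$ if it represents $K$. $c(D)$ is the number of crossings of $D$, and $c(K)=\min\{c(D)\mid D \text{ is a diagram of } K\}$. Definition of $b(D)$: if $c(D)=0$, then $b(D)=0$. If $c(D)\ge 1$, $b(D)$ is the unique positive integer $k$ for which there are $2k$ points $s_1,f_1,s_2,f_2,\dots,s_k,f_k$ of $D$, none of them an overcrossing or undercrossing, met in this cyclic order when $D$ is traversed once along its orientation, such that for each $i$ (indices mod $k$) the closed arc $[s_i,f_i]$ of $D$ contains at least one overcrossing and no undercrossing (an overpass), and the closed arc $[f_i,s_{i+1}]$ contains at least one undercrossing and no overcrossing (an underpass). Thus $b(D)$ is the number of overpasses (equivalently, of underpasses) of $D$. *)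

theory Defs
  imports "HOL-Analysis.Analysis"
begin

text \<open>
  Three-space is \<open>complex \<times> real\<close> (plane and height), so that the planar projection is \<open>fst\<close>.
  The three-sphere is the unit sphere of \<open>space \<times> real\<close>; it is identified with the one-point
  compactification of \<open>space\<close> by stereographic projection from \<open>(0, 1)\<close>.
\<close>

type_synonym space = "complex \<times> real"

abbreviation S3 :: "(space \<times> real) set" where
  "S3 \<equiv> sphere 0 1"

definition inv_stereographic :: "space \<Rightarrow> space \<times> real" where
  "inv_stereographic x =
     ((2 / ((norm x)\<^sup>2 + 1)) *\<^sub>R x, ((norm x)\<^sup>2 - 1) / ((norm x)\<^sup>2 + 1))"


text \<open>
  An oriented embedded circle is given by an embedding of \<open>\<real>/\<int>\<close>, written as a 1-periodic function
  on the reals. Two such functions describe the same oriented circle iff they differ by a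
  reparametrization in the sense of \<open>oriented_reparam\<close>.
\<close>

definition embedded_circle :: "'a::topological_space set \<Rightarrow> (real \<Rightarrow> 'a) \<Rightarrow> bool" where
  "embedded_circle S g \<longleftrightarrow>
     continuous_on UNIV g \<and> (\<forall>t. g (t + 1) = g t) \<and> inj_on g {0..<1} \<and> range g \<subseteq> S"

definition oriented_reparam :: "(real \<Rightarrow> real) \<Rightarrow> bool" where
  "oriented_reparam \<phi> \<longleftrightarrow>
     continuous_on UNIV \<phi> \<and> strict_mono \<phi> \<and> (\<forall>t. \<phi> (t + 1) = \<phi> t + 1)"

definition polygonal_circle :: "(real \<Rightarrow> space) \<Rightarrow> bool" where
  "polygonal_circle q \<longleftrightarrow> embedded_circle UNIV q \<and>
     (\<exists>F. finite F \<and> range q = (\<Union>(a, b)\<in>F. closed_segment a b))"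

definition tame_circle :: "(real \<Rightarrow> space \<times> real) \<Rightarrow> bool" where
  "tame_circle g \<longleftrightarrow> embedded_circle S3 g \<and>
     (\<exists>q h k. polygonal_circle q \<and> homeomorphism S3 S3 h k \<and>
        h ` range g = inv_stereographic ` range q)"

text \<open>End maps of ambient isotopies of the three-sphere: homotopies through homeomorphisms that
  start at the identity.\<close>

definition isotopic_to_id :: "(space \<times> real \<Rightarrow> space \<times> real) \<Rightarrow> bool" where
  "isotopic_to_id h \<longleftrightarrow>
     homotopic_with_canon (\<lambda>f. \<exists>k. homeomorphism S3 S3 f k) S3 S3 id h"

definition knot_isotopy :: "((real \<Rightarrow> space \<times> real) \<times> (real \<Rightarrow> space \<times> real)) set" where
  "knot_isotopy =
     {(g, g'). tame_circle g \<and> tame_circle g' \<and>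
        (\<exists>h \<phi>. isotopic_to_id h \<and> oriented_reparam \<phi> \<and> (\<forall>t. h (g t) = g' (\<phi> t)))}"

definition knots :: "(real \<Rightarrow> space \<times> real) set set" where
  "knots = {g. tame_circle g} // knot_isotopy"

definition round_circle :: "real \<Rightarrow> space \<times> real" where
  "round_circle t = inv_stereographic (cis (2 * pi * t), 0)"

definition trivial_knot :: "(real \<Rightarrow> space \<times> real) set" where
  "trivial_knot = knot_isotopy `` {round_circle}"


definition crossing_points :: "(real \<Rightarrow> complex) \<Rightarrow> complex set" where
  "crossing_points p = {x. \<exists>s t. s - t \<notin> \<int> \<and> p s = x \<and> p t = x}"

text \<open>
  Piecewise \<open>C\<^sup>1\<close> immersions, a class containing both smooth and polygonal curves: \<open>L\<close> and \<open>R\<close> are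
  the one-sided velocities, which differ only at finitely many corners in each period. The
  condition on the segment says that they are nonzero and that no corner is a cusp.
\<close>

definition piecewise_C1_immersion :: "(real \<Rightarrow> complex) \<Rightarrow> bool" where
  "piecewise_C1_immersion p \<longleftrightarrow>
     (\<exists>L R. finite {t \<in> {0..<1}. L t \<noteq> R t} \<and>
        (\<forall>t. (p has_vector_derivative L t) (at_left t) \<and>
             (p has_vector_derivative R t) (at_right t) \<and>
             (R \<longlongrightarrow> L t) (at_left t) \<and> (R \<longlongrightarrow> R t) (at_right t) \<and>
             0 \<notin> closed_segment (L t) (R t)))"

text \<open>The third and fourth conditions exclude triple points and require two-sided,
  non-parallel velocities at double points.\<close>

definition regular_closed_curve :: "(real \<Rightarrow> complex) \<Rightarrow> bool" where
  "regular_closed_curve p \<longleftrightarrow>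
     (\<forall>t. p (t + 1) = p t) \<and> piecewise_C1_immersion p \<and> finite (crossing_points p) \<and>
     (\<forall>r s t. p r = p s \<and> p s = p t \<longrightarrow> r - s \<in> \<int> \<or> s - t \<in> \<int> \<or> r - t \<in> \<int>) \<and>
     (\<forall>s t. s - t \<notin> \<int> \<and> p s = p t \<longrightarrow>
        (\<exists>a b. (p has_vector_derivative a) (at s) \<and> (p has_vector_derivative b) (at t) \<and>
               \<not> collinear {0, a, b}))"

text \<open>A diagram consists of its underlying plane curve and the (periodic) set of parameters of its
  overcrossings; the other parameters of double points are those of the undercrossings.\<close>

record diagram =
  curve :: "real \<Rightarrow> complex"
  overs :: "real set"

definition unders :: "diagram \<Rightarrow> real set" where
  "unders D = {t. curve D t \<in> crossing_points (curve D)} - overs D"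

definition projection_diagram :: "(real \<Rightarrow> space) \<Rightarrow> diagram" where
  "projection_diagram q =
     \<lparr>curve = fst \<circ> q,
      overs = {t. \<exists>s. fst (q s) = fst (q t) \<and> snd (q s) < snd (q t)}\<rparr>"

definition is_diagram_of :: "diagram \<Rightarrow> (real \<Rightarrow> space \<times> real) set \<Rightarrow> bool" where
  "is_diagram_of D K \<longleftrightarrow>
     (\<exists>q. inv_stereographic \<circ> q \<in> K \<and> regular_closed_curve (fst \<circ> q) \<and>
          D = projection_diagram q)"

definition crossings :: "diagram \<Rightarrow> nat" where
  "crossings D = card (crossing_points (curve D))"

definition crossing_number :: "(real \<Rightarrow> space \<times> real) set \<Rightarrow> nat" where
  "crossing_number K = Inf {crossings D |D. is_diagram_of D K}"

text \<open>Cutting the curve into \<open>k\<close> overpasses \<open>[s i, f i]\<close> and \<open>k\<close> underpasses \<open>[f i, s (i + 1)]\<close>, where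
  \<open>s k\<close> is the parameter of the same point as \<open>s 0\<close> after one full turn.\<close>

definition pass_decomposition :: "diagram \<Rightarrow> nat \<Rightarrow> bool" where
  "pass_decomposition D k \<longleftrightarrow> k \<ge> 1 \<and>
     (\<exists>s f :: nat \<Rightarrow> real. s k = s 0 + 1 \<and>
        (\<forall>i<k. s i < f i \<and> f i < s (Suc i) \<and>
           s i \<notin> overs D \<union> unders D \<and> f i \<notin> overs D \<union> unders D \<and>
           {s i..f i} \<inter> overs D \<noteq> {} \<and> {s i..f i} \<inter> unders D = {} \<and>
           {f i..s (Suc i)} \<inter> unders D \<noteq> {} \<and> {f i..s (Suc i)} \<inter> overs D = {}))"

definition bridges :: "diagram \<Rightarrow> nat" where
  "bridges D = (if crossings D = 0 then 0 else (THE k. pass_decomposition D k))"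

end

theory Submission imports Defs begin

text \<open>
  Suppose that in a minimal diagram an overpass met an underpass twice, or met an adjacent underpass
  once. Between two such meeting points (or between the meeting point and the common end) the two
  passes bound a bigon or a loop. The side with at least as many inner crossings can be rerouted along
  the other one, entirely above or entirely below the rest of the diagram; this is an ambient isotopy
  and lowers the number of crossings. Hence the crossings inject into the pairs of nonadjacent passes
  of opposite kinds, of which there are \<open>k (k - 2)\<close> if there are \<open>k\<close> overpasses, and
  \<open>c + 1 \<le> (k - 1)\<^sup>2\<close>. The upper bound holds since overpasses contain overcrossings.

  A crossingless curve is unknotted. All isotopies are composed of two kinds: changes of height that
  respect the order at the crossings, and isotopies that preserve every level and are affine on it,
  for which the height is first arranged so that each level contains few strands.
\<close>

section \<open>Isotopies of space and knots\<close>

text \<open>A level isotopy may be affine because complex affine maps act simply transitively on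
  ordered pairs of distinct points of the plane: if a level meets the curve in two points, one map
  \<open>w -> c (w - m) + m + e\<close> moves them wherever they should go. The coefficient c is a
  nowhere zero function of the height, so it has a continuous logarithm l, and
  \<open>exp (s l)\<close> is the isotopy. Where the two strands of a level merge, c is a quotient
  of differences that tends to a quotient of velocities; the exclusion of cusps makes this limit
  finite and nonzero. Thus an arc above everything else can be exchanged for another arc with the
  same ends, without an embedded disc or the Jordan curve theorem. What has to be built is a good
  new arc: a parallel copy of the other side of the bigon, so close that it meets the rest of the
  curve only near the crossings of that side. Its ends lie just before or after the points where the
  two sides meet, and are chosen such that at least one crossing there disappears. So even a tie
  between the sides lowers the number of crossings; the diagram and its mirror image then give
  contradictory strict inequalities.\<close>

definition proper_isotopy :: "(real \<Rightarrow> space \<Rightarrow> space) \<Rightarrow> bool" where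
  "proper_isotopy H \<longleftrightarrow> continuous_on ({0..1} \<times> UNIV) (\<lambda>(s, x). H s x) \<and> (\<forall>s\<in>{0..1}. bij (H s)) \<and>
     (\<forall>x. H 0 x = x) \<and> (\<forall>r. \<exists>r'. \<forall>s\<in>{0..1}. \<forall>x. norm (H s x) \<le> r \<longrightarrow> norm x \<le> r')"

definition isotopic_curves :: "(real \<Rightarrow> space) \<Rightarrow> (real \<Rightarrow> space) \<Rightarrow> bool" where
  "isotopic_curves q q' \<longleftrightarrow> (\<exists>H. proper_isotopy H \<and> (\<forall>t. H 1 (q t) = q' t))"

section \<open>Stereographic projection, and isotopies of space as isotopies of the
  three-sphere\<close>

definition stereographic :: "space \<times> real \<Rightarrow> space" where
  "stereographic y = (1 / (1 - snd y)) *\<^sub>R fst y"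

abbreviation pole :: "space \<times> real" where "pole \<equiv> (0, 1)"

lemma norm_pair_sq: "(norm (y::'a::real_normed_vector \<times> real))\<^sup>2 = (norm (fst y))\<^sup>2 + (snd y)\<^sup>2"
  by (cases y) (simp add: norm_Pair)

lemma inv_stereographic_S3: "inv_stereographic x \<in> S3"
proof -
  have "(norm x)\<^sup>2 + 1 > 0" by (smt (verit) zero_le_power2)
  then have "(norm (inv_stereographic x))\<^sup>2 = 1"
    unfolding norm_pair_sq inv_stereographic_def
    by (simp add: power_divide power_mult_distrib divide_simps) (simp add: power2_eq_square algebra_simps)
  then show ?thesis by (simp add: power2_eq_1_iff) (smt (verit) norm_ge_zero)
qed

lemma inv_stereographic_neq_pole: "inv_stereographic x \<noteq> pole"
proof -
  have "(norm x)\<^sup>2 + 1 > 0" by (smt (verit) zero_le_power2)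
  then show ?thesis unfolding inv_stereographic_def by (auto simp: divide_simps)
qed

lemma stereographic_inv: "stereographic (inv_stereographic x) = x"
proof -
  have "(norm x)\<^sup>2 + 1 > 0" by (smt (verit) zero_le_power2)
  then have "1 - ((norm x)\<^sup>2 - 1) / ((norm x)\<^sup>2 + 1) = 2 / ((norm x)\<^sup>2 + 1)"
    by (simp add: field_simps)
  moreover have "1 / (2 / ((norm x)\<^sup>2 + 1)) * (2 / ((norm x)\<^sup>2 + 1)) = 1"
    using \<open>(norm x)\<^sup>2 + 1 > 0\<close> by (simp add: field_simps)
  ultimately show ?thesis unfolding inv_stereographic_def stereographic_def
    by (simp only: fst_conv snd_conv scaleR_scaleR scaleR_one)
qed

lemma inv_stereographic_stereographic:
  assumes "y \<in> S3" "y \<noteq> pole" shows "inv_stereographic (stereographic y) = y"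
proof -
  obtain u v where y: "y = (u, v)" by (metis surj_pair)
  have 1: "(norm u)\<^sup>2 + v\<^sup>2 = 1"
    using assms(1) norm_pair_sq[of y] y by simp
  have v: "v \<noteq> 1" using 1 assms(2) y by auto
  have n: "(norm (stereographic y))\<^sup>2 = (1 + v) / (1 - v)"
  proof -
    have "(norm u)\<^sup>2 = (1 + v) * (1 - v)" using 1 by (simp add: power2_eq_square algebra_simps)
    then show ?thesis unfolding stereographic_def y using v
      by (simp add: power_divide) (simp add: power2_eq_square)
  qed
  have e: "(norm (stereographic y))\<^sup>2 + 1 = 2 / (1 - v)"
    unfolding n using v by (simp add: divide_simps)
  have f: "(norm (stereographic y))\<^sup>2 - 1 = 2 * v / (1 - v)"
    unfolding n using v by (simp add: divide_simps)
  show ?thesis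
    unfolding inv_stereographic_def e f using v y by (simp add: stereographic_def)
qed

text \<open>The chordal distance to the pole decreases with the norm, so neighbourhoods of the pole
  correspond to complements of balls. All estimates at infinity go through this formula.\<close>

lemma dist_inv_stereographic_pole: "(dist (inv_stereographic x) pole)\<^sup>2 = 4 / ((norm x)\<^sup>2 + 1)"
proof -
  have p: "(norm x)\<^sup>2 + 1 > 0" by (smt (verit) zero_le_power2)
  have e: "((norm x)\<^sup>2 - 1) / ((norm x)\<^sup>2 + 1) - 1 = - (2 / ((norm x)\<^sup>2 + 1))"
    using p by (simp add: field_simps)
  have "(dist (inv_stereographic x) pole)\<^sup>2
      = (2 * norm x / ((norm x)\<^sup>2 + 1))\<^sup>2 + (2 / ((norm x)\<^sup>2 + 1))\<^sup>2"
    unfolding dist_norm norm_pair_sq[of "inv_stereographic x - pole"] using p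
    by (simp add: inv_stereographic_def e)
  also have "\<dots> = 4 / ((norm x)\<^sup>2 + 1)"
    using p by (simp add: power_divide divide_simps) (simp add: power2_eq_square algebra_simps)
  finally show ?thesis .
qed

lemma continuous_inv_stereographic: "continuous_on UNIV inv_stereographic"
  unfolding inv_stereographic_def
  by (intro continuous_intros) (smt (verit) zero_le_power2)+

lemma continuous_stereographic: "continuous_on (S3 - {pole}) stereographic"
proof -
  have "1 - snd y \<noteq> 0" if "y \<in> S3 - {pole}" for y :: "space \<times> real"
  proof
    assume "1 - snd y = 0"
    then have "snd y = 1" by simp
    moreover then have "(norm (fst y))\<^sup>2 = 0" using that norm_pair_sq[of y] by simp
    ultimately show False using that by (cases y) auto
  qed
  then show ?thesis unfolding stereographic_def by (intro continuous_intros) auto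
qed

definition sphere_lift :: "(space \<Rightarrow> space) \<Rightarrow> space \<times> real \<Rightarrow> space \<times> real" where
  "sphere_lift f y = (if y \<in> S3 - {pole} then inv_stereographic (f (stereographic y)) else y)"

lemma sphere_lift_inv_stereographic: "sphere_lift f (inv_stereographic x) = inv_stereographic (f x)"
  using inv_stereographic_S3[of x] inv_stereographic_neq_pole[of x]
  by (simp add: sphere_lift_def stereographic_inv)

text \<open>Away from the pole the lift is a composition of continuous maps. At the pole, continuity
  is the last condition of \<open>proper_isotopy\<close>: a ball has its preimages under all
  \<open>H s\<close> in one common ball, so points far out stay far out, uniformly in time.\<close>

lemma continuous_sphere_lift:
  assumes H: "proper_isotopy H"
  shows "continuous_on ({0..1} \<times> S3) (\<lambda>(s, y). sphere_lift (H s) y)"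
proof -
  let ?D = "{0..1::real} \<times> S3" and ?F = "\<lambda>(s, y). sphere_lift (H s) y"
  have cH: "continuous_on ({0..1} \<times> UNIV) (\<lambda>(s, x). H s x)"
    and pr: "\<And>r. \<exists>r'. \<forall>s\<in>{0..1}. \<forall>x. norm (H s x) \<le> r \<longrightarrow> norm x \<le> r'"
    using H by (auto simp: proper_isotopy_def)
  have c1: "continuous_on ({0..1} \<times> (S3 - {pole})) (\<lambda>(s, y). H s (stereographic y))"
  proof -
    have "continuous_on ({0..1::real} \<times> (S3 - {pole})) (\<lambda>z. (fst z, stereographic (snd z)))"
      by (intro continuous_intros continuous_on_compose2[OF continuous_stereographic]) auto
    from continuous_on_compose2[OF cH this] show ?thesis
      by (force simp: case_prod_beta)
  qed
  have "continuous_on ({0..1} \<times> (S3 - {pole})) (\<lambda>z. inv_stereographic ((\<lambda>(s, y). H s (stereographic y)) z))"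
    by (rule continuous_on_compose2[OF continuous_inv_stereographic c1]) auto
  then have c2: "continuous_on ({0..1} \<times> (S3 - {pole})) ?F"
    by (rule continuous_on_eq) (simp add: sphere_lift_def split_beta mem_Times_iff)
  have "continuous (at z within ?D) ?F" if z: "z \<in> ?D" for z
  proof (cases "snd z = pole")
    case False
    then have "z \<in> {0..1} \<times> (S3 - {pole})" using z by (auto simp: mem_Times_iff)
    then have "continuous (at z within {0..1} \<times> (S3 - {pole})) ?F"
      using c2 continuous_on_eq_continuous_within by blast
    moreover have "at z within {0..1} \<times> (S3 - {pole}) = at z within ?D"
    proof (rule at_within_nhd)
      show "z \<in> UNIV \<times> (- {pole})" using False by (auto simp: mem_Times_iff)
      show "open (UNIV \<times> (- {pole :: space \<times> real}) :: (real \<times> space \<times> real) set)"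
        by (intro open_Times) auto
    qed auto
    ultimately show ?thesis by simp
  next
    case True
    show ?thesis unfolding continuous_within_eps_delta
    proof (intro allI impI)
      fix e :: real assume e: "e > 0"
      obtain r' where r': "\<And>s x. s \<in> {0..1} \<Longrightarrow> norm (H s x) \<le> 2/e \<Longrightarrow> norm x \<le> r'"
        using pr[of "2/e"] by blast
      \<comment> \<open>\<open>d\<close> is the distance from the pole at norm \<open>r'\<close>.
        Closer points have norm above \<open>r'\<close>, hence are sent to norm above
        \<open>2 / e\<close>, that is to distance less than \<open>e\<close> from the pole.\<close>
      define d where "d = 2 / sqrt (r'\<^sup>2 + 1)"
      have rp: "r'\<^sup>2 + 1 > 0" by (smt (verit) zero_le_power2)
      have d: "d > 0" unfolding d_def using rp by simp
      have "dist (?F x') (?F z) < e" if x': "x' \<in> ?D" and dx: "dist x' z < d" for x'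
      proof -
        obtain s y where sy: "x' = (s, y)" by (metis surj_pair)
        have s: "s \<in> {0..1}" and yS: "y \<in> S3" using x' sy by auto
        have Fz: "?F z = pole" using True by (cases z) (simp add: sphere_lift_def)
        show ?thesis
        proof (cases "y = pole")
          case True then show ?thesis using Fz sy e by (simp add: sphere_lift_def)
        next
          case False
          let ?x = "stereographic y"
          have "dist (snd x') (snd z) < d" using dx dist_snd_le[of x' z] by linarith
          then have "dist y pole < d" using sy True by simp
          moreover have "y = inv_stereographic ?x"
            using inv_stereographic_stereographic[OF yS False] by simp
          ultimately have "(dist (inv_stereographic ?x) pole)\<^sup>2 < d\<^sup>2"
            by (metis power_strict_mono zero_le_dist pos2)
          then have "4 / ((norm ?x)\<^sup>2 + 1) < 4 / (r'\<^sup>2 + 1)"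
            unfolding dist_inv_stereographic_pole d_def using rp by (simp add: power_divide)
          moreover have "(norm ?x)\<^sup>2 + 1 > 0" by (smt (verit) zero_le_power2)
          ultimately have "r'\<^sup>2 < (norm ?x)\<^sup>2" using rp by (simp add: divide_simps)
          then have "\<not> norm ?x \<le> r'" by (smt (verit) norm_ge_zero power_mono)
          then have "norm (H s ?x) > 2/e" using r'[OF s, of ?x] by linarith
          then have "(2/e)\<^sup>2 < (norm (H s ?x))\<^sup>2" using e by (intro power_strict_mono) auto
          then have "4 / e\<^sup>2 < (norm (H s ?x))\<^sup>2 + 1" unfolding power_divide[of 2 e 2] by simp
          then have "4 < ((norm (H s ?x))\<^sup>2 + 1) * e\<^sup>2" using e by (subst (asm) pos_divide_less_eq) auto
          moreover have "(norm (H s ?x))\<^sup>2 + 1 > 0" by (smt (verit) zero_le_power2)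
          ultimately have "4 / ((norm (H s ?x))\<^sup>2 + 1) < e\<^sup>2"
            by (subst pos_divide_less_eq) (auto simp: mult.commute)
          then have "(dist (inv_stereographic (H s ?x)) pole)\<^sup>2 < e\<^sup>2"
            unfolding dist_inv_stereographic_pole .
          then have "dist (inv_stereographic (H s ?x)) pole < e"
            using e power2_less_imp_less by (metis less_imp_le)
          moreover have "?F x' = inv_stereographic (H s ?x)" using sy False yS by (simp add: sphere_lift_def)
          ultimately show ?thesis using Fz by simp
        qed
      qed
      then show "\<exists>d>0. \<forall>x'\<in>?D. dist x' z < d \<longrightarrow> dist (?F x') (?F z) < e" using d by blast
    qed
  qed
  then show ?thesis by (simp add: continuous_on_eq_continuous_within)
qed

lemma bij_betw_sphere_lift:
  assumes "bij f" shows "bij_betw (sphere_lift f) S3 S3"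
proof (rule bij_betw_byWitness[where f' = "sphere_lift (inv f)"])
  have i: "inv f (f x) = x" "f (inv f x) = x" for x
    using assms by (auto simp: bij_def surj_f_inv_f)
  have S: "sphere_lift g y = inv_stereographic (g (stereographic y))" if "y \<in> S3" "y \<noteq> pole" for g y
    using that by (simp add: sphere_lift_def)
  have P: "sphere_lift g pole = pole" for g by (simp add: sphere_lift_def)
  show "\<forall>a\<in>S3. sphere_lift (inv f) (sphere_lift f a) = a"
  proof
    fix a :: "space \<times> real" assume "a \<in> S3"
    then show "sphere_lift (inv f) (sphere_lift f a) = a"
      by (cases "a = pole") (auto simp: P S sphere_lift_inv_stereographic i inv_stereographic_stereographic
          simp del: mem_sphere mem_sphere_0)
  qed
  show "\<forall>a\<in>S3. sphere_lift f (sphere_lift (inv f) a) = a"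
  proof
    fix a :: "space \<times> real" assume "a \<in> S3"
    then show "sphere_lift f (sphere_lift (inv f) a) = a"
      by (cases "a = pole") (auto simp: P S sphere_lift_inv_stereographic i inv_stereographic_stereographic
          simp del: mem_sphere mem_sphere_0)
  qed
  have "sphere_lift g y \<in> S3" if "y \<in> S3" for g y
    using that by (cases "y = pole") (auto simp: P S inv_stereographic_S3 simp del: mem_sphere mem_sphere_0)
  then show "sphere_lift f ` S3 \<subseteq> S3" "sphere_lift (inv f) ` S3 \<subseteq> S3" by blast+
qed

text \<open>At each time the lift is a continuous bijection of a compact Hausdorff space, hence a
  homeomorphism; this is why \<open>proper_isotopy\<close> asks for bijections only.\<close>

lemma isotopic_to_id_sphere_lift:
  assumes H: "proper_isotopy H" shows "isotopic_to_id (sphere_lift (H 1))"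
proof -
  let ?F = "\<lambda>(s, y). sphere_lift (H s) y"
  have c: "continuous_on ({0..1} \<times> S3) ?F" by (rule continuous_sphere_lift[OF H])
  have bij: "bij_betw (sphere_lift (H s)) S3 S3" if "s \<in> {0..1}" for s
    using H that by (simp add: bij_betw_sphere_lift proper_isotopy_def)
  have homeo: "\<exists>k. homeomorphism S3 S3 (sphere_lift (H s)) k" if s: "s \<in> {0..1}" for s
  proof -
    have "continuous_on S3 (?F \<circ> Pair s)" by (rule continuous_on_o_Pair[OF c s])
    then have "continuous_on S3 (sphere_lift (H s))" by (simp add: o_def)
    moreover have "compact S3" by (rule compact_sphere)
    ultimately show ?thesis using bij[OF s] homeomorphism_compact[of S3 "sphere_lift (H s)" S3]
      unfolding bij_betw_def by blast
  qed
  have id: "sphere_lift (H 0) x = x" for x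
    using H inv_stereographic_stereographic[of x] by (auto simp: sphere_lift_def proper_isotopy_def simp del: mem_sphere mem_sphere_0 split_paired_All)
  have im: "?F \<in> {0..1} \<times> S3 \<rightarrow> S3"
    using bij by (force simp: bij_betw_def simp del: mem_sphere mem_sphere_0)
  have pt: "prod_topology (top_of_set {0..1}) (top_of_set S3) = top_of_set ({0..1::real} \<times> S3)"
    by (simp add: prod_topology_subtopology_eu)
  show ?thesis
    unfolding isotopic_to_id_def homotopic_with_def
    apply (rule exI[of _ ?F])
    unfolding pt using c im homeo id
    by (auto simp: continuous_map_subtopology_eu simp del: mem_sphere mem_sphere_0)
qed

section \<open>Equivalence of tame circles\<close>

lemma tame_circle_image:
  assumes "tame_circle g" and h: "homeomorphism S3 S3 f f'"
  shows "tame_circle (\<lambda>t. f (g t))"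
proof -
  obtain q h k where g: "embedded_circle S3 g" and q: "polygonal_circle q" and h': "homeomorphism S3 S3 h k"
    and im: "h ` range g = inv_stereographic ` range q"
    using assms(1) by (auto simp: tame_circle_def)
  have gS: "g t \<in> S3" for t using g by (auto simp: embedded_circle_def simp del: mem_sphere mem_sphere_0)
  have inv: "f' (f (g t)) = g t" for t using h gS unfolding homeomorphism_def by blast
  have "embedded_circle S3 (\<lambda>t. f (g t))"
    unfolding embedded_circle_def
  proof (intro conjI allI)
    show "continuous_on UNIV (\<lambda>t. f (g t))"
      by (rule continuous_on_compose2[of S3 f]) (use h g gS in \<open>auto simp: homeomorphism_def embedded_circle_def simp del: mem_sphere mem_sphere_0\<close>)
    show "f (g (t + 1)) = f (g t)" for t using g by (simp add: embedded_circle_def)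
    show "inj_on (\<lambda>t. f (g t)) {0..<1}"
      using g inv unfolding embedded_circle_def inj_on_def by metis
    show "range (\<lambda>t. f (g t)) \<subseteq> S3" using h gS unfolding homeomorphism_def by blast
  qed
  moreover have "homeomorphism S3 S3 (h \<circ> f') (f \<circ> k)"
    by (rule homeomorphism_compose[OF homeomorphism_symD[OF h] h'])
  moreover have "(h \<circ> f') ` range (\<lambda>t. f (g t)) = inv_stereographic ` range q"
    unfolding im[symmetric] by (auto simp: inv image_iff)
  ultimately show ?thesis using q unfolding tame_circle_def by blast
qed

lemma isotopic_to_id_homeomorphism: "isotopic_to_id h \<Longrightarrow> \<exists>k. homeomorphism S3 S3 h k"
  unfolding isotopic_to_id_def by (drule homotopic_with_imp_property) simp

text \<open>Precomposition with a fixed homeomorphism keeps every stage a homeomorphism. Composition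
  and inversion of isotopies of the sphere both reduce to this.\<close>

lemma homotopic_homeomorphisms_compose_right:
  assumes "homotopic_with_canon (\<lambda>f. \<exists>k. homeomorphism S S f k) S S f g" and h: "homeomorphism S S h k"
  shows "homotopic_with_canon (\<lambda>f. \<exists>k. homeomorphism S S f k) S S (f \<circ> h) (g \<circ> h)"
proof (rule homotopic_with_compose_continuous_map_right[OF assms(1)])
  show "continuous_map (top_of_set S) (top_of_set S) h"
    using h by (auto simp: homeomorphism_def continuous_map_subtopology_eu)
  show "\<exists>k. homeomorphism S S (j \<circ> h) k" if "\<exists>k. homeomorphism S S j k" for j
    using that h homeomorphism_compose by blast
qed

lemma isotopic_to_id_compose:
  assumes "isotopic_to_id f" "isotopic_to_id g" shows "isotopic_to_id (g \<circ> f)"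
proof -
  obtain k where "homeomorphism S3 S3 f k" using isotopic_to_id_homeomorphism assms(1) by blast
  from homotopic_homeomorphisms_compose_right[OF assms(2)[unfolded isotopic_to_id_def] this]
  show ?thesis using assms(1) homotopic_with_trans unfolding isotopic_to_id_def id_comp by blast
qed

lemma isotopic_to_id_inverse:
  assumes "isotopic_to_id f" and h: "homeomorphism S3 S3 f k" shows "isotopic_to_id k"
proof -
  have k: "homeomorphism S3 S3 k f" by (rule homeomorphism_symD[OF h])
  let ?P = "\<lambda>f. \<exists>k. homeomorphism S3 S3 f k"
  have "homotopic_with_canon ?P S3 S3 k (f \<circ> k)"
    using homotopic_homeomorphisms_compose_right[OF assms(1)[unfolded isotopic_to_id_def] k] by simp
  \<comment> \<open>The two maps agree on the sphere only, so they are joined by a constant homotopy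
    instead of being identified.\<close>
  moreover have "homotopic_with_canon ?P S3 S3 (f \<circ> k) id"
  proof (rule homotopic_with_equal)
    show "?P (f \<circ> k)" using homeomorphism_compose[OF k h] by blast
    show "?P id" using homeomorphism_ident[of S3] by (auto simp: id_def)
    show "continuous_map (top_of_set S3) (top_of_set S3) (f \<circ> k)"
      using homeomorphism_compose[OF k h] by (auto simp: homeomorphism_def continuous_map_subtopology_eu)
    show "(f \<circ> k) x = id x" if "x \<in> topspace (top_of_set S3)" for x
      using that h by (simp add: homeomorphism_def del: mem_sphere mem_sphere_0)
  qed
  ultimately show ?thesis unfolding isotopic_to_id_def
    using homotopic_with_sym homotopic_with_trans by blast
qed

lemma oriented_reparam_compose: "oriented_reparam f \<Longrightarrow> oriented_reparam g \<Longrightarrow> oriented_reparam (\<lambda>t. g (f t))"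
  unfolding oriented_reparam_def strict_mono_def
  by (metis continuous_on_compose2 subset_UNIV)

lemma oriented_reparam_shift:
  assumes "oriented_reparam f" shows "f (t + of_int n) = f t + of_int n"
proof -
  have s: "f (t + 1) = f t + 1" for t using assms by (simp add: oriented_reparam_def)
  have p: "f (t + of_nat n) = f t + of_nat n" for t n
    by (induction n) (use s in \<open>auto simp: add.assoc[symmetric] add.commute[of 1]\<close>)
  show ?thesis
  proof (cases "n \<ge> 0")
    case True then show ?thesis using p[of t "nat n"] by simp
  next
    case False then show ?thesis using p[of "t + of_int n" "nat (-n)"] by simp
  qed
qed

lemma oriented_reparam_inverse:
  assumes f: "oriented_reparam f"
  obtains g where "oriented_reparam g" "\<And>t. f (g t) = t" "\<And>t. g (f t) = t"
proof -
  have c: "continuous_on UNIV f" and m: "strict_mono f" using f by (auto simp: oriented_reparam_def)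
  have "\<exists>t. f t = y" for y
  proof -
    \<comment> \<open>The values of \<open>f\<close> at \<open>n\<close> and \<open>n + 1\<close>
      are \<open>f 0 + n\<close> and \<open>f 0 + n + 1\<close>, and \<open>y\<close> lies between
      them.\<close>
    define n where "n = \<lfloor>y - f 0\<rfloor>"
    have "f (of_int n) \<le> y" "y \<le> f (of_int (n + 1))"
      using oriented_reparam_shift[OF f, of 0 n] oriented_reparam_shift[OF f, of 0 "n + 1"]
      unfolding n_def by simp_all linarith+
    then show ?thesis
      using IVT'[of f "of_int n" y "of_int (n+1)"] continuous_on_subset[OF c] by force
  qed
  then have "surj f" by (metis surjI)
  then have b: "bij f" using m by (simp add: bij_def strict_mono_imp_inj_on)
  define g where "g = inv f"
  have fg: "f (g t) = t" and gf: "g (f t) = t" for t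
    using b unfolding g_def by (auto simp: bij_def surj_f_inv_f)
  have gm: "strict_mono g" using m fg by (metis strict_mono_def strict_mono_less)
  have "continuous_on UNIV g"
  proof (rule continuous_onI_mono)
    have "surj g" using gf by (metis surjI)
    then show "open (range g)" by simp
    show "g x \<le> g y" if "x \<le> y" for x y using gm that by (simp add: strict_mono_less_eq)
  qed
  moreover have "g (t + 1) = g t + 1" for t
    using f fg gf unfolding oriented_reparam_def by metis
  ultimately have "oriented_reparam g" using gm by (simp add: oriented_reparam_def)
  then show thesis using fg gf that by blast
qed

lemma sym_knot_isotopy: "sym knot_isotopy"
proof (rule symI)
  fix g g' assume "(g, g') \<in> knot_isotopy"
  then obtain h \<phi> where t: "tame_circle g" "tame_circle g'" and h: "isotopic_to_id h"
    and \<phi>: "oriented_reparam \<phi>" and eq: "\<And>t. h (g t) = g' (\<phi> t)"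
    by (auto simp: knot_isotopy_def)
  obtain k where k: "homeomorphism S3 S3 h k" using isotopic_to_id_homeomorphism[OF h] by blast
  obtain \<psi> where \<psi>: "oriented_reparam \<psi>" "\<And>t. \<phi> (\<psi> t) = t" using oriented_reparam_inverse[OF \<phi>] by metis
  have "g t \<in> S3" for t using t(1) by (auto simp: tame_circle_def embedded_circle_def simp del: mem_sphere mem_sphere_0)
  then have "k (h (g t)) = g t" for t using k unfolding homeomorphism_def by blast
  then have "k (g' t) = g (\<psi> t)" for t by (metis eq \<psi>(2))
  then show "(g', g) \<in> knot_isotopy"
    using t isotopic_to_id_inverse[OF h k] \<psi>(1) unfolding knot_isotopy_def by blast
qed

lemma trans_knot_isotopy: "trans knot_isotopy"
proof (rule transI)
  fix g g' g'' assume "(g, g') \<in> knot_isotopy" "(g', g'') \<in> knot_isotopy"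
  then obtain h \<phi> h' \<phi>' where t: "tame_circle g" "tame_circle g''" and h: "isotopic_to_id h" "isotopic_to_id h'"
    and \<phi>: "oriented_reparam \<phi>" "oriented_reparam \<phi>'"
    and eq: "\<And>t. h (g t) = g' (\<phi> t)" "\<And>t. h' (g' t) = g'' (\<phi>' t)"
    by (auto simp: knot_isotopy_def)
  have "(h' \<circ> h) (g t) = g'' (\<phi>' (\<phi> t))" for t by (simp add: eq)
  then show "(g, g'') \<in> knot_isotopy"
    unfolding knot_isotopy_def
    using t isotopic_to_id_compose[OF h] oriented_reparam_compose[OF \<phi>] by blast
qed

text \<open>Tameness of the second curve is not assumed: the homeomorphism of the sphere carries it
  over. Rerouted curves therefore never have to be shown tame.\<close>

lemma isotopic_curves_knot_isotopy:
  assumes "tame_circle (inv_stereographic \<circ> q)" "isotopic_curves q q'"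
  shows "(inv_stereographic \<circ> q, inv_stereographic \<circ> q') \<in> knot_isotopy"
proof -
  obtain H where H: "proper_isotopy H" "\<And>t. H 1 (q t) = q' t" using assms(2) by (auto simp: isotopic_curves_def)
  let ?h = "sphere_lift (H 1)"
  have h: "isotopic_to_id ?h" by (rule isotopic_to_id_sphere_lift[OF H(1)])
  obtain k where k: "homeomorphism S3 S3 ?h k" using isotopic_to_id_homeomorphism[OF h] by blast
  have eq: "?h ((inv_stereographic \<circ> q) t) = (inv_stereographic \<circ> q') t" for t
    by (simp add: sphere_lift_inv_stereographic H(2))
  have "tame_circle (inv_stereographic \<circ> q')"
    using tame_circle_image[OF assms(1) k] unfolding eq by (simp add: o_def)
  moreover have "oriented_reparam (\<lambda>t. t)" by (simp add: oriented_reparam_def strict_mono_def)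
  ultimately show ?thesis unfolding knot_isotopy_def using assms(1) h eq by auto
qed

lemma knot_tame: "K \<in> knots \<Longrightarrow> g \<in> K \<Longrightarrow> tame_circle g"
  by (auto simp: knots_def quotient_def knot_isotopy_def)

lemma knot_class:
  assumes "K \<in> knots" "g \<in> K" shows "K = knot_isotopy `` {g}"
proof -
  obtain g0 where K: "K = knot_isotopy `` {g0}" using assms(1) by (auto simp: knots_def quotient_def)
  then have 1: "(g0, g) \<in> knot_isotopy" using assms(2) by simp
  then have 2: "(g, g0) \<in> knot_isotopy" by (rule symD[OF sym_knot_isotopy])
  show ?thesis unfolding K using transD[OF trans_knot_isotopy 1] transD[OF trans_knot_isotopy 2] by blast
qed

lemma isotopic_curves_in_knot:
  assumes "K \<in> knots" "inv_stereographic \<circ> q \<in> K" "isotopic_curves q q'"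
  shows "inv_stereographic \<circ> q' \<in> K"
  using isotopic_curves_knot_isotopy[OF knot_tame[OF assms(1,2)] assms(3)] knot_class[OF assms(1,2)] by blast

lemma isotopic_curves_trivial_knot:
  assumes "K \<in> knots" "inv_stereographic \<circ> q \<in> K" "isotopic_curves q (\<lambda>t. (cis (2 * pi * t), 0))"
  shows "K = trivial_knot"
proof -
  have "inv_stereographic \<circ> (\<lambda>t. (cis (2 * pi * t), 0)) = round_circle"
    by (auto simp: round_circle_def)
  then have "round_circle \<in> K" using isotopic_curves_in_knot[OF assms] by simp
  then show ?thesis unfolding trivial_knot_def by (rule knot_class[OF assms(1)])
qed

lemma isotopic_curves_trans:
  assumes "isotopic_curves q q'" "isotopic_curves q' q''" shows "isotopic_curves q q''"
proof -
  obtain H where H: "proper_isotopy H" "\<And>t. H 1 (q t) = q' t" using assms(1) by (auto simp: isotopic_curves_def)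
  obtain G where G: "proper_isotopy G" "\<And>t. G 1 (q' t) = q'' t" using assms(2) by (auto simp: isotopic_curves_def)
  \<comment> \<open>Both isotopies run at the same time, which avoids cutting the time interval in
    two.\<close>
  let ?F = "\<lambda>s x. G s (H s x)"
  have "proper_isotopy ?F" unfolding proper_isotopy_def
  proof (intro conjI allI ballI)
    have "continuous_on ({0..1} \<times> UNIV) (\<lambda>z. (fst z, (\<lambda>(s, x). H s x) z))"
      using H by (intro continuous_intros) (auto simp: proper_isotopy_def)
    moreover have "continuous_on ({0..1} \<times> UNIV) (\<lambda>(s, x). G s x)"
      using G(1) by (simp add: proper_isotopy_def)
    ultimately show "continuous_on ({0..1} \<times> UNIV) (\<lambda>(s, x). G s (H s x))"
      using continuous_on_compose2[of "{0..1} \<times> UNIV" "\<lambda>(s, x). G s x" "{0..1} \<times> UNIV"]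
      by (force simp: case_prod_beta)
    show "bij (?F s)" if "s \<in> {0..1}" for s
      using bij_comp[of "H s" "G s"] H G that by (auto simp: proper_isotopy_def o_def)
    show "?F 0 x = x" for x using H G by (simp add: proper_isotopy_def del: split_paired_All)
    show "\<exists>r'. \<forall>s\<in>{0..1}. \<forall>x. norm (?F s x) \<le> r \<longrightarrow> norm x \<le> r'" for r
    proof -
      obtain r1 where "\<forall>s\<in>{0..1}. \<forall>x. norm (G s x) \<le> r \<longrightarrow> norm x \<le> r1"
        using G(1) unfolding proper_isotopy_def by blast
      moreover obtain r2 where "\<forall>s\<in>{0..1}. \<forall>x. norm (H s x) \<le> r1 \<longrightarrow> norm x \<le> r2"
        using H(1) unfolding proper_isotopy_def by blast
      ultimately show ?thesis by blast
    qed
  qed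
  moreover have "\<forall>t. ?F 1 (q t) = q'' t" using H(2) G(2) by simp
  ultimately show ?thesis unfolding isotopic_curves_def by blast
qed

section \<open>Reflection in the plane of projection\<close>

definition mirror :: "space \<Rightarrow> space" where
  "mirror x = (fst x, - snd x)"

lemma mirror_mirror [simp]: "mirror (mirror x) = x"
  by (simp add: mirror_def)

lemma norm_mirror [simp]: "norm (mirror x) = norm x"
  by (cases x) (simp add: mirror_def norm_Pair)

text \<open>Conjugation of the isotopy by the reflection. It transfers results on overpasses to
  underpasses.\<close>

lemma isotopic_curves_mirror:
  assumes "isotopic_curves q q'" shows "isotopic_curves (mirror \<circ> q) (mirror \<circ> q')"
proof -
  obtain H where H: "proper_isotopy H" "\<And>t. H 1 (q t) = q' t" using assms(1) by (auto simp: isotopic_curves_def)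
  let ?F = "\<lambda>s x. mirror (H s (mirror x))"
  have m: "continuous_on A mirror" for A unfolding mirror_def by (intro continuous_intros)
  have "bij mirror" by (metis mirror_mirror o_bij comp_apply eq_id_iff)
  have "proper_isotopy ?F" unfolding proper_isotopy_def
  proof (intro conjI allI ballI)
    have "continuous_on ({0..1::real} \<times> UNIV) (\<lambda>z. (fst z, mirror (snd z)))"
      by (intro continuous_intros continuous_on_compose2[OF m[of UNIV]]) auto
    moreover have "continuous_on ({0..1} \<times> UNIV) (\<lambda>(s, x). H s x)"
      using H(1) by (simp add: proper_isotopy_def)
    ultimately have "continuous_on ({0..1} \<times> UNIV) (\<lambda>z. H (fst z) (mirror (snd z)))"
      using continuous_on_compose2[of "{0..1} \<times> UNIV" "\<lambda>(s, x). H s x" "{0..1} \<times> UNIV"]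
      by (force simp: case_prod_beta)
    from continuous_on_compose2[OF m[of UNIV] this]
    show "continuous_on ({0..1} \<times> UNIV) (\<lambda>(s, x). mirror (H s (mirror x)))"
      by (auto simp: case_prod_beta)
    show "bij (?F s)" if "s \<in> {0..1}" for s
      using bij_comp[OF \<open>bij mirror\<close> bij_comp[OF _ \<open>bij mirror\<close>, of "H s"]] H that
      by (auto simp: proper_isotopy_def o_def)
    show "?F 0 x = x" for x using H by (simp add: proper_isotopy_def del: split_paired_All)
    show "\<exists>r'. \<forall>s\<in>{0..1}. \<forall>x. norm (?F s x) \<le> r \<longrightarrow> norm x \<le> r'" for r
    proof -
      obtain r2 where "\<forall>s\<in>{0..1}. \<forall>x. norm (H s x) \<le> r \<longrightarrow> norm x \<le> r2"
        using H(1) unfolding proper_isotopy_def by blast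
      then show ?thesis by (metis norm_mirror)
    qed
  qed
  moreover have "\<forall>t. ?F 1 ((mirror \<circ> q) t) = (mirror \<circ> q') t" using H(2) by simp
  ultimately show ?thesis unfolding isotopic_curves_def by blast
qed

section \<open>Isotopies of curves\<close>

lemma bij_affine_fibres:
  fixes c :: "'a::real_normed_field"
  assumes "c \<noteq> 0" shows "\<exists>y. c * y + d = x"
  using assms by (intro exI[of _ "(x - d) / c"]) simp

lemma continuous_on_bounded_reals:
  fixes f :: "'a::heine_borel \<Rightarrow> 'b::real_normed_vector"
  assumes "continuous_on UNIV f"
  obtains B where "\<And>x. x \<in> cball a r \<Longrightarrow> norm (f x) \<le> B"
proof -
  have "compact (f ` cball a r)"
    by (intro compact_continuous_image continuous_on_subset[OF assms]) auto
  then have "bounded (f ` cball a r)" by (rule compact_imp_bounded)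
  then obtain B where "\<forall>y\<in>f ` cball a r. norm y \<le> B" unfolding bounded_iff by (elim exE)
  then show thesis by (intro that[of B]) (rule bspec, auto)
qed

lemma norm_summand_le:
  fixes x m e :: "'a::real_normed_vector"
  assumes "norm (x + m + e) \<le> r" "norm m \<le> M" "norm e \<le> E" shows "norm x \<le> r + M + E"
proof -
  have "norm x = norm ((x + m + e) - (m + e))" by simp
  also have "\<dots> \<le> norm (x + m + e) + norm (m + e)" by (rule norm_triangle_ineq4)
  also have "norm (m + e) \<le> norm m + norm e" by (rule norm_triangle_ineq)
  finally show ?thesis using assms by linarith
qed

lemma norm_of_real_scaled_le:
  fixes e :: "'a::real_normed_field"
  assumes "norm e \<le> E" "s \<in> {0..1}" shows "norm (of_real s * e) \<le> E"
proof -
  have "norm (of_real s * e) = s * norm e" using assms(2) by (simp add: norm_mult)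
  also have "\<dots> \<le> 1 * norm e" using assms(2) by (intro mult_right_mono) auto
  finally show ?thesis using assms(1) by simp
qed

text \<open>Multiplication by \<open>exp (- (of_real s * l))\<close> undoes the dilation and costs
  at most the factor \<open>exp B\<close>, whatever \<open>s\<close> is. Such uniform bounds on
  preimages give properness.\<close>

lemma norm_exp_scaled_ge:
  fixes l :: "'a::{real_normed_field,banach}"
  assumes "norm l \<le> B" "s \<in> {0..1}" "norm (exp (of_real s * l) * w) \<le> r"
  shows "norm w \<le> exp B * r"
proof -
  have "norm w = norm (exp (- (of_real s * l)) * (exp (of_real s * l) * w))"
    by (simp add: mult.assoc[symmetric] exp_add[symmetric])
  also have "\<dots> \<le> norm (exp (- (of_real s * l))) * r"
    unfolding norm_mult[of "exp (- (of_real s * l))"] by (intro mult_left_mono assms) simp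
  also have "\<dots> \<le> exp B * r"
  proof (intro mult_right_mono)
    have "norm (exp (- (of_real s * l))) \<le> exp (norm (- (of_real s * l)))" by (rule norm_exp)
    also have "\<dots> \<le> exp B" using norm_of_real_scaled_le[OF assms(1,2)] by simp
    finally show "norm (exp (- (of_real s * l))) \<le> exp B" .
    show "0 \<le> r" using assms(3) norm_ge_zero order_trans by blast
  qed
  finally show ?thesis .
qed

text \<open>An exponential coefficient is nonzero at all times, so every level is mapped bijectively
  to itself. The height is fixed, so an image in a ball confines it to a compact interval, on which
  \<open>l\<close>, \<open>m\<close> and \<open>e\<close> are bounded.\<close>

lemma proper_isotopy_levels:
  fixes l m e :: "real \<Rightarrow> complex"
  assumes c: "continuous_on UNIV l" "continuous_on UNIV m" "continuous_on UNIV e"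
  shows "proper_isotopy (\<lambda>s (w, h). (exp (of_real s * l h) * (w - m h) + m h + of_real s * e h, h))"
    (is "proper_isotopy ?H")
  unfolding proper_isotopy_def
proof (intro conjI allI ballI)
  have c': "continuous_on A (\<lambda>x. f (snd (snd x)))" if "continuous_on UNIV f"
    for f :: "real \<Rightarrow> complex" and A :: "(real \<times> complex \<times> real) set"
    by (rule continuous_on_compose2[OF that]) (auto intro!: continuous_intros)
  show "continuous_on ({0..1} \<times> UNIV) (\<lambda>(s, x). ?H s x)"
    unfolding split_beta by (intro continuous_intros c' c)
  show "?H 0 x = x" for x by (cases x) simp
  show "bij (?H s)" for s
  proof (rule bijI)
    show "inj (?H s)" by (auto simp: inj_on_def)
    show "surj (?H s)"
      unfolding surj_def
    proof
      fix y :: space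
      obtain w h where y: "y = (w, h)" by (metis surj_pair)
      obtain v where "exp (of_real s * l h) * v + (m h + of_real s * e h) = w"
        using bij_affine_fibres[of "exp (of_real s * l h)"] by fastforce
      then have "y = ?H s (v + m h, h)" using y by (simp add: add.assoc)
      then show "\<exists>x. y = ?H s x" by (rule exI)
    qed
  qed
  show "\<exists>r'. \<forall>s\<in>{0..1}. \<forall>x. norm (?H s x) \<le> r \<longrightarrow> norm x \<le> r'" for r
  proof -
    obtain L where L: "\<And>h. h \<in> cball 0 r \<Longrightarrow> norm (l h) \<le> L"
      using continuous_on_bounded_reals[OF c(1)] by blast
    obtain M where M: "\<And>h. h \<in> cball 0 r \<Longrightarrow> norm (m h) \<le> M"
      using continuous_on_bounded_reals[OF c(2)] by blast
    obtain E where E: "\<And>h. h \<in> cball 0 r \<Longrightarrow> norm (e h) \<le> E"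
      using continuous_on_bounded_reals[OF c(3)] by blast
    note B = L M E
    have "norm x \<le> exp L * (r + M + E) + M + r" if s: "s \<in> {0..1}" and n: "norm (?H s x) \<le> r" for s x
    proof -
      obtain w h where x: "x = (w, h)" by (metis surj_pair)
      have h: "\<bar>h\<bar> \<le> r" using n norm_snd_le[of "snd (?H s x)" "fst (?H s x)"] x by simp
      then have hb: "norm (l h) \<le> L" "norm (m h) \<le> M" "norm (e h) \<le> E" using B by auto
      have "norm (exp (of_real s * l h) * (w - m h) + m h + of_real s * e h) \<le> r"
        using n norm_fst_le[of "fst (?H s x)" "snd (?H s x)"] x by simp
      from norm_summand_le[OF this hb(2) norm_of_real_scaled_le[OF hb(3) s]]
      have "norm (exp (of_real s * l h) * (w - m h)) \<le> r + M + E" .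
      from norm_exp_scaled_ge[OF hb(1) s this] have "norm (w - m h) \<le> exp L * (r + M + E)" .
      then have "norm w \<le> exp L * (r + M + E) + M"
        using hb(2) norm_triangle_ineq[of "w - m h" "m h"] by simp
      then show ?thesis using h norm_Pair_le[of w h] x by simp
    qed
    then show ?thesis by blast
  qed
qed

text \<open>The same with the roles of plane and height exchanged. The coefficient is now positive,
  so the order on each vertical line is kept.\<close>

lemma proper_isotopy_vertical:
  fixes k j :: "complex \<Rightarrow> real"
  assumes c: "continuous_on UNIV k" "continuous_on UNIV j"
  shows "proper_isotopy (\<lambda>s (x, h). (x, exp (s * k x) * h + s * j x))"
    (is "proper_isotopy ?H")
  unfolding proper_isotopy_def
proof (intro conjI allI ballI)
  have c': "continuous_on A (\<lambda>x. f (fst (snd x)))" if "continuous_on UNIV f"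
    for f :: "complex \<Rightarrow> real" and A :: "(real \<times> complex \<times> real) set"
    by (rule continuous_on_compose2[OF that]) (auto intro!: continuous_intros)
  show "continuous_on ({0..1} \<times> UNIV) (\<lambda>(s, x). ?H s x)"
    unfolding split_beta by (intro continuous_intros c' c)
  show "?H 0 x = x" for x by (cases x) simp
  show "bij (?H s)" for s
  proof (rule bijI)
    show "inj (?H s)" by (auto simp: inj_on_def)
    show "surj (?H s)"
      unfolding surj_def
    proof
      fix y :: space
      obtain w h where y: "y = (w, h)" by (metis surj_pair)
      obtain v where "exp (s * k w) * v + s * j w = h"
        using bij_affine_fibres[of "exp (s * k w)"] by fastforce
      then have "y = ?H s (w, v)" using y by simp
      then show "\<exists>x. y = ?H s x" by (rule exI)
    qed
  qed
  show "\<exists>r'. \<forall>s\<in>{0..1}. \<forall>x. norm (?H s x) \<le> r \<longrightarrow> norm x \<le> r'" for r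
  proof -
    obtain L where L: "\<And>h. h \<in> cball 0 r \<Longrightarrow> norm (k h) \<le> L"
      using continuous_on_bounded_reals[OF c(1)] by blast
    obtain M where M: "\<And>h. h \<in> cball 0 r \<Longrightarrow> norm (j h) \<le> M"
      using continuous_on_bounded_reals[OF c(2)] by blast
    note B = L M
    have "norm x \<le> r + exp L * (r + M)" if s: "s \<in> {0..1}" and n: "norm (?H s x) \<le> r" for s x
    proof -
      obtain w h where x: "x = (w, h)" by (metis surj_pair)
      have h: "norm w \<le> r" using n norm_fst_le[of "fst (?H s x)" "snd (?H s x)"] x by simp
      then have hb: "norm (k w) \<le> L" "norm (j w) \<le> M" using B by auto
      have "norm (exp (s * k w) * h + s * j w) \<le> r"
        using n norm_snd_le[of "snd (?H s x)" "fst (?H s x)"] x by simp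
      then have "norm (exp (of_real s * k w) * h) \<le> r + M"
        using norm_of_real_scaled_le[OF hb(2) s] norm_summand_le[of "exp (s * k w) * h" "s * j w" 0 r M 0] by simp
      from norm_exp_scaled_ge[OF hb(1) s this] have "norm h \<le> exp L * (r + M)" .
      then show ?thesis using h norm_Pair_le[of w h] x by simp
    qed
    then show ?thesis by blast
  qed
qed

text \<open>Only the end map is prescribed. The line of heights is contractible, so the nowhere zero
  \<open>c\<close> has a continuous logarithm, which supplies the intermediate maps.\<close>

lemma isotopic_curves_levels:
  fixes c m e :: "real \<Rightarrow> complex"
  assumes cont: "continuous_on UNIV c" "continuous_on UNIV m" "continuous_on UNIV e"
    and nz: "\<And>h. c h \<noteq> 0"
    and eq: "\<And>t. p' t = c (z t) * (p t - m (z t)) + m (z t) + e (z t)"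
  shows "isotopic_curves (\<lambda>t. (p t, z t)) (\<lambda>t. (p' t, z t))"
proof -
  obtain l where l: "continuous_on UNIV l" "\<And>h. c h = exp (l h)"
  proof (rule continuous_logarithm_on_contractible[OF cont(1)])
    show "contractible (UNIV :: real set)" by (rule convex_imp_contractible[OF convex_UNIV])
  qed (auto simp: nz)
  show ?thesis unfolding isotopic_curves_def
    by (rule exI, rule conjI[OF proper_isotopy_levels[OF l(1) cont(2,3)]]) (simp add: eq l(2))
qed

text \<open>A continuous map from a compact space is a quotient map onto its image, so
  \<open>g\<close> descends to the image; here this is seen from the compactness of the graph. The
  extension to the plane is that of Dugundji.\<close>

lemma continuous_factor_through_compact:
  fixes p :: "real \<Rightarrow> complex" and g :: "real \<Rightarrow> real"
  assumes T: "compact T" and p: "continuous_on T p" and g: "continuous_on T g"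
    and eq: "\<And>s t. s \<in> T \<Longrightarrow> t \<in> T \<Longrightarrow> p s = p t \<Longrightarrow> g s = g t"
  obtains f where "continuous_on UNIV f" "\<And>t. t \<in> T \<Longrightarrow> f (p t) = g t"
proof -
  define f0 where "f0 x = g (SOME t. t \<in> T \<and> p t = x)" for x
  have f0: "f0 (p t) = g t" if "t \<in> T" for t
  proof -
    have "(SOME s. s \<in> T \<and> p s = p t) \<in> T \<and> p (SOME s. s \<in> T \<and> p s = p t) = p t"
      by (rule someI[of _ t]) (simp add: that)
    then show ?thesis unfolding f0_def using eq[OF _ that] by blast
  qed
  have "continuous_on (p ` T) f0"
  proof (rule continuous_from_closed_graph)
    show "compact (g ` T)" by (rule compact_continuous_image[OF g T])
    show "f0 \<in> p ` T \<rightarrow> g ` T" using f0 by auto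
    have "(\<lambda>x. (x, f0 x)) ` p ` T = (\<lambda>t. (p t, g t)) ` T" using f0 by (auto simp: image_iff)
    moreover have "compact ((\<lambda>t. (p t, g t)) ` T)"
      by (intro compact_continuous_image continuous_intros p g T)
    ultimately show "closed ((\<lambda>x. (x, f0 x)) ` p ` T)" by (simp add: compact_imp_closed)
  qed
  moreover have "closedin (top_of_set UNIV) (p ` T)"
    using compact_imp_closed[OF compact_continuous_image[OF p T]] by simp
  ultimately obtain f where "continuous_on UNIV f" "\<And>x. x \<in> p ` T \<Longrightarrow> f x = f0 x"
    using Dugundji[of UNIV UNIV "p ` T" f0] by auto
  then show thesis using that f0 by force
qed

lemma periodic_shift_int:
  assumes "\<And>t::real. f (t + 1) = f t" shows "f (t + of_int n) = f t"
proof -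
  have p: "f (t + of_nat n) = f t" for t n
    by (induction n) (use assms in \<open>auto simp: add.assoc[symmetric] add.commute[of 1]\<close>)
  show ?thesis
  proof (cases "n \<ge> 0")
    case True then show ?thesis using p[of t "nat n"] by simp
  next
    case False then show ?thesis using p[of "t + of_int n" "nat (-n)"] by simp
  qed
qed

lemma periodic_eq:
  assumes "\<And>t::real. f (t + 1) = f t" "s - t \<in> \<int>" shows "f s = f t"
proof -
  obtain n where "s = t + of_int n" using assms(2) by (metis Ints_cases add.commute diff_add_cancel)
  then show ?thesis using periodic_shift_int[of f, OF assms(1)] by simp
qed

section \<open>Closed plane curves with a height function\<close>

locale projected_curve =
  fixes p :: "real \<Rightarrow> complex" and z :: "real \<Rightarrow> real"
  assumes p_periodic: "p (t + 1) = p t" and z_periodic: "z (t + 1) = z t"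
    and continuous_p: "continuous_on UNIV p" and continuous_z: "continuous_on UNIV z"
    and embedded: "p s = p t \<Longrightarrow> z s = z t \<Longrightarrow> s - t \<in> \<int>"
    and finite_crossings: "finite (crossing_points p)"
    and no_triple_points: "p r = p s \<Longrightarrow> p s = p t \<Longrightarrow> r - s \<in> \<int> \<or> s - t \<in> \<int> \<or> r - t \<in> \<int>"
begin

lemma p_int: "s - t \<in> \<int> \<Longrightarrow> p s = p t"
  by (rule periodic_eq[of p, OF p_periodic])

lemma z_int: "s - t \<in> \<int> \<Longrightarrow> z s = z t"
  by (rule periodic_eq[of z, OF z_periodic])

definition over_times :: "real set" where "over_times = {t. \<exists>s. p s = p t \<and> z s < z t}"
definition under_times :: "real set" where "under_times = {t. \<exists>s. p s = p t \<and> z t < z s}"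

lemma crossing_iff: "p t \<in> crossing_points p \<longleftrightarrow> (\<exists>s. s - t \<notin> \<int> \<and> p s = p t)"
proof
  assume "p t \<in> crossing_points p"
  then obtain a b where ab: "a - b \<notin> \<int>" "p a = p t" "p b = p t" by (auto simp: crossing_points_def)
  then have "\<not> (a - t \<in> \<int> \<and> b - t \<in> \<int>)" by (metis Ints_diff diff_diff_eq2 diff_add_cancel add_diff_eq)
  then show "\<exists>s. s - t \<notin> \<int> \<and> p s = p t" using ab by blast
next
  assume "\<exists>s. s - t \<notin> \<int> \<and> p s = p t"
  then show "p t \<in> crossing_points p" unfolding crossing_points_def by blast
qed

lemma over_under_crossing: "over_times \<union> under_times = {t. p t \<in> crossing_points p}"
proof -
  have "t \<in> over_times \<union> under_times \<longleftrightarrow> p t \<in> crossing_points p" for t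
  proof
    assume "t \<in> over_times \<union> under_times"
    then obtain s where s: "p s = p t" "z s \<noteq> z t" by (auto simp: over_times_def under_times_def)
    then have "s - t \<notin> \<int>" using z_int by blast
    then show "p t \<in> crossing_points p" using s crossing_iff by blast
  next
    assume "p t \<in> crossing_points p"
    then obtain s where s: "s - t \<notin> \<int>" "p s = p t" unfolding crossing_iff by blast
    then have "z s \<noteq> z t" using embedded by blast
    then show "t \<in> over_times \<union> under_times"
      using s by (auto simp: over_times_def under_times_def neq_iff)
  qed
  then show ?thesis by blast
qed

text \<open>A time of both kinds would have a partner below and a partner above it: three strands
  through one point.\<close>

lemma over_under_disjoint: "over_times \<inter> under_times = {}"
proof -
  have False if "p s = p t" "z s < z t" "p r = p t" "z t < z r" for r s t
    using no_triple_points[of r s t] z_int[of r s] z_int[of s t] z_int[of r t] that by auto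
  then show ?thesis by (auto simp: over_times_def under_times_def)
qed

lemma crossing_partner_over:
  assumes "p s = p t" "s - t \<notin> \<int>" shows "s \<in> over_times \<longleftrightarrow> t \<in> under_times"
proof (cases "z s < z t")
  case True
  then have "s \<in> under_times" "t \<in> over_times"
    using assms(1) unfolding under_times_def over_times_def by (auto intro: sym)
  then show ?thesis using over_under_disjoint by blast
next
  case False
  then have "z t < z s" using embedded[OF assms(1)] assms(2) by linarith
  then have "s \<in> over_times" "t \<in> under_times"
    using assms(1) unfolding under_times_def over_times_def by (auto intro: sym)
  then show ?thesis by blast
qed

lemma over_int: "s - t \<in> \<int> \<Longrightarrow> s \<in> over_times \<longleftrightarrow> t \<in> over_times"
  using p_int[of s t] z_int[of s t] by (simp add: over_times_def)

lemma under_int: "s - t \<in> \<int> \<Longrightarrow> s \<in> under_times \<longleftrightarrow> t \<in> under_times"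
  using p_int[of s t] z_int[of s t] by (simp add: under_times_def)

lemma Ints_diff_unit_interval:
  assumes "s \<in> {a..<a+1}" "t \<in> {a..<a+1}" "s - t \<in> \<int>" shows "s = (t::real)"
proof -
  obtain n where n: "s - t = of_int n" using assms(3) by (auto elim: Ints_cases)
  then have "\<bar>real_of_int n\<bar> < 1" using assms by auto
  then have "n = 0" by linarith
  then show ?thesis using n by simp
qed

lemma finite_fibre: "finite {t \<in> {a..<a+1}. p t = x}" (is "finite ?F")
proof (cases "\<exists>r s. r \<in> ?F \<and> s \<in> ?F \<and> r \<noteq> s")
  case True
  then obtain r s where rs: "r \<in> ?F" "s \<in> ?F" "r \<noteq> s" by blast
  have "t = r \<or> t = s" if "t \<in> ?F" for t
    using no_triple_points[of r s t] Ints_diff_unit_interval[of r a s] Ints_diff_unit_interval[of s a t]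
      Ints_diff_unit_interval[of r a t] rs that by auto
  then have "?F \<subseteq> {r, s}" by blast
  then show ?thesis by (rule finite_subset) simp
next
  case False
  then have "?F = {} \<or> (\<exists>r. ?F = {r})" by blast
  then show ?thesis by (elim disjE exE) (simp_all only: finite.emptyI finite.insertI)
qed

lemma finite_crossing_times: "finite {t \<in> {a..b}. p t \<in> crossing_points p}"
proof -
  have 1: "finite {t \<in> {a..<a+1}. p t \<in> crossing_points p}" for a
  proof -
    have "{t \<in> {a..<a+1}. p t \<in> crossing_points p} = (\<Union>x\<in>crossing_points p. {t \<in> {a..<a+1}. p t = x})" by blast
    then show ?thesis using finite_crossings finite_fibre by simp
  qed
  have 2: "{t \<in> {a..b}. p t \<in> crossing_points p} \<subseteq>
      (\<Union>n\<in>{..nat \<lfloor>b - a\<rfloor>}. {t \<in> {a + of_nat n..<a + of_nat n + 1}. p t \<in> crossing_points p})"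
  proof
    fix t assume t: "t \<in> {t \<in> {a..b}. p t \<in> crossing_points p}"
    let ?n = "nat \<lfloor>t - a\<rfloor>"
    have "?n \<le> nat \<lfloor>b - a\<rfloor>" using t by (intro nat_mono floor_mono) auto
    moreover have "a + of_nat ?n \<le> t" "t < a + of_nat ?n + 1" using t by auto linarith+
    ultimately show "t \<in> (\<Union>n\<in>{..nat \<lfloor>b - a\<rfloor>}. {t \<in> {a + of_nat n..<a + of_nat n + 1}. p t \<in> crossing_points p})"
      using t by auto
  qed
  show ?thesis by (rule finite_subset[OF 2]) (use 1 in blast)
qed

lemma representative: "\<exists>t'\<in>{a..<a+1}. t' - (t::real) \<in> \<int>"
proof -
  let ?n = "\<lfloor>t - a\<rfloor>"
  have "t - of_int ?n \<in> {a..<a+1}" by auto linarith+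
  moreover have "t - of_int ?n - t \<in> \<int>" by simp
  ultimately show ?thesis by blast
qed

text \<open>The vertical isotopy is affine on each vertical line: near a crossing it is determined by the
  two strands there, elsewhere it is a translation, and a bump function blends the two.\<close>

lemma isotopic_height_change:
  assumes z': "continuous_on UNIV z'" "\<And>t. z' (t + 1) = z' t"
    and ord: "\<And>s t. p s = p t \<Longrightarrow> z s < z t \<Longrightarrow> z' s < z' t"
  shows "isotopic_curves (\<lambda>t. (p t, z t)) (\<lambda>t. (p t, z' t))"
proof -
  have z'_int: "z' s = z' t" if "s - t \<in> \<int>" for s t :: real by (rule periodic_eq[of z', OF z'(2) that])
  define Of where "Of = over_times \<inter> {0..1}"
  define Uf where "Uf = under_times \<inter> {0..1}"
  have "finite ((over_times \<union> under_times) \<inter> {0..1})"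
    using finite_crossing_times[of 0 1] unfolding over_under_crossing by (auto elim: rev_finite_subset)
  then have fin: "finite Of" "finite Uf" by (auto simp: Of_def Uf_def intro: rev_finite_subset)
  have rep: "\<exists>s'\<in>{0..1}. s' - s \<in> \<int>" for s :: real using representative[of 0 s] by auto
  have ne: "Of = {} \<longleftrightarrow> Uf = {}"
  proof -
    have "Uf \<noteq> {}" if t: "t \<in> Of" for t
    proof -
      obtain s where s: "p s = p t" "z s < z t" using t unfolding Of_def over_times_def by blast
      obtain s' where "s' \<in> {0..1}" "s' - s \<in> \<int>" using rep by blast
      then have "s' \<in> Uf" using s p_int[of s' s] z_int[of s' s]
        unfolding Uf_def under_times_def by (auto intro!: exI[of _ t])
      then show ?thesis by blast
    qed
    moreover have "Of \<noteq> {}" if t: "t \<in> Uf" for t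
    proof -
      obtain s where s: "p s = p t" "z t < z s" using t unfolding Uf_def under_times_def by blast
      obtain s' where "s' \<in> {0..1}" "s' - s \<in> \<int>" using rep by blast
      then have "s' \<in> Of" using s p_int[of s' s] z_int[of s' s]
        unfolding Of_def over_times_def by (auto intro!: exI[of _ t])
      then show ?thesis by blast
    qed
    ultimately show ?thesis by blast
  qed
  \<comment> \<open>\<open>A\<close> consists of the times at least as near to overcrossings as to
    undercrossings, \<open>B\<close> of those for which the converse holds. Neither contains both
    times of a crossing, so on each the heights are functions of the point: \<open>u\<close>,
    \<open>u'\<close> for upper strands and \<open>l\<close>, \<open>l'\<close> for lower
    ones.\<close>
  define A where "A = {t \<in> {0..1}. infdist t Of \<le> infdist t Uf}"
  define B where "B = {t \<in> {0..1}. infdist t Uf \<le> infdist t Of}"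
  have "closed {t. infdist t Of \<le> infdist t Uf}" "closed {t. infdist t Uf \<le> infdist t Of}"
    by (intro closed_Collect_le continuous_intros)+
  then have "compact ({0..1} \<inter> {t. infdist t Of \<le> infdist t Uf})"
    "compact ({0..1} \<inter> {t. infdist t Uf \<le> infdist t Of})"
    by (auto intro: compact_Int_closed)
  moreover have "A = {0..1} \<inter> {t. infdist t Of \<le> infdist t Uf}" "B = {0..1} \<inter> {t. infdist t Uf \<le> infdist t Of}"
    unfolding A_def B_def by blast+
  ultimately have comp: "compact A" "compact B" by simp_all
  have AB: "t \<in> A \<or> t \<in> B" if "t \<in> {0..1}" for t using that by (auto simp: A_def B_def)
  have inA: "t \<in> A" "t \<notin> B" if "t \<in> Of" for t
  proof -
    have "t \<notin> Uf" using that over_under_disjoint by (auto simp: Of_def Uf_def)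
    moreover have "closed Uf" "Uf \<noteq> {}" using fin ne that by (auto intro: finite_imp_closed)
    ultimately have "infdist t Uf > 0" using in_closed_iff_infdist_zero[of Uf t] infdist_nonneg[of t Uf] by linarith
    moreover have "infdist t Of = 0" using that by simp
    ultimately show "t \<in> A" "t \<notin> B" using that by (auto simp: A_def B_def Of_def)
  qed
  have inB: "t \<in> B" "t \<notin> A" if "t \<in> Uf" for t
  proof -
    have "t \<notin> Of" using that over_under_disjoint by (auto simp: Of_def Uf_def)
    moreover have "closed Of" "Of \<noteq> {}" using fin ne that by (auto intro: finite_imp_closed)
    ultimately have "infdist t Of > 0" using in_closed_iff_infdist_zero[of Of t] infdist_nonneg[of t Of] by linarith
    moreover have "infdist t Uf = 0" using that by simp
    ultimately show "t \<in> B" "t \<notin> A" using that by (auto simp: A_def B_def Uf_def)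
  qed
  have inj: "s - t \<in> \<int>" if "p s = p t" "s \<in> A \<and> t \<in> A \<or> s \<in> B \<and> t \<in> B" for s t
  proof (rule ccontr)
    assume n: "s - t \<notin> \<int>"
    have st: "s \<in> {0..1}" "t \<in> {0..1}" using that(2) by (auto simp: A_def B_def)
    have "z s \<noteq> z t" using embedded that(1) n by blast
    then have "s \<in> Of \<and> t \<in> Uf \<or> s \<in> Uf \<and> t \<in> Of"
      using that(1) that(1)[symmetric] st neq_iff[of "z s" "z t"]
      unfolding Of_def Uf_def over_times_def under_times_def by blast
    then show False using inA[of s] inA[of t] inB[of s] inB[of t] that(2) by blast
  qed
  have c: "continuous_on X p" "continuous_on X z" "continuous_on X z'" for X
    using continuous_p continuous_z z'(1) continuous_on_subset by blast+
  obtain u where u: "continuous_on UNIV u" "\<And>t. t \<in> A \<Longrightarrow> u (p t) = z t"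
    using continuous_factor_through_compact[OF comp(1) c(1,2)] inj z_int by metis
  obtain u' where u': "continuous_on UNIV u'" "\<And>t. t \<in> A \<Longrightarrow> u' (p t) = z' t"
    using continuous_factor_through_compact[OF comp(1) c(1,3)] inj z'_int by metis
  obtain l where l: "continuous_on UNIV l" "\<And>t. t \<in> B \<Longrightarrow> l (p t) = z t"
    using continuous_factor_through_compact[OF comp(2) c(1,2)] inj z_int by metis
  obtain l' where l': "continuous_on UNIV l'" "\<And>t. t \<in> B \<Longrightarrow> l' (p t) = z' t"
    using continuous_factor_through_compact[OF comp(2) c(1,3)] inj z'_int by metis
  let ?X = "crossing_points p"
  have gap: "l x < u x" "l' x < u' x" if x: "x \<in> ?X" for x
  proof -
    obtain s t where st: "s - t \<notin> \<int>" "p s = x" "p t = x" using x by (auto simp: crossing_points_def)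
    obtain s1 where s1: "s1 \<in> {0..1}" "s1 - s \<in> \<int>" using rep by blast
    obtain t1 where t1: "t1 \<in> {0..1}" "t1 - t \<in> \<int>" using rep by blast
    have p1: "p s1 = x" "p t1 = x" using st p_int s1 t1 by auto
    have "z s \<noteq> z t" using embedded[of s t] st by auto
    then have ne1: "z s1 \<noteq> z t1" using z_int s1 t1 by metis
    have main: "l x < u x \<and> l' x < u' x"
      if "p a = x" "p b = x" "z a < z b" "a \<in> {0..1}" "b \<in> {0..1}" for a b
    proof -
      have "a \<in> Uf" "b \<in> Of" using that by (auto simp: Of_def Uf_def over_times_def under_times_def)
      then have "a \<in> B" "b \<in> A" using inA inB by auto
      then show ?thesis using u(2) u'(2) l(2) l'(2) that ord[of a b] by force
    qed
    show "l x < u x" "l' x < u' x" using main[of s1 t1] main[of t1 s1] p1 ne1 s1 t1 by fastforce+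
  qed
  obtain \<eta> where e: "\<eta> > 0" "\<And>x. x \<in> ?X \<Longrightarrow> \<eta> < u x - l x \<and> \<eta> < u' x - l' x"
  proof (cases "?X = {}")
    case True then show thesis using that[of 1] by simp
  next
    case False
    define F where "F = (\<lambda>x. u x - l x) ` ?X \<union> (\<lambda>x. u' x - l' x) ` ?X"
    have F: "finite F" "F \<noteq> {}" "\<And>y. y \<in> F \<Longrightarrow> 0 < y" using finite_crossings False gap by (auto simp: F_def)
    then have "0 < Min F" by simp
    show thesis
    proof (rule that[of "Min F / 2"])
      show "0 < Min F / 2" using \<open>0 < Min F\<close> by simp
      fix x assume x: "x \<in> ?X"
      then have "u x - l x \<in> F" "u' x - l' x \<in> F" by (auto simp: F_def)
      then have "Min F \<le> u x - l x" "Min F \<le> u' x - l' x" using F by auto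
      then show "Min F / 2 < u x - l x \<and> Min F / 2 < u' x - l' x" using \<open>0 < Min F\<close> by linarith
    qed
  qed
  \<comment> \<open>On this neighbourhood of the crossings both gaps between upper and lower
    function exceed \<open>\<eta>\<close>, and there is an affine map taking \<open>l\<close> to
    \<open>l'\<close> and \<open>u\<close> to \<open>u'\<close>. \<open>bump\<close> is 1 at the
    crossings and 0 off \<open>W\<close>.\<close>
  define W where "W = {x. \<eta> < u x - l x} \<inter> {x. \<eta> < u' x - l' x}"
  have "open W" unfolding W_def
    by (intro open_Int open_Collect_less continuous_intros u u' l l')
  then have "closed (- W)" by (simp add: closed_Compl)
  moreover have "closed ?X" by (simp add: finite_crossings finite_imp_closed)
  moreover have "?X \<inter> - W = {}" using e by (auto simp: W_def)
  ultimately obtain bump :: "complex \<Rightarrow> real" where bump: "continuous_on UNIV bump" "\<And>x. bump x \<in> closed_segment 1 0"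
    "\<And>x. x \<in> ?X \<Longrightarrow> bump x = 1" "\<And>x. x \<in> - W \<Longrightarrow> bump x = 0"
    using Urysohn[of ?X "- W" "1::real" 0] by metis
  have bump01: "0 \<le> bump x" "bump x \<le> 1" for x using bump(2)[of x] by (auto simp: closed_segment_eq_real_ivl)
  \<comment> \<open>The dilation factor of that affine map. Cutting both gaps off at
    \<open>\<eta>\<close> keeps it continuous and positive outside \<open>W\<close> as well.\<close>
  define r where "r x = max (u' x - l' x) \<eta> / max (u x - l x) \<eta>" for x
  have r: "continuous_on UNIV r" unfolding r_def using e(1)
    by (intro continuous_intros u u' l l') (auto simp: max_def)
  have rpos: "r x > 0" for x unfolding r_def using e(1) by (intro divide_pos_pos) (auto simp: max_def)
  \<comment> \<open>At a crossing the translation \<open>z' - z\<close> is not a function of the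
    point. The factor \<open>1 - bump\<close> vanishes there, so the product is one.\<close>
  have cg: "continuous_on {0..1} (\<lambda>t. (1 - bump (p t)) * (z' t - z t))"
    by (intro continuous_intros c continuous_on_compose2[OF bump(1) c(1)]) auto
  have eg: "(1 - bump (p s)) * (z' s - z s) = (1 - bump (p t)) * (z' t - z t)"
    if "s \<in> {0..1}" "t \<in> {0..1}" "p s = p t" for s t
  proof (cases "s - t \<in> \<int>")
    case True then show ?thesis using z_int[of s t] z'_int[of s t] that by simp
  next
    case False
    then have "p t \<in> ?X" using that by (auto simp: crossing_points_def)
    then show ?thesis using bump(3) that by simp
  qed
  obtain g where g: "continuous_on UNIV g"
      "\<And>t. t \<in> {0..1} \<Longrightarrow> g (p t) = (1 - bump (p t)) * (z' t - z t)"
    by (rule continuous_factor_through_compact[OF compact_Icc c(1) cg eg]) (assumption | blast)+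
  define k where "k x = bump x * r x + (1 - bump x)" for x
  have kpos: "k x > 0" for x
  proof (cases "bump x = 0")
    case False
    then have "bump x * r x > 0" using rpos bump01(1)[of x] by simp
    then show ?thesis using bump01(2)[of x] by (simp add: k_def)
  qed (simp add: k_def)
  define j where "j x = bump x * (l' x - r x * l x) + g x" for x
  have ck: "continuous_on UNIV (\<lambda>x. ln (k x))"
    using kpos unfolding k_def by (intro continuous_intros bump r) (metis less_irrefl)
  have cj: "continuous_on UNIV j" unfolding j_def by (intro continuous_intros bump r l l' g)
  have main: "k (p t) * z t + j (p t) = z' t" if t: "t \<in> {0..1}" for t
  proof (cases "p t \<in> W")
    case False
    then show ?thesis using bump(4)[of "p t"] g(2)[OF t] by (simp add: k_def j_def)
  next
    case True
    then have rr: "r (p t) = (u' (p t) - l' (p t)) / (u (p t) - l (p t))" "u (p t) - l (p t) \<noteq> 0"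
      using e(1) by (auto simp: r_def W_def max_def)
    have "l' (p t) + r (p t) * (z t - l (p t)) = z' t"
      using AB[OF t] u(2)[of t] u'(2)[of t] l(2)[of t] l'(2)[of t] rr by auto
    then have "bump (p t) * (l' (p t) + r (p t) * (z t - l (p t))) = bump (p t) * z' t" by simp
    then show ?thesis using g(2)[OF t] by (simp add: k_def j_def algebra_simps)
  qed
  have all: "k (p t) * z t + j (p t) = z' t" for t
  proof -
    obtain t' where t': "t' \<in> {0..1}" "t' - t \<in> \<int>" using rep by blast
    show ?thesis using main[OF t'(1)] p_int[OF t'(2)] z_int[OF t'(2)] z'_int[OF t'(2)] by simp
  qed
  show ?thesis unfolding isotopic_curves_def
    by (rule exI, rule conjI[OF proper_isotopy_vertical[OF ck cj]]) (simp add: kpos all)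
qed

end

section \<open>Curves without crossings\<close>

lemma has_vector_derivative_quotient:
  fixes f :: "real \<Rightarrow> complex"
  assumes "(f has_vector_derivative D) (at x within S)"
  shows "((\<lambda>y. (f y - f x) / of_real (y - x)) \<longlongrightarrow> D) (at x within S)"
proof -
  have "((\<lambda>y. norm (f y - f x - (y - x) *\<^sub>R D) / norm (y - x)) \<longlongrightarrow> 0) (at x within S)"
    using assms unfolding has_vector_derivative_def has_derivative_iff_norm by simp
  moreover have "\<forall>\<^sub>F y in at x within S. norm (f y - f x - (y - x) *\<^sub>R D) / norm (y - x)
      = norm ((f y - f x) / of_real (y - x) - D)"
  proof (rule eventually_at_filter[THEN iffD2], rule always_eventually, intro allI impI)
    fix y assume "y \<noteq> x"
    then have "(f y - f x) / of_real (y - x) - D = (f y - f x - (y - x) *\<^sub>R D) / of_real (y - x)"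
      by (simp add: diff_divide_distrib scaleR_conv_of_real)
    then show "norm (f y - f x - (y - x) *\<^sub>R D) / norm (y - x) = norm ((f y - f x) / of_real (y - x) - D)"
      by (simp add: norm_divide del: of_real_diff)
  qed
  ultimately have "((\<lambda>y. norm ((f y - f x) / of_real (y - x) - D)) \<longlongrightarrow> 0) (at x within S)"
    by (rule Lim_transform_eventually)
  then show ?thesis unfolding tendsto_norm_zero_iff by (rule LIM_zero_cancel)
qed

text \<open>L'Hospital's rule makes the quotient continuous at the common zeros.\<close>

lemma continuous_on_ratio:
  fixes f g :: "real \<Rightarrow> complex"
  assumes f: "continuous_on S f" and g: "continuous_on S g"
    and zero: "\<And>x. x \<in> S \<Longrightarrow> g x = 0 \<Longrightarrow> f x = 0 \<and> (f has_vector_derivative D x) (at x within S) \<and>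
                  (g has_vector_derivative E x) (at x within S) \<and> E x \<noteq> 0"
  shows "continuous_on S (\<lambda>x. if g x = 0 then D x / E x else f x / g x)"
    (is "continuous_on S ?h")
  unfolding continuous_on_def
proof
  fix x assume x: "x \<in> S"
  have tf: "(f \<longlongrightarrow> f x) (at x within S)" and tg: "(g \<longlongrightarrow> g x) (at x within S)"
    using f g x by (auto simp: continuous_on_def)
  show "(?h \<longlongrightarrow> ?h x) (at x within S)"
  proof (cases "g x = 0")
    case False
    have "((\<lambda>y. f y / g y) \<longlongrightarrow> f x / g x) (at x within S)" by (rule tendsto_divide[OF tf tg False])
    moreover have "\<forall>\<^sub>F y in at x within S. f y / g y = ?h y"
      using tendsto_imp_eventually_ne[OF tg False] by eventually_elim simp
    ultimately have "(?h \<longlongrightarrow> f x / g x) (at x within S)" by (rule Lim_transform_eventually)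
    then show ?thesis using False by simp
  next
    case True
    note z = zero[OF x True]
    have qf: "((\<lambda>y. f y / of_real (y - x)) \<longlongrightarrow> D x) (at x within S)"
      using has_vector_derivative_quotient[of f "D x" x S] z by simp
    have qg: "((\<lambda>y. g y / of_real (y - x)) \<longlongrightarrow> E x) (at x within S)"
      using has_vector_derivative_quotient[of g "E x" x S] z True by simp
    have "((\<lambda>y. (f y / of_real (y - x)) / (g y / of_real (y - x))) \<longlongrightarrow> D x / E x) (at x within S)"
      by (rule tendsto_divide[OF qf qg]) (use z in simp)
    moreover have "\<forall>\<^sub>F y in at x within S. (f y / of_real (y - x)) / (g y / of_real (y - x)) = ?h y"
    proof -
      have "\<forall>\<^sub>F y in at x within S. g y / of_real (y - x) \<noteq> 0"
        using tendsto_imp_eventually_ne[OF qg] z by blast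
      moreover have "\<forall>\<^sub>F y in at x within S. y \<noteq> x" by (simp add: eventually_at_filter)
      ultimately show ?thesis by eventually_elim (simp del: of_real_diff)
    qed
    ultimately have "(?h \<longlongrightarrow> D x / E x) (at x within S)" by (rule Lim_transform_eventually)
    then show ?thesis using True by simp
  qed
qed

text \<open>Covers changes of parameter that reverse the direction: for \<open>k < 0\<close> a left
  neighbourhood becomes a right one, and so the derivative from one side becomes that from the
  other.\<close>

lemma has_vector_derivative_reflect:
  fixes p :: "real \<Rightarrow> complex"
  assumes "(p has_vector_derivative L) (at y within T)" and "y = b + k * x" and "(\<lambda>v. b + k * v) ` S \<subseteq> T"
  shows "((\<lambda>v. p (b + k * v)) has_vector_derivative of_real k * L) (at x within S)"
proof -
  have "((\<lambda>v. b + k * v) has_vector_derivative k) (at x within S)"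
    by (auto intro!: derivative_eq_intros)
  moreover have "(p has_vector_derivative L) (at (b + k * x) within (\<lambda>v. b + k * v) ` S)"
    using assms by (auto intro: has_vector_derivative_within_subset)
  ultimately have "((p \<circ> (\<lambda>v. b + k * v)) has_vector_derivative k *\<^sub>R L) (at x within S)"
    by (rule vector_diff_chain_within)
  then show ?thesis by (simp add: o_def scaleR_conv_of_real)
qed

text \<open>A positive combination is a positive multiple of a point of the segment. In this form
  the absence of cusps enters the quotients below.\<close>

lemma combination_neq_0:
  fixes L R :: complex
  assumes "0 \<notin> closed_segment L R" "k > 0" "d > 0"
  shows "of_real k * L + of_real d * R \<noteq> 0"
proof
  assume z: "of_real k * L + of_real d * R = 0"
  have "0 = (1 - d / (k + d)) *\<^sub>R L + (d / (k + d)) *\<^sub>R R"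
  proof -
    have "(1 - d / (k + d)) = (1 / (k + d)) * k" using assms by (simp add: field_simps)
    then have "(1 - d / (k + d)) *\<^sub>R L + (d / (k + d)) *\<^sub>R R = (1 / (k + d)) *\<^sub>R (k *\<^sub>R L + d *\<^sub>R R)"
      by (simp only: scaleR_right_distrib scaleR_scaleR) simp
    then show ?thesis using z by (simp add: scaleR_conv_of_real)
  qed
  moreover have "0 \<le> d / (k + d)" "d / (k + d) \<le> 1" using assms by auto
  ultimately have "0 \<in> closed_segment L R" unfolding closed_segment_def by blast
  then show False using assms(1) by simp
qed

lemma continuous_periodic_extension:
  fixes f :: "real \<Rightarrow> 'a::topological_space"
  assumes c: "continuous_on {a..a+1} f" and e: "f a = f (a + 1)"
  shows "continuous_on UNIV (\<lambda>t. f (t - of_int \<lfloor>t - a\<rfloor>))" (is "continuous_on UNIV ?g")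
    and "f (t + 1 - of_int \<lfloor>t + 1 - a\<rfloor>) = f (t - of_int \<lfloor>t - a\<rfloor>)"
    and "t \<in> {a..a+1} \<Longrightarrow> f (t - of_int \<lfloor>t - a\<rfloor>) = f t"
proof -
  have piece: "continuous_on {a + of_int n..a + of_int n + 1} ?g" for n
  proof -
    have "continuous_on {a + of_int n..a + of_int n + 1} (\<lambda>t. f (t - of_int n))"
      by (intro continuous_on_compose2[OF c] continuous_intros) auto
    moreover have "f (t - of_int n) = ?g t" if t: "t \<in> {a + of_int n..a + of_int n + 1}" for t
    proof (cases "t = a + of_int n + 1")
      case True
      then have "\<lfloor>t - a\<rfloor> = n + 1" by (simp add: floor_eq_iff)
      then show ?thesis using True e by simp
    next
      case False
      then have "\<lfloor>t - a\<rfloor> = n" using t by (simp add: floor_eq_iff)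
      then show ?thesis by simp
    qed
    ultimately show ?thesis by (rule continuous_on_eq)
  qed
  show "continuous_on UNIV ?g"
    unfolding continuous_on_eq_continuous_at[OF open_UNIV]
  proof
    fix t0 :: real
    define n where "n = \<lfloor>t0 - a\<rfloor>"
    let ?U = "{a + of_int n - 1<..<a + of_int n + 1}"
    have "continuous_on ({a + of_int (n - 1)..a + of_int (n - 1) + 1} \<union> {a + of_int n..a + of_int n + 1}) ?g"
      by (intro continuous_on_closed_Un piece closed_atLeastAtMost)
    then have "continuous_on ?U ?g" by (rule continuous_on_subset) auto
    moreover have "t0 \<in> ?U" unfolding n_def by auto linarith+
    ultimately show "continuous (at t0) ?g" by (simp add: continuous_on_eq_continuous_at)
  qed
  have "\<lfloor>t + 1 - a\<rfloor> = \<lfloor>t - a\<rfloor> + 1" by linarith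
  then show "f (t + 1 - of_int \<lfloor>t + 1 - a\<rfloor>) = f (t - of_int \<lfloor>t - a\<rfloor>)" by simp
  assume t: "t \<in> {a..a+1}"
  show "f (t - of_int \<lfloor>t - a\<rfloor>) = f t"
  proof (cases "t = a + 1")
    case True then show ?thesis using e by simp
  next
    case False
    then have "\<lfloor>t - a\<rfloor> = 0" using t by (simp add: floor_eq_iff)
    then show ?thesis by simp
  qed
qed

text \<open>A level meets the rising strand once, which is to be moved, and the falling strand once; the affine
  map fixes the latter and takes the old point on the former to the new one.\<close>

lemma isotopic_reroute_standard_height:
  fixes p p' :: "real \<Rightarrow> complex"
  assumes ab: "a < b" "0 < d" "b + d < a + 1"
    and cont: "continuous_on UNIV p" "continuous_on UNIV p'"
    and per: "\<And>t. p (t + 1) = p t" "\<And>t. p' (t + 1) = p' t" "\<And>t. z (t + 1) = z t"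
    and eq: "\<And>t. t \<in> {b..a+1} \<Longrightarrow> p' t = p t"
    and z1: "\<And>t. t \<in> {a..b} \<Longrightarrow> z t = M + (t - a) / (b - a)"
    and z2: "\<And>t. t \<in> {b..b+d} \<Longrightarrow> z t = M + 1 - (t - b) / d"
    and z3: "\<And>t. t \<in> {b+d..a+1} \<Longrightarrow> z t \<le> M"
    and sep: "\<And>s t. s \<in> {a..<b} \<Longrightarrow> t \<in> {b..b+d} \<Longrightarrow> p s \<noteq> p t \<and> p' s \<noteq> p' t"
    and der: "(p has_vector_derivative L) (at_left b)" "(p' has_vector_derivative L') (at_left b)"
      "(p has_vector_derivative R) (at_right b)" "0 \<notin> closed_segment L R" "0 \<notin> closed_segment L' R"
  shows "isotopic_curves (\<lambda>t. (p t, z t)) (\<lambda>t. (p' t, z t))"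
proof -
  define k where "k = b - a"
  have k: "k > 0" using ab by (simp add: k_def)
  \<comment> \<open>All three strands are parametrized by the depth \<open>v\<close> below the top
    level \<open>M + 1\<close>: \<open>\<alpha>\<close> is the old and \<open>\<gamma>\<close> the
    new rising strand, both run backwards from \<open>b\<close>, and \<open>\<beta>\<close> is the
    falling one.\<close>
  define \<alpha> where "\<alpha> v = p (b + (-k) * v)" for v
  define \<gamma> where "\<gamma> v = p' (b + (-k) * v)" for v
  define \<beta> where "\<beta> v = p (b + d * v)" for v
  have cs: "continuous_on X \<alpha>" "continuous_on X \<gamma>" "continuous_on X \<beta>" for X
    unfolding \<alpha>_def \<gamma>_def \<beta>_def
    by (intro continuous_on_compose2[OF cont(1)] continuous_on_compose2[OF cont(2)] continuous_intros subset_UNIV)+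
  have at0: "at 0 within {0..1::real} = at_right 0" by (simp add: at_within_Icc_at_right)
  have d\<alpha>: "(\<alpha> has_vector_derivative of_real (-k) * L) (at 0 within {0..1})"
    unfolding at0 \<alpha>_def by (rule has_vector_derivative_reflect[OF der(1)]) (use k in \<open>auto simp: mult_pos_pos\<close>)
  have d\<gamma>: "(\<gamma> has_vector_derivative of_real (-k) * L') (at 0 within {0..1})"
    unfolding at0 \<gamma>_def by (rule has_vector_derivative_reflect[OF der(2)]) (use k in \<open>auto simp: mult_pos_pos\<close>)
  have d\<beta>: "(\<beta> has_vector_derivative of_real d * R) (at 0 within {0..1})"
    unfolding at0 \<beta>_def by (rule has_vector_derivative_reflect[OF der(3)]) (use ab in \<open>auto simp: mult_pos_pos\<close>)
  define A where "A v = \<alpha> v - \<beta> v" for v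
  define C where "C v = \<gamma> v - \<beta> v" for v
  have p'b: "p' b = p b" using eq[of b] ab by simp
  have A0: "A v = 0 \<longleftrightarrow> v = 0" "C v = 0 \<longleftrightarrow> v = 0" if v: "v \<in> {0..1}" for v
  proof -
    have "A 0 = 0" "C 0 = 0" using p'b by (simp_all add: A_def C_def \<alpha>_def \<beta>_def \<gamma>_def)
    moreover have "A v \<noteq> 0 \<and> C v \<noteq> 0" if "v \<noteq> 0"
    proof -
      have vp: "v > 0" using v that by simp
      have "b + (-k) * v \<in> {a..<b}"
      proof -
        have "k * v \<le> k * 1" using k v by (intro mult_left_mono) auto
        moreover have "k * v > 0" using k vp by simp
        ultimately show ?thesis unfolding atLeastLessThan_iff mult_minus_left using k_def by linarith
      qed
      moreover have "b + d * v \<in> {b..b+d}"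
      proof -
        have "d * v \<le> d * 1" using ab v by (intro mult_left_mono) auto
        moreover have "d * v > 0" using ab vp by simp
        ultimately show ?thesis by simp
      qed
      moreover from this have "p' (b + d * v) = p (b + d * v)" using ab
        unfolding atLeastAtMost_iff by (intro eq) (unfold atLeastAtMost_iff, linarith)
      ultimately show ?thesis using sep[of "b + (-k) * v" "b + d * v"]
        by (auto simp: A_def C_def \<alpha>_def \<beta>_def \<gamma>_def)
    qed
    ultimately show "A v = 0 \<longleftrightarrow> v = 0" "C v = 0 \<longleftrightarrow> v = 0" by blast+
  qed
  \<comment> \<open>The derivatives of \<open>C\<close> and \<open>A\<close> at
    \<open>v = 0\<close>. Each is minus a positive combination of a left velocity and the right
    velocity at \<open>b\<close>, hence nonzero because there is no cusp.\<close>
  define DC where "DC = of_real (-k) * L' - of_real d * R"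
  define DA where "DA = of_real (-k) * L - of_real d * R"
  have "DC = - (of_real k * L' + of_real d * R)" "DA = - (of_real k * L + of_real d * R)"
    by (simp_all add: DC_def DA_def)
  then have nz: "DC \<noteq> 0" "DA \<noteq> 0"
    using combination_neq_0[OF der(4) k ab(2)] combination_neq_0[OF der(5) k ab(2)]
    by (simp_all only: neg_equal_0_iff_equal not_False_eq_True)
  \<comment> \<open>The coefficient that takes the difference of old and falling strand to the
    difference of new and falling strand, with its limit at the top, where the strands
    merge.\<close>
  define c0 where "c0 v = (if A v = 0 then DC / DA else C v / A v)" for v
  have c0: "continuous_on {0..1} c0" unfolding c0_def
  proof (rule continuous_on_ratio)
    show "continuous_on {0..1} C" "continuous_on {0..1} A" unfolding A_def C_def by (intro continuous_intros cs)+
    fix x :: real assume x: "x \<in> {0..1}" "A x = 0"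
    then have "x = 0" using A0 by blast
    then show "C x = 0 \<and> (C has_vector_derivative DC) (at x within {0..1}) \<and>
        (A has_vector_derivative DA) (at x within {0..1}) \<and> DA \<noteq> 0"
      using A0(2)[of 0] nz has_vector_derivative_diff[OF d\<gamma> d\<beta>] has_vector_derivative_diff[OF d\<alpha> d\<beta>]
      by (simp add: A_def[abs_def] C_def[abs_def] DC_def DA_def)
  qed
  have c0nz: "c0 v \<noteq> 0" if "v \<in> {0..1}" for v using A0[OF that] nz by (auto simp: c0_def)
  \<comment> \<open>The depth of a level, clipped to \<open>[0, 1]\<close>. Levels from
    \<open>M\<close> downwards get depth 1, where \<open>c0\<close> is 1 and the affine map is the
    identity, so the rest of the curve stays in place.\<close>
  define cl where "cl h = max 0 (min 1 (M + 1 - h))" for h :: real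
  have cl: "continuous_on X cl" "cl h \<in> {0..1}" for X h
    unfolding cl_def by (intro continuous_intros) (auto simp: max_def min_def)
  have C1: "c0 1 = 1"
  proof -
    have "p' a = p a" using eq[of "a+1"] ab per by simp
    then have "C 1 = A 1" by (simp add: A_def C_def \<alpha>_def \<gamma>_def k_def)
    then show ?thesis using A0[of 1] by (simp add: c0_def)
  qed
  show ?thesis
  proof (rule isotopic_curves_levels[where c = "\<lambda>h. c0 (cl h)" and m = "\<lambda>h. \<beta> (cl h)" and e = "\<lambda>h. 0"])
    show "continuous_on UNIV (\<lambda>h. c0 (cl h))"
      by (rule continuous_on_compose2[OF c0 cl(1)]) (use cl(2) in blast)
    show "continuous_on UNIV (\<lambda>h. \<beta> (cl h))"
      by (rule continuous_on_compose2[OF cs(3)[of UNIV] cl(1)]) simp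
    show "continuous_on UNIV (\<lambda>h::real. 0::complex)" by simp
    show "c0 (cl h) \<noteq> 0" for h using c0nz cl(2) by blast
    have main: "p' t = c0 (cl (z t)) * (p t - \<beta> (cl (z t))) + \<beta> (cl (z t)) + 0" if t: "t \<in> {a..a+1}" for t
    proof -
      consider "t \<in> {a..<b}" | "t \<in> {b..b+d}" | "t \<in> {b+d..a+1}" using t by fastforce
      then show ?thesis
      proof cases
        case 1
        define v where "v = (b - t) / k"
        have v: "v \<in> {0..1}" "v \<noteq> 0" using 1 k by (auto simp: v_def k_def)
        have "z t = M + 1 - v" using z1[of t] 1 k unfolding v_def k_def by (simp add: field_simps)
        then have "cl (z t) = v" using v by (simp add: cl_def)
        moreover have "b + (-k) * v = t" using k by (simp add: v_def)
        then have "\<alpha> v = p t" "\<gamma> v = p' t" by (simp_all add: \<alpha>_def \<gamma>_def)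
        moreover have "A v \<noteq> 0" using A0[OF v(1)] v(2) by simp
        ultimately show ?thesis by (simp add: c0_def A_def C_def)
      next
        case 2
        define v where "v = (t - b) / d"
        have v: "v \<in> {0..1}" using 2 ab by (auto simp: v_def)
        have "z t = M + 1 - v" using z2[OF 2] by (simp add: v_def)
        then have "cl (z t) = v" using v by (simp add: cl_def)
        moreover have "\<beta> v = p t" using ab by (simp add: v_def \<beta>_def)
        moreover have "p' t = p t" using 2 ab by (intro eq) auto
        ultimately show ?thesis by simp
      next
        case 3
        then have "cl (z t) = 1" using z3[OF 3] by (simp add: cl_def)
        moreover have "p' t = p t" using 3 ab by (intro eq) auto
        ultimately show ?thesis using C1 by simp
      qed
    qed
    show "p' t = c0 (cl (z t)) * (p t - \<beta> (cl (z t))) + \<beta> (cl (z t)) + 0" for t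
    proof -
      define t' where "t' = t - of_int \<lfloor>t - a\<rfloor>"
      have t': "t' \<in> {a..a+1}" unfolding t'_def by auto linarith+
      have i: "t' - t \<in> \<int>" by (simp add: t'_def)
      have "p' t' = p' t" "p t' = p t" "z t' = z t"
        using periodic_eq[of p', OF per(2) i] periodic_eq[of p, OF per(1) i] periodic_eq[of z, OF per(3) i] by auto
      then show ?thesis using main[OF t'] by simp
    qed
  qed
qed

text \<open>Having no undercrossing, the arc can be lifted above everything else by a change of
  height; it is then exchanged for the new one level by level. The new arc may cross the rest of the
  curve arbitrarily, since it passes above. Only just behind \<open>b\<close> crossings are
  excluded, by \<open>simple\<close> for \<open>p'\<close> and by \<open>b\<close> for
  \<open>p\<close>, to leave room for a steep descent.\<close>

lemma (in projected_curve) isotopic_reroute: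
  assumes ab: "a < b" "b < a + 1" and under: "{a..b} \<inter> under_times = {}"
    and a: "a \<notin> over_times" and b: "b \<notin> over_times"
    and p': "continuous_on UNIV p'" "\<And>t. p' (t + 1) = p' t" "\<And>t. t \<in> {b..a+1} \<Longrightarrow> p' t = p t"
    and simple: "d0 > 0" "\<And>t. t \<in> {b..b+d0} \<Longrightarrow> p' t \<notin> crossing_points p'"
    and der: "(p has_vector_derivative L) (at_left b)" "(p' has_vector_derivative L') (at_left b)"
      "(p has_vector_derivative R) (at_right b)" "0 \<notin> closed_segment L R" "0 \<notin> closed_segment L' R"
  shows "\<exists>z'. isotopic_curves (\<lambda>t. (p t, z t)) (\<lambda>t. (p' t, z' t))"
proof -
  have cross: "t \<in> over_times \<union> under_times" if "p s = p t" "s - t \<notin> \<int>" for s t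
    using that over_under_crossing crossing_iff[of t] by blast
  have "a \<in> {a..b}" "b \<in> {a..b}" using ab by auto
  then have "a \<notin> under_times" "b \<notin> under_times" using under by blast+
  then have nc: "a \<notin> over_times \<union> under_times" "b \<notin> over_times \<union> under_times" using a b by auto
  define T where "T = (over_times \<union> under_times) \<inter> {b..a+1}"
  have T: "finite T" using finite_crossing_times[of b "a+1"] unfolding T_def over_under_crossing
    by (auto simp: Int_def conj_commute)
  have "b \<notin> T" "a + 1 \<notin> T" using nc over_int[of "a+1" a] under_int[of "a+1" a] by (auto simp: T_def)
  then have Td: "\<forall>t\<in>T. 0 < min (t - b) (a + 1 - t)"
    unfolding T_def by (metis IntD2 atLeastAtMost_iff diff_gt_0_iff_gt min_less_iff_conj order_less_le T_def)
  obtain \<delta> where \<delta>: "\<delta> > 0" "\<And>t. t \<in> T \<Longrightarrow> \<delta> \<le> t - b \<and> \<delta> \<le> a + 1 - t"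
  proof (cases "T = {}")
    case True then show thesis using that[of 1] by simp
  next
    case False
    let ?F = "(\<lambda>t. min (t - b) (a + 1 - t)) ` T"
    have "Min ?F > 0" using T False Td by simp
    moreover have "Min ?F \<le> t - b \<and> Min ?F \<le> a + 1 - t" if "t \<in> T" for t
    proof -
      have "Min ?F \<le> min (t - b) (a + 1 - t)" by (rule Min_le) (use T that in auto)
      then show ?thesis by linarith
    qed
    ultimately show thesis by (rule that)
  qed
  obtain B where B: "\<And>t. \<bar>z t\<bar> \<le> B"
  proof -
    have "compact (z ` {0..1})" by (intro compact_continuous_image continuous_on_subset[OF continuous_z]) auto
    from compact_imp_bounded[OF this] obtain B where B: "\<forall>y\<in>z ` {0..1}. norm y \<le> B"
      unfolding bounded_iff by (elim exE)
    have "\<bar>z t\<bar> \<le> B" for t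
    proof -
      obtain t' where "t' \<in> {0..<0+1}" "t' - t \<in> \<int>" using representative by blast
      then have "z t' = z t" "t' \<in> {0..1}" using z_int by auto
      then have "norm (z t) \<le> B" using bspec[OF B imageI[of t' _ z]] by simp
      then show ?thesis by simp
    qed
    then show thesis by (rule that)
  qed
  have B0: "B \<ge> 0" using B[of 0] by linarith
  define M where "M = B + 1"
  \<comment> \<open>All other crossing times are at least \<open>\<delta>\<close> away from
    \<open>b\<close> and \<open>a + 1\<close>. Within that time a ramp of slope
    \<open>- 1 / d\<close> drops by at least \<open>2 * B + 3\<close>, from
    \<open>M + 1 = B + 2\<close> to below the minimum \<open>- B\<close> of the old height.\<close>
  define d where "d = min (min \<delta> d0) (a + 1 - b) / (2 * B + 3)"
  have m0: "min (min \<delta> d0) (a + 1 - b) > 0" using \<delta>(1) simple(1) ab by simp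
  have d: "d > 0" using B0 m0 by (simp add: d_def)
  have md: "min (min \<delta> d0) (a + 1 - b) = d * (2 * B + 3)" using B0 by (simp add: d_def)
  have "d * 3 \<le> d * (2 * B + 3)" using B0 d by (intro mult_left_mono) auto
  then have d3: "d < \<delta>" "d < d0" "2 * d < a + 1 - b" "d * (2 * B + 3) \<le> \<delta>" "d * (2 * B + 3) \<le> a + 1 - b"
  proof -
    have "d * (2 * B + 3) \<le> \<delta>" "d * (2 * B + 3) \<le> d0" "d * (2 * B + 3) \<le> a + 1 - b" using md by linarith+
    then show "d < \<delta>" "d < d0" "2 * d < a + 1 - b" "d * (2 * B + 3) \<le> \<delta>" "d * (2 * B + 3) \<le> a + 1 - b"
      using \<open>d * 3 \<le> d * (2 * B + 3)\<close> d by linarith+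
  qed
  \<comment> \<open>On the arc a linear climb from \<open>M\<close> to \<open>M + 1\<close>;
    elsewhere the maximum of the old height and two steep ramps, one down from the end of the arc
    and one up to its next beginning at \<open>a + 1\<close>.\<close>
  define f where "f t = (if t \<le> b then M + (t - a) / (b - a)
      else max (z t) (max (M + 1 - (t - b) / d) (M - (a + 1 - t) / d)))" for t
  have zM: "z t < M" "- B \<le> z t" for t using B[of t] by (auto simp: M_def)
  have fb: "max (z b) (max (M + 1 - (b - b) / d) (M - (a + 1 - b) / d)) = M + (b - a) / (b - a)"
  proof -
    have 0: "(a + 1 - b) / d \<ge> 0" using ab d by simp
    have 1: "(b - a) / (b - a) = 1" "(b - b) / d = 0" using ab by simp_all
    have "z b < M" by (rule zM)
    then show ?thesis using 0 unfolding 1 by linarith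
  qed
  have f1: "continuous_on {a..a+1} f"
  proof -
    have "continuous_on ({a..b} \<union> {b..a+1}) f" unfolding f_def
    proof (rule continuous_on_cases)
      show "continuous_on {a..b} (\<lambda>t. M + (t - a) / (b - a))" using ab by (intro continuous_intros) auto
      show "continuous_on {b..a+1} (\<lambda>t. max (z t) (max (M + 1 - (t - b) / d) (M - (a + 1 - t) / d)))"
        using d by (intro continuous_intros continuous_on_subset[OF continuous_z]) auto
      show "\<forall>t. t \<in> {a..b} \<and> \<not> t \<le> b \<or> t \<in> {b..a+1} \<and> t \<le> b \<longrightarrow> M + (t - a) / (b - a)
          = max (z t) (max (M + 1 - (t - b) / d) (M - (a + 1 - t) / d))"
        using fb by (auto simp: order_antisym_conv)
    qed auto
    then show ?thesis using ab by (simp add: ivl_disj_un)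
  qed
  have fe: "f a = f (a + 1)"
  proof -
    have "(a + 1 - b) / d \<ge> 1" using d3(3) d by simp
    then show ?thesis using ab zM(1)[of "a+1"] by (auto simp: f_def max_def)
  qed
  define z' where "z' t = f (t - of_int \<lfloor>t - a\<rfloor>)" for t
  have z': "continuous_on UNIV z'" "\<And>t. z' (t + 1) = z' t" "\<And>t. t \<in> {a..a+1} \<Longrightarrow> z' t = f t"
    unfolding z'_def using continuous_periodic_extension[OF f1 fe] by auto
  have z'_int: "z' s = z' t" if "s - t \<in> \<int>" for s t by (rule periodic_eq[of z', OF z'(2) that])
  \<comment> \<open>At crossing times off the arc the height is unchanged and below
    \<open>M\<close>, hence below the arc. So the change of height respects the order at every
    crossing.\<close>
  have fz: "f t = z t" if t: "t \<in> T" for t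
  proof -
    have "d * (2 * B + 3) \<le> t - b" "d * (2 * B + 3) \<le> a + 1 - t" using \<delta>(2)[OF t] d3(4) by auto
    then have "2 * B + 3 \<le> (t - b) / d" "2 * B + 3 \<le> (a + 1 - t) / d"
      using d by (simp_all add: pos_le_divide_eq mult.commute)
    then have "M + 1 - (t - b) / d \<le> z t" "M - (a + 1 - t) / d \<le> z t" using zM(2)[of t] by (auto simp: M_def)
    moreover have "\<not> t \<le> b" using t \<open>b \<notin> T\<close> by (auto simp: T_def)
    ultimately show ?thesis by (simp add: f_def)
  qed
  have ord: "z' s < z' t" if st: "p s = p t" "z s < z t" for s t
  proof -
    obtain s' where s': "s' \<in> {a..<a+1}" "s' - s \<in> \<int>" using representative by blast
    obtain t' where t': "t' \<in> {a..<a+1}" "t' - t \<in> \<int>" using representative by blast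
    have e: "p s' = p t'" "z s' < z t'" "z' s = f s'" "z' t = f t'"
      using st p_int[OF s'(2)] p_int[OF t'(2)] z_int[OF s'(2)] z_int[OF t'(2)]
        z'_int[OF s'(2)] z'_int[OF t'(2)] z'(3)[of s'] z'(3)[of t'] s'(1) t'(1) by auto
    have u: "s' \<in> under_times" unfolding under_times_def using e by (intro CollectI exI[of _ t']) auto
    have o: "t' \<in> over_times" unfolding over_times_def using e by (intro CollectI exI[of _ s']) auto
    have "s' \<notin> {a..b}" using u under by blast
    then have "s' \<in> T" using u s'(1) by (auto simp: T_def)
    show ?thesis
    proof (cases "t' \<le> b")
      case True
      have "(t' - a) / (b - a) \<ge> 0" using t' ab by simp
      then have "f t' \<ge> M" using True by (simp add: f_def)
      then show ?thesis using fz[OF \<open>s' \<in> T\<close>] zM(1)[of s'] e by simp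
    next
      case False
      then have "t' \<in> T" using o t'(1) by (auto simp: T_def)
      then show ?thesis using fz[OF \<open>s' \<in> T\<close>] fz[OF \<open>t' \<in> T\<close>] e by simp
    qed
  qed
  have 1: "isotopic_curves (\<lambda>t. (p t, z t)) (\<lambda>t. (p t, z' t))"
    by (rule isotopic_height_change[OF z'(1,2) ord])
  have 2: "isotopic_curves (\<lambda>t. (p t, z' t)) (\<lambda>t. (p' t, z' t))"
  proof (rule isotopic_reroute_standard_height[where p = p and p' = p' and z = z' and a = a and b = b
          and d = d and M = M and L = L and L' = L' and R = R])
    show "a < b" "0 < d" by (rule ab(1), rule d)
    show "continuous_on UNIV p" "continuous_on UNIV p'" by (rule continuous_p, rule p'(1))
    show "p (t + 1) = p t" "p' (t + 1) = p' t" "z' (t + 1) = z' t" for t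
      by (rule p_periodic, rule p'(2), rule z'(2))
    show "p' t = p t" if "t \<in> {b..a+1}" for t by (rule p'(3)[OF that])
    show "b + d < a + 1" using d3(3) d by linarith
    show "z' t = M + (t - a) / (b - a)" if "t \<in> {a..b}" for t using that z'(3)[of t] ab by (simp add: f_def)
    show "z' t = M + 1 - (t - b) / d" if t: "t \<in> {b..b+d}" for t
    proof (cases "t = b")
      case True then show ?thesis using z'(3)[of t] ab by (simp add: f_def)
    next
      case False
      have 1: "(t - b) / d \<le> 1" using t d by simp
      have 2: "(a + 1 - t) / d \<ge> 0" using t d d3(3) by simp
      have 3: "t \<in> {a..a+1}" using t d d3(3) ab by simp
      have "z' t = max (z t) (max (M + 1 - (t - b) / d) (M - (a + 1 - t) / d))"
        using z'(3)[OF 3] t False unfolding f_def by simp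
      then show ?thesis using 1 2 zM(1)[of t] by linarith
    qed
    show "z' t \<le> M" if t: "t \<in> {b+d..a+1}" for t
    proof -
      have 1: "(t - b) / d \<ge> 1" using t d by simp
      have 2: "(a + 1 - t) / d \<ge> 0" using t d by simp
      have 3: "t \<in> {a..a+1}" using t d ab by simp
      have "z' t = max (z t) (max (M + 1 - (t - b) / d) (M - (a + 1 - t) / d))"
        using z'(3)[OF 3] t d unfolding f_def by simp
      then show ?thesis using 1 2 zM(1)[of t] by linarith
    qed
    show "p s \<noteq> p t \<and> p' s \<noteq> p' t" if s: "s \<in> {a..<b}" and t: "t \<in> {b..b+d}" for s t
    proof -
      have "t \<notin> over_times \<union> under_times"
      proof
        assume "t \<in> over_times \<union> under_times"
        then have "t \<in> T" using t d3 by (auto simp: T_def)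
        then show False using \<delta>(2)[of t] t d3(1) by auto
      qed
      moreover have ni: "s - t \<notin> \<int>"
      proof
        assume "s - t \<in> \<int>"
        then obtain n where n: "s - t = of_int n" by (auto elim: Ints_cases)
        moreover have "-1 < s - t" "s - t < 0" using s t d3(3) d by auto
        ultimately have "-1 < real_of_int n" "real_of_int n < 0" by auto
        then have "real_of_int (-1) < real_of_int n" "real_of_int n < real_of_int 0" by simp_all
        then show False unfolding of_int_less_iff by linarith
      qed
      moreover have "p' s \<noteq> p' t"
      proof
        assume "p' s = p' t"
        then have "p' t \<in> crossing_points p'" using ni unfolding crossing_points_def by blast
        then show False using simple(2)[of t] t d3(2) by auto
      qed
      ultimately show ?thesis using cross by blast
    qed
  qed (rule der)+
  show ?thesis using isotopic_curves_trans[OF 1 2] by blast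
qed

text \<open>Without crossings every change of height is allowed. A height is chosen for which both
  the curve and the round circle meet each level in at most two points; an affine map of the level
  then takes one pair to the other, and finally the round circle is flattened.\<close>

lemma isotopic_round_circle:
  assumes per: "\<And>t. p (t + 1) = p t" "\<And>t. z (t + 1) = z t"
    and cont: "continuous_on UNIV p" "continuous_on UNIV z"
    and inj: "\<And>s t. p s = p t \<Longrightarrow> s - t \<in> \<int>"
    and der: "\<And>t. (p has_vector_derivative L t) (at_left t)" "\<And>t. (p has_vector_derivative R t) (at_right t)"
      "\<And>t. 0 \<notin> closed_segment (L t) (R t)"
  shows "isotopic_curves (\<lambda>t. (p t, z t)) (\<lambda>t. (cis (2 * pi * t), 0))"
proof -
  \<comment> \<open>Even in \<open>t\<close> and increasing from 0 to 1 on \<open>[0, 1/2]\<close>,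
    so that within a period each inner level contains the two points at the times \<open>v\<close>
    and \<open>- v\<close>.\<close>
  define z0 where "z0 t = (1 - cos (2 * pi * t)) / 2" for t :: real
  have trig: "cos (2 * pi * (t + 1)) = cos (2 * pi * t)" "cis (2 * pi * (t + 1)) = cis (2 * pi * t)" for t
  proof -
    have e: "2 * pi * (t + 1) = 2 * pi * t + 2 * pi" by (simp add: algebra_simps)
    show "cos (2 * pi * (t + 1)) = cos (2 * pi * t)" unfolding e by (rule cos_periodic)
    show "cis (2 * pi * (t + 1)) = cis (2 * pi * t)" unfolding e complex_eq_iff by (simp add: cos_periodic sin_periodic)
  qed
  have z0: "continuous_on UNIV z0" "z0 (t + 1) = z0 t" for t
    unfolding z0_def trig by (intro continuous_intros) simp_all
  have pc: "projected_curve q w" if h: "\<And>t. q (t + 1) = q t" "\<And>t. w (t + 1) = w t"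
    "continuous_on UNIV q" "continuous_on UNIV w" and i: "\<And>s t. q s = q t \<Longrightarrow> s - t \<in> \<int>" for q w
  proof
    have "crossing_points q = {}" unfolding crossing_points_def using i by fastforce
    then show "finite (crossing_points q)" by simp
    show "q (t + 1) = q t" "w (t + 1) = w t" for t by (rule h)+
    show "continuous_on UNIV q" "continuous_on UNIV w" by (rule h)+
    show "s - t \<in> \<int>" if "q s = q t" for s t by (rule i[OF that])
    show "r - s \<in> \<int> \<or> s - t \<in> \<int> \<or> r - t \<in> \<int>" if "q r = q s" for r s t using i[OF that] by blast
  qed
  interpret P: projected_curve p z by (rule pc[OF per cont inj])
  have 1: "isotopic_curves (\<lambda>t. (p t, z t)) (\<lambda>t. (p t, z0 t))"
  proof (rule P.isotopic_height_change[OF z0])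
    fix s t assume st: "p s = p t" "z s < z t"
    have "z s = z t" by (rule P.z_int[OF inj[OF st(1)]])
    then show "z0 s < z0 t" using st(2) by simp
  qed
  define A where "A v = p (0 + 1 * v) - p (0 + (-1) * v)" for v :: real
  define C where "C v = cis (2 * pi * v) - cis (- (2 * pi * v))" for v :: real
  have p1: "p (1 + (-1) * v) = p (0 + (-1) * v)" for v
    by (rule P.p_int) simp
  have A0: "A v = 0 \<longleftrightarrow> v = 0 \<or> v = 1/2" if v: "v \<in> {0..1/2}" for v
  proof
    assume "A v = 0"
    then have "2 * v \<in> \<int>" using inj[of v "-v"] by (simp add: A_def)
    then obtain n where n: "2 * v = of_int n" by (auto elim: Ints_cases)
    then have "0 \<le> real_of_int n" "real_of_int n \<le> 1" using v by auto
    then have "n = 0 \<or> n = 1" by linarith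
    then show "v = 0 \<or> v = 1/2" using n by auto
  next
    assume "v = 0 \<or> v = 1/2"
    then show "A v = 0"
    proof
      assume v: "v = 1/2"
      show ?thesis unfolding v A_def using p1[of "1/2"] by simp
    qed (simp add: A_def)
  qed
  have C0: "C v = 2 * \<i> * of_real (sin (2 * pi * v))" for v
    by (simp add: C_def complex_eq_iff)
  have trig0: "C v = 0" "cos (2 * pi * v) \<noteq> 0" if "v = 0 \<or> v = 1/2" for v
    unfolding C0 using that by (elim disjE; hypsubst; simp)+
  have Cnz: "C v \<noteq> 0" if "v \<in> {0..1/2}" "v \<noteq> 0" "v \<noteq> 1/2" for v
    using sin_gt_zero[of "2 * pi * v"] that unfolding C0 by auto
  \<comment> \<open>The strands at \<open>v\<close> and \<open>- v\<close> merge at the lowest and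
    the highest level, \<open>v = 0\<close> and \<open>v = 1/2\<close>. There the derivative of
    \<open>A\<close> is the sum of the two one-sided velocities, nonzero without a cusp.\<close>
  define DA where "DA v = (if v = 0 then R 0 + L 0 else L (1/2) + R (1/2))" for v :: real
  define DC where "DC v = 2 * \<i> * of_real (cos (2 * pi * v) * (2 * pi))" for v :: real
  define c0 where "c0 v = (if A v = 0 then DC v / DA v else C v / A v)" for v
  have nz: "DA v \<noteq> 0" for v
    using combination_neq_0[OF der(3)[of 0], of 1 1] combination_neq_0[OF der(3)[of "1/2"], of 1 1]
    by (auto simp: DA_def add.commute)
  have cp: "continuous_on X p" for X using cont(1) continuous_on_subset by blast
  have c0: "continuous_on {0..1/2} c0" unfolding c0_def
  proof (rule continuous_on_ratio)
    show "continuous_on {0..1/2} C" unfolding C_def by (intro continuous_intros)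
    show "continuous_on {0..1/2} A" unfolding A_def
      by (intro continuous_intros continuous_on_compose2[OF cp[of UNIV]]) auto
    fix v :: real assume v: "v \<in> {0..1/2}" "A v = 0"
    then have v': "v = 0 \<or> v = 1/2" using A0 by blast
    have "(C has_vector_derivative DC v) (at v within {0..1/2})"
      unfolding C0[abs_def] DC_def has_vector_derivative_complex_iff
      by (auto intro!: derivative_eq_intros)
    moreover have "C v = 0" by (rule trig0(1)[OF v'])
    moreover have "(A has_vector_derivative DA v) (at v within {0..1/2})"
      using v'
    proof
      assume v0: "v = 0"
      have "((\<lambda>v. p (0 + 1 * v)) has_vector_derivative of_real 1 * R 0) (at_right 0)"
        by (rule has_vector_derivative_reflect[OF der(2)]) auto
      moreover have "((\<lambda>v. p (0 + (-1) * v)) has_vector_derivative of_real (-1) * L 0) (at_right 0)"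
        by (rule has_vector_derivative_reflect[OF der(1)]) auto
      ultimately have "(A has_vector_derivative of_real 1 * R 0 - of_real (-1) * L 0) (at_right 0)"
        unfolding A_def[abs_def] by (rule has_vector_derivative_diff)
      then show ?thesis using v0 by (simp add: DA_def at_within_Icc_at_right)
    next
      assume v0: "v = 1/2"
      have "((\<lambda>v. p (0 + 1 * v)) has_vector_derivative of_real 1 * L (1/2)) (at_left (1/2))"
        by (rule has_vector_derivative_reflect[OF der(1)]) auto
      moreover have "((\<lambda>v. p (1 + (-1) * v)) has_vector_derivative of_real (-1) * R (1/2)) (at_left (1/2))"
        by (rule has_vector_derivative_reflect[OF der(2)]) auto
      ultimately have "(A has_vector_derivative of_real 1 * L (1/2) - of_real (-1) * R (1/2)) (at_left (1/2))"
        unfolding A_def[abs_def] p1 by (rule has_vector_derivative_diff)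
      then show ?thesis unfolding v0 by (simp add: DA_def at_within_Icc_at_left)
    qed
    ultimately show "C v = 0 \<and> (C has_vector_derivative DC v) (at v within {0..1/2}) \<and>
        (A has_vector_derivative DA v) (at v within {0..1/2}) \<and> DA v \<noteq> 0" using nz by blast
  qed
  have c0nz: "c0 v \<noteq> 0" if v: "v \<in> {0..1/2}" for v
  proof (cases "A v = 0")
    case True
    then have "v = 0 \<or> v = 1/2" using A0[OF v] by blast
    then have "DC v \<noteq> 0" using trig0(2)[of v] by (simp add: DC_def)
    then show ?thesis using nz True by (simp add: c0_def)
  next
    case False
    then show ?thesis using Cnz[OF v] A0[OF v] by (simp add: c0_def)
  qed
  \<comment> \<open>The inverse of \<open>z0\<close> on \<open>[0, 1/2]\<close>, continued by
    constants, because an isotopy of space needs a map on every level.\<close>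
  define ht where "ht h = arccos (1 - 2 * max 0 (min 1 h)) / (2 * pi)" for h :: real
  have ht: "continuous_on UNIV ht" "ht h \<in> {0..1/2}" for h
  proof -
    show "continuous_on UNIV ht" unfolding ht_def by (intro continuous_intros) (auto simp: max_def min_def)
    have b: "-1 \<le> 1 - 2 * max 0 (min 1 h)" "1 - 2 * max 0 (min 1 h) \<le> 1" by (auto simp: max_def min_def)
    show "ht h \<in> {0..1/2}" using arccos_lbound[OF b] arccos_ubound[OF b] unfolding ht_def by (simp add: field_simps)
  qed
  have ht_z0: "ht (z0 v) = v" if "v \<in> {0..1/2}" for v
  proof -
    have "max 0 (min 1 (z0 v)) = z0 v"
      using cos_le_one[of "2 * pi * v"] cos_ge_minus_one[of "2 * pi * v"] by (simp add: z0_def)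
    then have "ht (z0 v) = arccos (1 - 2 * z0 v) / (2 * pi)" unfolding ht_def by simp
    also have "1 - 2 * z0 v = cos (2 * pi * v)" unfolding z0_def by (simp add: field_simps)
    also have "arccos (cos (2 * pi * v)) = 2 * pi * v" using that by (intro arccos_cos) auto
    finally show ?thesis by simp
  qed
  have 2: "isotopic_curves (\<lambda>t. (p t, z0 t)) (\<lambda>t. (cis (2 * pi * t), z0 t))"
  proof (rule isotopic_curves_levels[where c = "\<lambda>h. c0 (ht h)" and m = "\<lambda>h. p (- ht h)"
        and e = "\<lambda>h. cis (- (2 * pi * ht h)) - p (- ht h)"])
    show "continuous_on UNIV (\<lambda>h. c0 (ht h))" by (rule continuous_on_compose2[OF c0 ht(1)]) (use ht(2) in blast)
    show 3: "continuous_on UNIV (\<lambda>h. p (- ht h))"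
      by (intro continuous_on_compose2[OF cont(1)] continuous_intros ht) auto
    show "continuous_on UNIV (\<lambda>h. cis (- (2 * pi * ht h)) - p (- ht h))"
      by (intro continuous_intros 3 ht)
    show "c0 (ht h) \<noteq> 0" for h using c0nz ht(2) by blast
    have pos: "cis (2 * pi * v) = c0 v * (p v - p (- v)) + p (- v) + (cis (- (2 * pi * v)) - p (- v))"
      if v: "v \<in> {0..1/2}" for v
    proof (cases "A v = 0")
      case True
      then have e: "p v = p (-v)" and "v = 0 \<or> v = 1/2" using A0[OF v] by (auto simp: A_def)
      then have "C v = 0" using trig0(1) by blast
      then show ?thesis using e by (simp add: C_def)
    next
      case False
      then have "c0 v * (p v - p (- v)) = C v" by (simp add: c0_def A_def)
      then show ?thesis by (simp add: C_def)
    qed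
    have main: "cis (2 * pi * t) = c0 (ht (z0 t)) * (p t - p (- ht (z0 t))) + p (- ht (z0 t))
        + (cis (- (2 * pi * ht (z0 t))) - p (- ht (z0 t)))" if t: "t \<in> {-1/2..1/2}" for t
    proof (cases "t \<ge> 0")
      case True
      then have t': "t \<in> {0..1/2}" using t by simp
      show ?thesis unfolding ht_z0[OF t'] by (rule pos[OF t'])
    next
      case False
      then have "-t \<in> {0..1/2}" using t by simp
      then have "ht (z0 (-t)) = -t" by (rule ht_z0)
      moreover have "z0 (-t) = z0 t" by (simp add: z0_def)
      ultimately have "ht (z0 t) = -t" by simp
      then show ?thesis by simp
    qed
    show "cis (2 * pi * t) = c0 (ht (z0 t)) * (p t - p (- ht (z0 t))) + p (- ht (z0 t))
        + (cis (- (2 * pi * ht (z0 t))) - p (- ht (z0 t)))" for t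
    proof -
      obtain t' where t': "t' \<in> {-1/2..<-1/2+1}" "t' - t \<in> \<int>" using P.representative by blast
      have "z0 t' = z0 t" by (rule periodic_eq[of z0, OF z0(2) t'(2)])
      moreover have "cis (2 * pi * t') = cis (2 * pi * t)"
        by (rule periodic_eq[of "\<lambda>t. cis (2 * pi * t)", OF trig(2) t'(2)])
      ultimately show ?thesis using main[of t'] t'(1) P.p_int[OF t'(2)] by simp
    qed
  qed
  interpret Q: projected_curve "\<lambda>t. cis (2 * pi * t)" z0
  proof (rule pc)
    fix s t assume "cis (2 * pi * s) = cis (2 * pi * t)"
    then have "sin (2 * pi * s) = sin (2 * pi * t) \<and> cos (2 * pi * s) = cos (2 * pi * t)"
      by (simp only: complex_eq_iff cis.simps)
    then obtain n where "2 * pi * s = 2 * pi * t + 2 * pi * of_int n"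
      unfolding sin_cos_eq_iff by (elim exE)
    then have "2 * pi * (s - t) = 2 * pi * of_int n" by (simp add: algebra_simps)
    then have "s - t = of_int n" by simp
    then show "s - t \<in> \<int>" by simp
  qed (auto simp: trig z0 intro!: continuous_intros)
  have 3: "isotopic_curves (\<lambda>t. (cis (2 * pi * t), z0 t)) (\<lambda>t. (cis (2 * pi * t), 0))"
  proof (rule Q.isotopic_height_change)
    fix s t assume h: "cis (2 * pi * s) = cis (2 * pi * t)" "z0 s < z0 t"
    have "Re (cis (2 * pi * s)) = Re (cis (2 * pi * t))" using h(1) by simp
    then have "z0 s = z0 t" by (simp add: z0_def)
    then show "(0::real) < 0" using h(2) by simp
  qed auto
  show ?thesis using isotopic_curves_trans[OF isotopic_curves_trans[OF 1 2] 3] .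
qed

section \<open>Immersed plane curves\<close>

text \<open>The determinant of two plane vectors. Its sign tells on which side of \<open>v\<close>
  the vector \<open>w\<close> points.\<close>

definition cross2 :: "complex \<Rightarrow> complex \<Rightarrow> real" where
  "cross2 v w = Re v * Im w - Im v * Re w"

lemma cross2_inner: "cross2 v w = v \<bullet> (- \<i> * w)"
  by (simp add: cross2_def inner_complex_def)

lemma cross2_self [simp]: "cross2 v v = 0"
  by (simp add: cross2_def)

lemma cross2_scale [simp]: "cross2 (of_real x * v) w = x * cross2 v w" "cross2 v (of_real x * w) = x * cross2 v w"
  by (simp_all add: cross2_def algebra_simps)

lemma cross2_minus [simp]: "cross2 (- v) w = - cross2 v w" "cross2 v (- w) = - cross2 v w"
  by (simp_all add: cross2_def)

lemma cross2_commute: "cross2 w v = - cross2 v w"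
  by (simp add: cross2_def)

lemma cross2_add: "cross2 (u + v) w = cross2 u w + cross2 v w" "cross2 u (v + w) = cross2 u v + cross2 u w"
  by (simp_all add: cross2_def algebra_simps)

lemma continuous_on_cross2 [continuous_intros]:
  "continuous_on S f \<Longrightarrow> continuous_on S g \<Longrightarrow> continuous_on S (\<lambda>x. cross2 (f x) (g x))"
  unfolding cross2_def by (intro continuous_intros)

lemma collinear_cross2: "collinear {0, a, b} \<longleftrightarrow> cross2 a b = 0"
proof
  assume "collinear {0, a, b}"
  then consider "a = 0" | "b = 0" | c where "b = c *\<^sub>R a" unfolding collinear_lemma by auto
  then show "cross2 a b = 0" by cases (auto simp: cross2_def algebra_simps)
next
  assume z: "cross2 a b = 0"
  show "collinear {0, a, b}"
  proof (cases "a = 0")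
    case False
    have "(Re a)\<^sup>2 + (Im a)\<^sup>2 \<noteq> 0" using False by (simp add: complex_eq_iff sum_power2_eq_zero_iff)
    then have "b = ((a \<bullet> b) / ((Re a)\<^sup>2 + (Im a)\<^sup>2)) *\<^sub>R a"
      using z by (simp add: complex_eq_iff inner_complex_def cross2_def field_simps power2_eq_square)
    then show ?thesis unfolding collinear_lemma by blast
  qed simp
qed

lemma cross2_pos_nbhd:
  assumes "cross2 v w > 0"
  shows "\<exists>e>0. \<exists>m>0. \<forall>v'\<in>ball v e. \<forall>w'\<in>ball w e. cross2 v' w' \<ge> m"
proof -
  let ?m = "cross2 v w / 2"
  have "open {x. ?m < cross2 (fst x) (snd x)}" by (intro open_Collect_less continuous_intros)
  moreover have "(v, w) \<in> {x. ?m < cross2 (fst x) (snd x)}" using assms by simp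
  ultimately obtain e where e: "e > 0" "ball (v, w) e \<subseteq> {x. ?m < cross2 (fst x) (snd x)}"
    by (metis open_contains_ball)
  have "cross2 v' w' \<ge> ?m" if "v' \<in> ball v (e/2)" "w' \<in> ball w (e/2)" for v' w'
  proof -
    have "dist (v, w) (v', w') \<le> dist v v' + dist w w'"
      using sqrt_sum_squares_le_sum[of "dist v v'" "dist w w'"] by (simp add: dist_Pair_Pair)
    then have "(v', w') \<in> ball (v, w) e" using that by simp
    then show ?thesis using e(2) by fastforce
  qed
  then show ?thesis using e(1) assms by (intro exI[of _ "e/2"] conjI exI[of _ ?m]) auto
qed

text \<open>The determinant with \<open>w\<close> isolates \<open>x\<close>, that with
  \<open>v\<close> isolates \<open>y\<close>, and both are bounded by Cauchy-Schwarz. This is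
  transversality in quantitative form: near a crossing two strands separate at a linear
  rate.\<close>

lemma cross2_independent:
  assumes "cross2 v w \<noteq> 0"
  obtains \<mu> where "\<mu> > 0" "\<And>x y. norm (x *\<^sub>R v - y *\<^sub>R w) \<ge> \<mu> * (\<bar>x\<bar> + \<bar>y\<bar>)"
proof -
  define K where "K = norm v + norm w"
  have nz: "v \<noteq> 0" "w \<noteq> 0" using assms by (auto simp: cross2_def)
  then have K: "K > 0" by (simp add: K_def add_pos_pos)
  have bound: "\<bar>cross2 u u'\<bar> \<le> norm u * norm u'" for u u'
    using Cauchy_Schwarz_ineq2[of u "- \<i> * u'"] by (simp add: cross2_inner norm_mult)
  have "norm (x *\<^sub>R v - y *\<^sub>R w) * K \<ge> \<bar>cross2 v w\<bar> * (\<bar>x\<bar> + \<bar>y\<bar>)" for x y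
  proof -
    let ?d = "x *\<^sub>R v - y *\<^sub>R w"
    have "cross2 ?d w = x * cross2 v w" "cross2 ?d v = y * cross2 v w"
      by (simp_all add: cross2_def algebra_simps)
    then have "\<bar>x\<bar> * \<bar>cross2 v w\<bar> \<le> norm ?d * norm w" "\<bar>y\<bar> * \<bar>cross2 v w\<bar> \<le> norm ?d * norm v"
      using bound[of ?d w] bound[of ?d v] by (simp_all add: abs_mult)
    then show ?thesis by (simp add: K_def algebra_simps)
  qed
  then have "norm (x *\<^sub>R v - y *\<^sub>R w) \<ge> \<bar>cross2 v w\<bar> / K * (\<bar>x\<bar> + \<bar>y\<bar>)" for x y
    using K by (simp add: field_simps)
  moreover have "\<bar>cross2 v w\<bar> / K > 0" using assms K by simp
  ultimately show thesis using that by blast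
qed

text \<open>Compactness replaces a smallness of \<open>d\<close> that depends on the point by one
  that does not. The uniform properties of sufficiently close parallel arcs are reduced in this way
  to local ones.\<close>

lemma eventually_ball_compact:
  assumes K: "compact K"
    and loc: "\<And>x. x \<in> K \<Longrightarrow> \<exists>U. open U \<and> x \<in> U \<and> (\<forall>\<^sub>F d in F. \<forall>y\<in>U \<inter> K. P d y)"
  shows "\<forall>\<^sub>F d in F. \<forall>y\<in>K. P d y"
proof -
  obtain U where U: "\<And>x. x \<in> K \<Longrightarrow> open (U x) \<and> x \<in> U x \<and> (\<forall>\<^sub>F d in F. \<forall>y\<in>U x \<inter> K. P d y)"
    using loc by metis
  have "K \<subseteq> (\<Union>x\<in>K. U x)" using U by blast
  then obtain X where X: "X \<subseteq> K" "finite X" "K \<subseteq> (\<Union>x\<in>X. U x)"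
    using compactE_image[OF K, of K U] U by metis
  have "\<forall>\<^sub>F d in F. \<forall>x\<in>X. \<forall>y\<in>U x \<inter> K. P d y"
    using X(1,2) U by (intro eventually_ball_finite) auto
  then show ?thesis by eventually_elim (use X(3) in blast)
qed

section \<open>Piecewise continuously differentiable immersions\<close>

locale immersed_curve =
  fixes p L R :: "real \<Rightarrow> complex"
  assumes periodic: "p (t + 1) = p t"
    and finite_corners: "finite {t \<in> {0..<1}. L t \<noteq> R t}"
    and left: "(p has_vector_derivative L t) (at_left t)"
    and right: "(p has_vector_derivative R t) (at_right t)"
    and lim_left: "(R \<longlongrightarrow> L t) (at_left t)"
    and lim_right: "(R \<longlongrightarrow> R t) (at_right t)"
    and no_cusp: "0 \<notin> closed_segment (L t) (R t)"
begin

lemma continuous: "continuous_on X p"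
proof -
  have "isCont p t" for t
    unfolding isCont_def
  proof (rule filterlim_split_at)
    show "(p \<longlongrightarrow> p t) (at_left t)" "(p \<longlongrightarrow> p t) (at_right t)"
      using has_vector_derivative_continuous[OF left] has_vector_derivative_continuous[OF right]
      by (simp_all add: continuous_within)
  qed
  then show ?thesis by (simp add: continuous_at_imp_continuous_on)
qed

lemma two_sided:
  assumes "L t = R t" shows "(p has_vector_derivative R t) (at t)"
  using left[of t] right[of t] unfolding assms has_vector_derivative_def has_derivative_iff_norm
  by (blast intro: filterlim_split_at)

lemma derivative_unique:
  assumes "(p has_vector_derivative v) (at t)" shows "L t = v" "R t = v"
proof -
  have "(p has_vector_derivative v) (at_left t)" "(p has_vector_derivative v) (at_right t)"
    using assms by (auto intro: has_vector_derivative_at_within)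
  then show "L t = v" "R t = v"
    using vector_derivative_unique_within[OF _ left] vector_derivative_unique_within[OF _ right] by simp_all
qed

text \<open>Not postulated, but forced by the uniqueness of one-sided derivatives.\<close>

lemma velocity_periodic: "L (t + 1) = L t" "R (t + 1) = R t"
proof -
  have "((\<lambda>v. p (1 + 1 * v)) has_vector_derivative of_real 1 * L (t + 1)) (at_left t)"
    by (rule has_vector_derivative_reflect[OF left]) auto
  moreover have "((\<lambda>v. p (1 + 1 * v)) has_vector_derivative of_real 1 * R (t + 1)) (at_right t)"
    by (rule has_vector_derivative_reflect[OF right]) auto
  moreover have "(\<lambda>v. p (1 + 1 * v)) = p" using periodic by (auto simp: add.commute)
  ultimately have "(p has_vector_derivative L (t + 1)) (at_left t)" "(p has_vector_derivative R (t + 1)) (at_right t)"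
    by simp_all
  then show "L (t + 1) = L t" "R (t + 1) = R t"
    using vector_derivative_unique_within[OF _ left[of t]] vector_derivative_unique_within[OF _ right[of t]] by simp_all
qed

lemma finite_corners_Icc: "finite {t \<in> {a..b}. L t \<noteq> R t}"
proof -
  let ?C = "{t \<in> {0..<1}. L t \<noteq> R t}"
  have "{t \<in> {a..b}. L t \<noteq> R t} \<subseteq> (\<lambda>(c, n). c + of_int n) ` (?C \<times> {\<lfloor>a\<rfloor>..\<lfloor>b\<rfloor>})"
  proof
    fix t assume t: "t \<in> {t \<in> {a..b}. L t \<noteq> R t}"
    let ?n = "\<lfloor>t\<rfloor>"
    have i: "t - of_int ?n - t \<in> \<int>" by simp
    have "L (t - of_int ?n) = L t" "R (t - of_int ?n) = R t"
      using periodic_eq[of L, OF velocity_periodic(1) i] periodic_eq[of R, OF velocity_periodic(2) i] by auto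
    then have "t - of_int ?n \<in> ?C" using t by (auto simp: less_diff_eq) linarith+
    moreover have "?n \<in> {\<lfloor>a\<rfloor>..\<lfloor>b\<rfloor>}" using t by (auto intro: floor_mono)
    ultimately show "t \<in> (\<lambda>(c, n). c + of_int n) ` (?C \<times> {\<lfloor>a\<rfloor>..\<lfloor>b\<rfloor>})"
      by (intro image_eqI[of _ _ "(t - of_int ?n, ?n)"]) auto
  qed
  then show ?thesis by (rule finite_subset) (use finite_corners in auto)
qed

lemma fundamental_theorem:
  assumes "s \<le> t" shows "(R has_integral (p t - p s)) {s..t}"
proof (rule fundamental_theorem_of_calculus_interior_strong[OF finite_corners_Icc[of s t] assms _ continuous])
  fix x assume "x \<in> {s<..<t} - {u \<in> {s..t}. L u \<noteq> R u}"
  then have "L x = R x" by auto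
  then show "(p has_vector_derivative R x) (at x)" by (rule two_sided)
qed

text \<open>Integration of the velocity. For \<open>m > 0\<close> it yields injectivity wherever all
  velocities lie in one open half-plane, also across corners.\<close>

lemma cone_lower_bound:
  assumes "s \<le> t" "\<And>u. u \<in> {s..t} \<Longrightarrow> R u \<bullet> e \<ge> m"
  shows "(p t - p s) \<bullet> e \<ge> m * (t - s)"
proof -
  have "((\<lambda>u. R u \<bullet> e) has_integral ((p t - p s) \<bullet> e)) {s..t}"
    using has_integral_linear[OF fundamental_theorem[OF assms(1)] bounded_linear_inner_left[of e]]
    unfolding o_def .
  moreover have "((\<lambda>u. m) has_integral (t - s) *\<^sub>R m) {s..t}" using has_integral_const_real[of m s t] assms(1) by simp
  ultimately have "(t - s) *\<^sub>R m \<le> (p t - p s) \<bullet> e" using assms(2) has_integral_le by blast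
  then show ?thesis by (simp add: mult.commute)
qed

lemma near_linear:
  assumes "\<And>u. u \<in> closed_segment s t \<Longrightarrow> norm (R u - v) \<le> e" "e \<ge> 0"
  shows "norm (p t - p s - (t - s) *\<^sub>R v) \<le> e * \<bar>t - s\<bar>"
proof -
  have main: "norm (p t - p s - (t - s) *\<^sub>R v) \<le> e * \<bar>t - s\<bar>"
    if st: "s \<le> t" and b: "\<And>u. u \<in> {s..t} \<Longrightarrow> norm (R u - v) \<le> e" for s t
  proof -
    have "((\<lambda>u. R u - v) has_integral (p t - p s - (t - s) *\<^sub>R v)) {s..t}"
      using has_integral_diff[OF fundamental_theorem[OF st] has_integral_const_real[of v s t]] st by simp
    then show ?thesis
      using has_integral_bound[OF assms(2), of "\<lambda>u. R u - v" _ s t] b st by simp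
  qed
  show ?thesis
  proof (cases "s \<le> t")
    case True then show ?thesis using main[of s t] assms by (simp add: closed_segment_eq_real_ivl)
  next
    case False
    then have "norm (p s - p t - (s - t) *\<^sub>R v) \<le> e * \<bar>s - t\<bar>"
      using main[of t s] assms by (simp add: closed_segment_eq_real_ivl)
    moreover have "p s - p t - (s - t) *\<^sub>R v = - (p t - p s - (t - s) *\<^sub>R v)" by (simp add: algebra_simps)
    ultimately show ?thesis by (simp only: norm_minus_cancel abs_minus_commute)
  qed
qed

text \<open>Left velocities are controlled through \<open>R\<close>, of which they are the left
  limits.\<close>

lemma velocity_near_aux:
  assumes "(R \<longlongrightarrow> v) (at_left t)" "\<forall>u\<in>{c<..<t}. dist (R u) V < e" "c < t" shows "dist v V \<le> e"
proof -
  have "((\<lambda>u. dist (R u) V) \<longlongrightarrow> dist v V) (at_left t)" by (intro tendsto_intros assms)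
  moreover have "\<forall>\<^sub>F u in at_left t. dist (R u) V \<le> e"
    unfolding eventually_at_left_field using assms by (intro exI[of _ c]) (auto intro: less_imp_le)
  ultimately show ?thesis using tendsto_upperbound trivial_limit_at_left_real by blast
qed

lemma velocity_near:
  assumes "e > 0"
  obtains d where "d > 0" "\<And>u. u \<in> {t-d<..<t} \<Longrightarrow> dist (R u) (L t) < e \<and> dist (L u) (L t) < e"
    "\<And>u. u \<in> {t<..<t+d} \<Longrightarrow> dist (R u) (R t) < e \<and> dist (L u) (R t) < e"
proof -
  have e2: "e / 2 > 0" using assms by simp
  obtain c1 where c1: "c1 < t" "\<And>u. u \<in> {c1<..<t} \<Longrightarrow> dist (R u) (L t) < e / 2"
    using tendstoD[OF lim_left e2, of t] unfolding eventually_at_left_field by auto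
  obtain c2 where c2: "c2 > t" "\<And>u. u \<in> {t<..<c2} \<Longrightarrow> dist (R u) (R t) < e / 2"
    using tendstoD[OF lim_right e2, of t] unfolding eventually_at_right_field by auto
  have l1: "dist (L u) (L t) < e" if "u \<in> {c1<..<t}" for u
    using velocity_near_aux[OF lim_left[of u], of c1 "L t" "e/2"] c1 that assms by fastforce
  have l2: "dist (L u) (R t) < e" if "u \<in> {t<..<c2}" for u
    using velocity_near_aux[OF lim_left[of u], of t "R t" "e/2"] c2 that assms by fastforce
  show thesis
  proof (rule that[of "min (t - c1) (c2 - t)"])
    show "min (t - c1) (c2 - t) > 0" using c1 c2 by simp
    show "dist (R u) (L t) < e \<and> dist (L u) (L t) < e" if "u \<in> {t - min (t - c1) (c2 - t)<..<t}" for u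
    proof -
      have "u \<in> {c1<..<t}" using that by auto
      then show ?thesis using l1 c1(2)[of u] assms by fastforce
    qed
    show "dist (R u) (R t) < e \<and> dist (L u) (R t) < e" if "u \<in> {t<..<t + min (t - c1) (c2 - t)}" for u
    proof -
      have "u \<in> {t<..<c2}" using that by auto
      then show ?thesis using l2 c2(2)[of u] assms by fastforce
    qed
  qed
qed

lemma velocity_near_union:
  assumes "e > 0"
  obtains d where "d > 0" "\<And>u. u \<in> ball t d \<Longrightarrow> R u \<in> ball (L t) e \<union> ball (R t) e"
    "\<And>u. u \<in> ball t d \<Longrightarrow> L u \<in> ball (L t) e \<union> ball (R t) e"
proof -
  obtain d where d: "d > 0" "\<And>u. u \<in> {t-d<..<t} \<Longrightarrow> dist (R u) (L t) < e \<and> dist (L u) (L t) < e"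
    "\<And>u. u \<in> {t<..<t+d} \<Longrightarrow> dist (R u) (R t) < e \<and> dist (L u) (R t) < e"
    using velocity_near[OF assms] by blast
  have "R u \<in> ball (L t) e \<union> ball (R t) e \<and> L u \<in> ball (L t) e \<union> ball (R t) e" if u: "u \<in> ball t d" for u
  proof -
    consider "u = t" | "u \<in> {t-d<..<t}" | "u \<in> {t<..<t+d}" using u by (fastforce simp: dist_real_def)
    then show ?thesis
    proof cases
      case 1 then show ?thesis using assms by simp
    next
      case 2 then show ?thesis using d(2)[of u] by (simp add: dist_commute)
    next
      case 3 then show ?thesis using d(3)[of u] by (simp add: dist_commute)
    qed
  qed
  then show thesis using that d(1) by blast
qed

lemma lim_L: "(L \<longlongrightarrow> L t) (at_left t)" "(L \<longlongrightarrow> R t) (at_right t)"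
proof -
  show "(L \<longlongrightarrow> L t) (at_left t)"
  proof (rule tendstoI)
    fix e :: real assume "e > 0"
    then obtain d where d: "d > 0" "\<And>u. u \<in> {t-d<..<t} \<Longrightarrow> dist (R u) (L t) < e \<and> dist (L u) (L t) < e"
      using velocity_near by metis
    then show "\<forall>\<^sub>F u in at_left t. dist (L u) (L t) < e"
      unfolding eventually_at_left_field by (intro exI[of _ "t - d"]) auto
  qed
  show "(L \<longlongrightarrow> R t) (at_right t)"
  proof (rule tendstoI)
    fix e :: real assume "e > 0"
    then obtain d where d: "d > 0" "\<And>u. u \<in> {t<..<t+d} \<Longrightarrow> dist (R u) (R t) < e \<and> dist (L u) (R t) < e"
      using velocity_near by metis
    then show "\<forall>\<^sub>F u in at_right t. dist (L u) (R t) < e"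
      unfolding eventually_at_right_field by (intro exI[of _ "t + d"]) auto
  qed
qed

text \<open>The segment between the one-sided velocities avoids 0, so a line separates it from 0.
  The normal of that line is a direction in which these velocities, and all nearby ones, point
  forward.\<close>

lemma forward_direction:
  obtains e m d where "m > 0" "d > 0" "\<And>u. u \<in> ball t d \<Longrightarrow> R u \<bullet> e \<ge> m \<and> L u \<bullet> e \<ge> m"
proof -
  obtain e b where e: "e \<noteq> 0" "b > 0" "\<And>x. x \<in> closed_segment (L t) (R t) \<Longrightarrow> e \<bullet> x > b"
    using separating_hyperplane_closed_0[OF convex_closed_segment closed_segment no_cusp[of t]] by blast
  have op: "open {x. b < e \<bullet> x}" by (intro open_Collect_less continuous_intros)
  have "L t \<in> {x. b < e \<bullet> x}" "R t \<in> {x. b < e \<bullet> x}" using e(3) by auto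
  then obtain e1 e2 where ee: "e1 > 0" "ball (L t) e1 \<subseteq> {x. b < e \<bullet> x}" "e2 > 0" "ball (R t) e2 \<subseteq> {x. b < e \<bullet> x}"
    using op unfolding open_contains_ball by blast
  then have "min e1 e2 > 0" by simp
  then obtain d where d: "d > 0" "\<And>u. u \<in> ball t d \<Longrightarrow> R u \<in> ball (L t) (min e1 e2) \<union> ball (R t) (min e1 e2)"
    "\<And>u. u \<in> ball t d \<Longrightarrow> L u \<in> ball (L t) (min e1 e2) \<union> ball (R t) (min e1 e2)"
    using velocity_near_union by blast
  have "R u \<bullet> e \<ge> b \<and> L u \<bullet> e \<ge> b" if "u \<in> ball t d" for u
  proof -
    have "R u \<in> {x. b < e \<bullet> x}" "L u \<in> {x. b < e \<bullet> x}" using d(2,3)[OF that] ee by fastforce+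
    then show ?thesis by (simp add: inner_commute less_imp_le)
  qed
  then show thesis using that e(2) d(1) by blast
qed

text \<open>\<open>w\<close> points to the side \<open>\<sigma>\<close> of the curve, as seen from
  both one-sided tangents.\<close>

definition transversal :: "real \<Rightarrow> real \<Rightarrow> complex \<Rightarrow> bool" where
  "transversal \<sigma> t w \<longleftrightarrow> \<sigma> * cross2 (L t) w > 0 \<and> \<sigma> * cross2 (R t) w > 0"

lemma transversal_nbhd:
  assumes "transversal \<sigma> t w" "\<sigma> = 1 \<or> \<sigma> = -1"
  obtains d e m where "d > 0" "e > 0" "m > 0"
    "\<And>s w'. s \<in> ball t d \<Longrightarrow> w' \<in> ball w e \<Longrightarrow> \<sigma> * cross2 (L s) w' \<ge> m \<and> \<sigma> * cross2 (R s) w' \<ge> m"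
proof -
  have c: "\<sigma> * cross2 v w' = cross2 v (of_real \<sigma> * w')" for v w' by simp
  have p: "cross2 (L t) (of_real \<sigma> * w) > 0" "cross2 (R t) (of_real \<sigma> * w) > 0"
    using assms(1) unfolding transversal_def c by simp_all
  obtain e1 m1 where e1: "e1 > 0" "m1 > 0"
    "\<And>v' w'. v' \<in> ball (L t) e1 \<Longrightarrow> w' \<in> ball (of_real \<sigma> * w) e1 \<Longrightarrow> cross2 v' w' \<ge> m1"
    using cross2_pos_nbhd[OF p(1)] by blast
  obtain e2 m2 where e2: "e2 > 0" "m2 > 0"
    "\<And>v' w'. v' \<in> ball (R t) e2 \<Longrightarrow> w' \<in> ball (of_real \<sigma> * w) e2 \<Longrightarrow> cross2 v' w' \<ge> m2"
    using cross2_pos_nbhd[OF p(2)] by blast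
  let ?e = "min e1 e2" and ?m = "min m1 m2"
  have "?e > 0" using e1 e2 by simp
  then obtain d where d: "d > 0" "\<And>u. u \<in> ball t d \<Longrightarrow> R u \<in> ball (L t) ?e \<union> ball (R t) ?e"
    "\<And>u. u \<in> ball t d \<Longrightarrow> L u \<in> ball (L t) ?e \<union> ball (R t) ?e"
    using velocity_near_union by blast
  have key: "cross2 v (of_real \<sigma> * w') \<ge> ?m" if v: "v \<in> ball (L t) ?e \<union> ball (R t) ?e" and w: "w' \<in> ball w ?e" for v w'
  proof -
    have "dist (of_real \<sigma> * w) (of_real \<sigma> * w') = dist w w'"
      using assms(2) by (auto simp: dist_norm norm_minus_commute)
    then have w2: "of_real \<sigma> * w' \<in> ball (of_real \<sigma> * w) e1" "of_real \<sigma> * w' \<in> ball (of_real \<sigma> * w) e2"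
      using w by auto
    from v have "v \<in> ball (L t) e1 \<or> v \<in> ball (R t) e2" by auto
    then show ?thesis using e1(3)[OF _ w2(1)] e2(3)[OF _ w2(2)] by fastforce
  qed
  show thesis
  proof (rule that[of d ?e ?m])
    show "0 < d" "0 < ?e" "0 < ?m" using d e1 e2 by simp_all
    show "?m \<le> \<sigma> * cross2 (L s) w' \<and> ?m \<le> \<sigma> * cross2 (R s) w'" if "s \<in> ball t d" "w' \<in> ball w ?e" for s w'
      unfolding c using key d(2,3)[OF that(1)] that(2) by blast
  qed
qed

text \<open>The intersection of two open half-planes. Convexity allows transversal vectors to be
  blended by a partition of unity.\<close>

lemma convex_transversal: "convex {w. transversal \<sigma> t w}"
proof -
  have "{w. transversal \<sigma> t w} = {w. (of_real \<sigma> * \<i> * L t) \<bullet> w > 0} \<inter> {w. (of_real \<sigma> * \<i> * R t) \<bullet> w > 0}"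
    by (auto simp: transversal_def cross2_def inner_complex_def algebra_simps)
  then show ?thesis by (simp add: convex_Int convex_halfspace_gt)
qed

text \<open>The forward direction turned by a right angle, towards the side
  \<open>\<sigma>\<close>.\<close>

lemma transversal_exists:
  assumes "\<sigma> = 1 \<or> \<sigma> = -1" shows "\<exists>w. transversal \<sigma> t w"
proof -
  obtain e m d where e: "m > 0" "d > 0" "\<And>u. u \<in> ball t d \<Longrightarrow> R u \<bullet> e \<ge> m \<and> L u \<bullet> e \<ge> m"
    using forward_direction[of t] by metis
  have c: "cross2 v (\<i> * e) = v \<bullet> e" for v by (simp add: cross2_inner mult.assoc[symmetric])
  have "\<sigma> * cross2 v (of_real \<sigma> * (\<i> * e)) = v \<bullet> e" for v
    unfolding cross2_scale c using assms by auto
  then have "transversal \<sigma> t (of_real \<sigma> * (\<i> * e))"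
    unfolding transversal_def using e(1) e(3)[of t] e(2) by (metis centre_in_ball less_le_trans)
  then show ?thesis by blast
qed

text \<open>A constant field works near each time. A partition of unity glues these fields, as the
  condition is convex; a polynomial approximation makes the result differentiable, as the condition
  is open; a linear correction restores the end values.\<close>

lemma transversal_field:
  assumes \<sigma>: "\<sigma> = 1 \<or> \<sigma> = -1" and uv: "u < v" and W: "transversal \<sigma> u wu" "transversal \<sigma> v wv"
  obtains w w' where "\<And>t. (w has_vector_derivative w' t) (at t)" "continuous_on UNIV w'"
    "w u = wu" "w v = wv" "\<And>t. t \<in> {u..v} \<Longrightarrow> transversal \<sigma> t (w t)"
proof -
  define f where "f t = (if t = u then wu else if t = v then wv else SOME w. transversal \<sigma> t w)" for t
  have f: "transversal \<sigma> t (f t)" for t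
    using W someI_ex[OF transversal_exists[OF \<sigma>, of t]] by (auto simp: f_def)
  \<comment> \<open>By the last condition an end point lies only in the neighbourhood chosen for
    that end, so the glued field has the prescribed value there.\<close>
  define N where "N t U \<longleftrightarrow> open U \<and> t \<in> U \<and> (\<forall>s\<in>U. transversal \<sigma> s (f t)) \<and> U \<inter> {u, v} \<subseteq> {t}" for t U
  have "\<exists>U. N t U" for t
  proof -
    obtain d e m where d: "d > 0" "e > 0" "m > 0"
      "\<And>s w'. s \<in> ball t d \<Longrightarrow> w' \<in> ball (f t) e \<Longrightarrow> \<sigma> * cross2 (L s) w' \<ge> m \<and> \<sigma> * cross2 (R s) w' \<ge> m"
      using transversal_nbhd[OF f \<sigma>] by blast
    have "transversal \<sigma> s (f t)" if "s \<in> ball t d" for s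
      using d(4)[OF that, of "f t"] d(2,3) by (simp add: transversal_def)
    moreover have "open (ball t d - ({u, v} - {t}))" by (intro open_Diff finite_imp_closed) auto
    ultimately have "N t (ball t d - ({u, v} - {t}))" using d(1) by (auto simp: N_def)
    then show ?thesis by blast
  qed
  then obtain U where U: "\<And>t. N t (U t)" by metis
  have "{u..v} \<subseteq> (\<Union>t\<in>{u..v}. U t)" using U by (auto simp: N_def)
  then obtain X where X: "X \<subseteq> {u..v}" "finite X" "{u..v} \<subseteq> (\<Union>t\<in>X. U t)"
    using compactE_image[OF compact_Icc, of "{u..v}" U u v] U unfolding N_def by metis
  define g where "g V = (SOME t. t \<in> X \<and> V = U t)" for V
  have g: "g V \<in> X \<and> V = U (g V)" if "V \<in> U ` X" for V
    unfolding g_def by (rule someI_ex) (use that in blast)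
  obtain F :: "[real set, real] \<Rightarrow> real" where F: "\<And>V. V \<in> U ` X \<Longrightarrow> continuous_on {u..v} (F V) \<and> (\<forall>x\<in>{u..v}. 0 \<le> F V x)"
    "\<And>x V. V \<in> U ` X \<Longrightarrow> x \<in> {u..v} \<Longrightarrow> x \<notin> V \<Longrightarrow> F V x = 0"
    "\<And>x. x \<in> {u..v} \<Longrightarrow> supp_sum (\<lambda>W. F W x) (U ` X) = 1"
  proof (rule subordinate_partition_of_unity[of "{u..v}" "U ` X"])
    show "{u..v} \<subseteq> \<Union> (U ` X)" using X(3) by simp
    show "open T" if "T \<in> U ` X" for T using that U by (auto simp: N_def)
    show "\<exists>V. open V \<and> x \<in> V \<and> finite {Ua \<in> U ` X. Ua \<inter> V \<noteq> {}}" if "x \<in> {u..v}" for x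
      using X(2) by (intro exI[of _ UNIV]) auto
  qed blast
  have sum1: "(\<Sum>V\<in>U ` X. F V x) = 1" if "x \<in> {u..v}" for x
  proof -
    have "supp_sum (\<lambda>W. F W x) (U ` X) = (\<Sum>V\<in>U ` X. F V x)"
      unfolding supp_sum_def support_on_def by (rule sum.mono_neutral_left) (use X(2) in auto)
    then show ?thesis using F(3)[OF that] by simp
  qed
  define h where "h x = (\<Sum>V\<in>U ` X. F V x *\<^sub>R f (g V))" for x
  have hc: "continuous_on {u..v} h" unfolding h_def using F(1) by (intro continuous_intros) auto
  have ht: "transversal \<sigma> x (h x)" if x: "x \<in> {u..v}" for x
  proof -
    let ?S = "{V \<in> U ` X. F V x \<noteq> 0}"
    have e: "h x = (\<Sum>V\<in>?S. F V x *\<^sub>R f (g V))" unfolding h_def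
      by (rule sum.mono_neutral_right) (use X(2) in auto)
    have s: "(\<Sum>V\<in>?S. F V x) = 1" unfolding sum1[OF x, symmetric]
      by (rule sum.mono_neutral_left) (use X(2) in auto)
    have "h x \<in> {w. transversal \<sigma> x w}" unfolding e
    proof (rule convex_sum[OF _ convex_transversal s])
      show "finite ?S" using X(2) by simp
      fix V assume V: "V \<in> ?S"
      then show "0 \<le> F V x" using F(1) x by blast
      have "x \<in> V" using V F(2) x by blast
      then show "f (g V) \<in> {w. transversal \<sigma> x w}" using g[of V] V U[of "g V"] unfolding N_def by blast
    qed
    then show ?thesis by simp
  qed
  have hend: "h x = f x" if x: "x = u \<or> x = v" for x
  proof -
    have xi: "x \<in> {u..v}" using x uv by auto
    have "F V x *\<^sub>R f (g V) = F V x *\<^sub>R f x" if V: "V \<in> U ` X" for V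
    proof (cases "x \<in> V")
      case True
      then have "x \<in> U (g V) \<inter> {u, v}" using g[OF V] x by auto
      then have "x = g V" using U[of "g V"] by (auto simp: N_def)
      then show ?thesis by simp
    qed (use F(2)[OF V xi] in simp)
    then have "h x = (\<Sum>V\<in>U ` X. F V x *\<^sub>R f x)" unfolding h_def by (rule sum.cong[OF refl])
    also have "\<dots> = f x" using sum1[OF xi] by (simp add: scaleR_left.sum[symmetric])
    finally show ?thesis .
  qed
  \<comment> \<open>Uniform room around \<open>h\<close>, so that a uniform approximation is still
    transversal.\<close>
  have "\<exists>e>0. \<forall>t\<in>{u..v}. \<forall>w\<in>ball (h t) e. transversal \<sigma> t w"
  proof -
    have "\<forall>\<^sub>F e in at_right 0. \<forall>t\<in>{u..v}. \<forall>w\<in>ball (h t) e. transversal \<sigma> t w"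
    proof (rule eventually_ball_compact[OF compact_Icc])
      fix t assume t: "t \<in> {u..v}"
      obtain d e m where d: "d > 0" "e > 0" "m > 0"
        "\<And>s w'. s \<in> ball t d \<Longrightarrow> w' \<in> ball (h t) e \<Longrightarrow> \<sigma> * cross2 (L s) w' \<ge> m \<and> \<sigma> * cross2 (R s) w' \<ge> m"
        using transversal_nbhd[OF ht[OF t] \<sigma>] by blast
      obtain d' where d': "d' > 0" "\<And>s. s \<in> {u..v} \<Longrightarrow> dist s t < d' \<Longrightarrow> dist (h s) (h t) < e / 2"
        using hc t d(2) unfolding continuous_on_iff by (metis half_gt_zero)
      have "transversal \<sigma> s w" if "e' < e / 2" "s \<in> ball t (min d d') \<inter> {u..v}" "w \<in> ball (h s) e'" for e' s w
      proof -
        have "dist (h t) w \<le> dist (h t) (h s) + dist (h s) w" by (rule dist_triangle)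
        moreover have "dist (h s) (h t) < e / 2" using d'(2)[of s] that by (simp add: dist_commute)
        ultimately have "w \<in> ball (h t) e" using that by (simp add: dist_commute)
        then show ?thesis using d(4)[of s w] that d(3) by (simp add: transversal_def)
      qed
      moreover have "\<forall>\<^sub>F e' in at_right 0. e' < e / 2" using d(2)
        by (intro order_tendstoD(2)[OF tendsto_ident_at]) auto
      ultimately have "\<forall>\<^sub>F e' in at_right 0. \<forall>s\<in>ball t (min d d') \<inter> {u..v}. \<forall>w\<in>ball (h s) e'. transversal \<sigma> s w"
        by (auto elim!: eventually_mono)
      moreover have "open (ball t (min d d'))" "t \<in> ball t (min d d')" using d(1) d'(1) by auto
      ultimately show "\<exists>U. open U \<and> t \<in> U \<and> (\<forall>\<^sub>F e in at_right 0. \<forall>t\<in>U \<inter> {u..v}. \<forall>w\<in>ball (h t) e. transversal \<sigma> t w)"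
        by blast
    qed
    then obtain b where b: "b > 0" "\<And>e. 0 < e \<Longrightarrow> e < b \<Longrightarrow> \<forall>t\<in>{u..v}. \<forall>w\<in>ball (h t) e. transversal \<sigma> t w"
      unfolding eventually_at_right_field by auto
    show ?thesis by (intro exI[of _ "b / 2"] conjI b(2)) (use b(1) in auto)
  qed
  then obtain e where e: "e > 0" "\<And>t w. t \<in> {u..v} \<Longrightarrow> w \<in> ball (h t) e \<Longrightarrow> transversal \<sigma> t w" by blast
  obtain P where P: "polynomial_function P" "\<And>t. t \<in> {u..v} \<Longrightarrow> norm (h t - P t) < e / 2"
    using Stone_Weierstrass_polynomial_function[OF compact_Icc hc, of "e / 2"] e(1) by auto
  obtain P' where P': "polynomial_function P'" "\<And>t. (P has_vector_derivative P' t) (at t)"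
    using has_vector_derivative_polynomial_function[OF P(1)] by blast
  define A where "A = f u - P u"
  define B where "B = f v - P v"
  \<comment> \<open>The errors of the polynomial at the ends are interpolated linearly and added.
    The weights sum to 1, so the correction is at most \<open>e / 2\<close>, which with the
    approximation error stays below \<open>e\<close>.\<close>
  define w where "w t = P t + ((v - t) / (v - u)) *\<^sub>R A + ((t - u) / (v - u)) *\<^sub>R B" for t
  define w' where "w' t = P' t + (- 1 / (v - u)) *\<^sub>R A + (1 / (v - u)) *\<^sub>R B" for t
  have AB: "norm A < e / 2" "norm B < e / 2" using P(2)[of u] P(2)[of v] hend[of u] hend[of v] uv
    by (auto simp: A_def B_def)
  show thesis
  proof (rule that[of w w'])
    show "(w has_vector_derivative w' t) (at t)" for t
    proof -
      have "((\<lambda>t. (v - t) / c) has_real_derivative - 1 / c) (at t)"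
        "((\<lambda>t. (t - u) / c) has_real_derivative 1 / c) (at t)" if "c \<noteq> 0" for c
        using that by (auto intro!: derivative_eq_intros)
      then have "((\<lambda>t. (v - t) / (v - u)) has_real_derivative - 1 / (v - u)) (at t)"
        "((\<lambda>t. (t - u) / (v - u)) has_real_derivative 1 / (v - u)) (at t)" using uv by auto
      from has_vector_derivative_scaleR[OF this(1) has_vector_derivative_const[of A]]
        has_vector_derivative_scaleR[OF this(2) has_vector_derivative_const[of B]]
      show ?thesis unfolding w_def w'_def by (intro has_vector_derivative_add P'(2)) simp_all
    qed
    have "continuous_on UNIV P'" by (rule continuous_on_polymonial_function[OF P'(1)])
    then show "continuous_on UNIV w'" unfolding w'_def by (intro continuous_intros)
    show "w u = wu" "w v = wv" using uv by (auto simp: w_def A_def B_def f_def)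
    show "transversal \<sigma> t (w t)" if t: "t \<in> {u..v}" for t
    proof (rule e(2)[OF t])
      have c: "((v - t) / (v - u)) + ((t - u) / (v - u)) = 1" using uv by (simp add: add_divide_distrib[symmetric])
      have "norm (((v - t) / (v - u)) *\<^sub>R A + ((t - u) / (v - u)) *\<^sub>R B)
          \<le> ((v - t) / (v - u)) * norm A + ((t - u) / (v - u)) * norm B"
        using t uv by (intro order_trans[OF norm_triangle_ineq]) simp
      also have "\<dots> \<le> ((v - t) / (v - u)) * (e / 2) + ((t - u) / (v - u)) * (e / 2)"
        using t uv AB by (intro add_mono mult_left_mono) auto
      also have "\<dots> = e / 2" using c by (metis distrib_right mult_1)
      finally have "norm (((v - t) / (v - u)) *\<^sub>R A + ((t - u) / (v - u)) *\<^sub>R B) \<le> e / 2" .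
      moreover have "h t - w t = (h t - P t) - (((v - t) / (v - u)) *\<^sub>R A + ((t - u) / (v - u)) *\<^sub>R B)"
        by (simp add: w_def)
      then have "dist (h t) (w t) \<le> norm (h t - P t) + norm (((v - t) / (v - u)) *\<^sub>R A + ((t - u) / (v - u)) *\<^sub>R B)"
        unfolding dist_norm by (metis norm_triangle_ineq4)
      ultimately show "w t \<in> ball (h t) e" using P(2)[OF t] by simp
    qed
  qed
qed

end

section \<open>Parallel arcs\<close>

lemma norm_diff_le_of_vector_derivative:
  fixes f :: "real \<Rightarrow> complex"
  assumes "\<And>t. t \<in> {u..v} \<Longrightarrow> (f has_vector_derivative f' t) (at t)" "\<And>t. t \<in> {u..v} \<Longrightarrow> norm (f' t) \<le> B"
    and "s \<in> {u..v}" "t \<in> {u..v}"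
  shows "norm (f s - f t) \<le> B * \<bar>s - t\<bar>"
proof -
  have "norm (f s - f t) \<le> B * norm (s - t)"
  proof (rule differentiable_bound[of "{u..v}"])
    show "(f has_derivative (\<lambda>h. h *\<^sub>R f' x)) (at x within {u..v})" if "x \<in> {u..v}" for x
      using assms(1)[OF that] unfolding has_vector_derivative_def by (rule has_derivative_at_withinI)
    show "onorm (\<lambda>h. h *\<^sub>R f' x) \<le> B" if "x \<in> {u..v}" for x
    proof (rule onorm_bound)
      show "0 \<le> B" using order_trans[OF norm_ge_zero assms(2)[OF that]] .
      show "norm (h *\<^sub>R f' x) \<le> B * norm h" for h
        using mult_left_mono[OF assms(2)[OF that] abs_ge_zero[of h]] by (simp add: mult.commute)
    qed
  qed (use assms in auto)
  then show ?thesis by simp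
qed

lemma eventually_at_right_0_less: "r > 0 \<Longrightarrow> \<forall>\<^sub>F d in at_right 0. 0 < d \<and> d < (r::real)"
  unfolding eventually_at_right_field by (intro exI[of _ r]) auto

locale transverse_curve = projected_curve p z + immersed_curve p L R for p z L R +
  assumes transverse: "p s = p t \<Longrightarrow> s - t \<notin> \<int> \<Longrightarrow> L s = R s \<and> cross2 (R s) (R t) \<noteq> 0"
begin

lemma crossing_times_isolated:
  "\<exists>e>0. \<forall>c\<in>ball c0 e. p c \<in> crossing_points p \<longrightarrow> c = c0"
proof -
  have "finite {t \<in> {c0-1..c0+1}. p t \<in> crossing_points p}" by (rule finite_crossing_times)
  from finite_set_avoid[OF this, of c0] obtain d where d: "d > 0"
    "\<And>x. x \<in> {c0-1..c0+1} \<Longrightarrow> p x \<in> crossing_points p \<Longrightarrow> x \<noteq> c0 \<Longrightarrow> d \<le> dist c0 x" by auto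
  have "c = c0" if "c \<in> ball c0 (min d 1)" "p c \<in> crossing_points p" for c
  proof (rule ccontr)
    assume "c \<noteq> c0"
    moreover have "c \<in> {c0-1..c0+1}" using that(1) by (auto simp: dist_real_def)
    ultimately have "d \<le> dist c0 c" using d(2) that(2) by blast
    then show False using that(1) by simp
  qed
  then show ?thesis using d(1) by (intro exI[of _ "min d 1"]) auto
qed

lemma corners_isolated: "\<exists>e>0. \<forall>c\<in>ball c0 e. L c \<noteq> R c \<longrightarrow> c = c0"
proof -
  have "finite {t \<in> {c0-1..c0+1}. L t \<noteq> R t}" by (rule finite_corners_Icc)
  from finite_set_avoid[OF this, of c0] obtain d where d: "d > 0"
    "\<And>x. x \<in> {c0-1..c0+1} \<Longrightarrow> L x \<noteq> R x \<Longrightarrow> x \<noteq> c0 \<Longrightarrow> d \<le> dist c0 x" by auto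
  have "c = c0" if "c \<in> ball c0 (min d 1)" "L c \<noteq> R c" for c
  proof (rule ccontr)
    assume "c \<noteq> c0"
    moreover have "c \<in> {c0-1..c0+1}" using that(1) by (auto simp: dist_real_def)
    ultimately have "d \<le> dist c0 c" using d(2) that(2) by blast
    then show False using that(1) by simp
  qed
  then show ?thesis using d(1) by (intro exI[of _ "min d 1"]) auto
qed

end

text \<open>\<open>push_off d\<close> runs parallel to \<open>p\<close> on \<open>{u..v}\<close>, on the side given by \<open>\<sigma>\<close>, at distance of order \<open>d\<close>.
  Its ends are the points of \<open>p\<close> at the parameters \<open>au + su * d\<close> and \<open>av + sv * d\<close>. Either
  \<open>au\<close> is the other parameter of the double point \<open>p u\<close>, or \<open>su = 0\<close> and \<open>au = u\<close>, and the distance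
  shrinks to \<open>0\<close> at \<open>u\<close>; likewise for \<open>v\<close>.\<close>

locale parallel_arc = transverse_curve p z L R for p z L R +
  fixes u v au av su sv \<sigma> :: real and w w' :: "real \<Rightarrow> complex"
  assumes uv: "u < v" "v < u + 1" and T_over: "{u..v} \<inter> over_times = {}"
    and su: "su \<in> {-1, 0, 1}" and sv: "sv \<in> {-1, 0, 1}" and not_both: "su \<noteq> 0 \<or> sv \<noteq> 0"
    and u_cross: "su \<noteq> 0 \<Longrightarrow> p au = p u \<and> au - u \<notin> \<int>" and u_tail: "su = 0 \<Longrightarrow> au = u"
    and v_cross: "sv \<noteq> 0 \<Longrightarrow> p av = p v \<and> av - v \<notin> \<int>" and v_tail: "sv = 0 \<Longrightarrow> av = v"
    and \<sigma>: "\<sigma> = 1 \<or> \<sigma> = -1"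
    and w_deriv: "\<And>t. (w has_vector_derivative w' t) (at t)" and w'_cont: "continuous_on UNIV w'"
    and w_trans: "\<And>t. t \<in> {u..v} \<Longrightarrow> transversal \<sigma> t (w t)"
    and w_u: "su \<noteq> 0 \<Longrightarrow> w u = of_real su * R au" and w_v: "sv \<noteq> 0 \<Longrightarrow> w v = of_real sv * R av"
begin

definition lu :: "real \<Rightarrow> real" where "lu t = (v - t) / (v - u)"
definition lv :: "real \<Rightarrow> real" where "lv t = (t - u) / (v - u)"
text \<open>The profile of the distance from the followed arc: constantly 1 if both ends are
  crossings, linear down to 0 at an end where the new arc runs into the followed one.\<close>

definition rho :: "real \<Rightarrow> real" where "rho t = lu t * \<bar>su\<bar> + lv t * \<bar>sv\<bar>"
text \<open>The remainder of the first-order expansion of \<open>p\<close> at \<open>au\<close>. It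
  is added to the shift in order that the new arc ends exactly on the curve and not only up to first
  order.\<close>

definition ru :: "real \<Rightarrow> complex" where "ru d = p (au + su * d) - p au - of_real d * (of_real su * R au)"
definition rv :: "real \<Rightarrow> complex" where "rv d = p (av + sv * d) - p av - of_real d * (of_real sv * R av)"
definition shift :: "real \<Rightarrow> real \<Rightarrow> complex" where
  "shift d t = of_real (d * rho t) * w t + of_real (lu t) * ru d + of_real (lv t) * rv d"
definition shift' :: "real \<Rightarrow> real \<Rightarrow> complex" where
  "shift' d t = of_real (d * ((\<bar>sv\<bar> - \<bar>su\<bar>) / (v - u))) * w t + of_real (d * rho t) * w' t
     + of_real (- 1 / (v - u)) * ru d + of_real (1 / (v - u)) * rv d"
definition push_off :: "real \<Rightarrow> real \<Rightarrow> complex" where "push_off d t = p t + shift d t"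

lemma lulv: "t \<in> {u..v} \<Longrightarrow> 0 \<le> lu t \<and> lu t \<le> 1 \<and> 0 \<le> lv t \<and> lv t \<le> 1"
  using uv by (auto simp: lu_def lv_def)

lemma lu_ends: "lu u = 1" "lu v = 0" "lv u = 0" "lv v = 1"
  using uv by (simp_all add: lu_def lv_def)

lemma lulv_sum: "lu t + lv t = 1"
  using uv by (simp add: lu_def lv_def add_divide_distrib[symmetric])

lemma abs_s: "\<bar>su\<bar> = 0 \<or> \<bar>su\<bar> = 1" "\<bar>sv\<bar> = 0 \<or> \<bar>sv\<bar> = 1"
  using su sv by auto

lemma rho_bounds: "t \<in> {u..v} \<Longrightarrow> 0 \<le> rho t \<and> rho t \<le> 1"
  using lulv[of t] lulv_sum[of t] abs_s by (auto simp: rho_def)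

lemma rho_pos: "t \<in> {u<..<v} \<Longrightarrow> rho t > 0"
proof -
  assume t: "t \<in> {u<..<v}"
  have "lu t > 0" "lv t > 0" using t uv by (auto simp: lu_def lv_def)
  then show ?thesis using abs_s not_both by (auto simp: rho_def)
qed

text \<open>At a crossing the prescribed value of \<open>w\<close> supplies the linear part and
  \<open>ru\<close> or \<open>rv\<close> the rest of the displacement along the other
  strand.\<close>

lemma shift_ends: "shift d u = p (au + su * d) - p u" "shift d v = p (av + sv * d) - p v"
proof -
  show "shift d u = p (au + su * d) - p u"
  proof (cases "su = 0")
    case True
    have "ru d = 0" "rho u = 0" unfolding ru_def rho_def lu_ends using True by simp_all
    then show ?thesis using True u_tail unfolding shift_def lu_ends by simp
  next
    case False
    then have "\<bar>su\<bar> = 1" using su by auto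
    then show ?thesis using False u_cross w_u by (simp add: shift_def rho_def lu_ends ru_def)
  qed
  show "shift d v = p (av + sv * d) - p v"
  proof (cases "sv = 0")
    case True
    have "rv d = 0" "rho v = 0" unfolding rv_def rho_def lu_ends using True by simp_all
    then show ?thesis using True v_tail unfolding shift_def lu_ends by simp
  next
    case False
    then have "\<bar>sv\<bar> = 1" using sv by auto
    then show ?thesis using False v_cross w_v by (simp add: shift_def rho_def lu_ends rv_def)
  qed
qed

lemma arc_ends: "push_off d u = p (au + su * d)" "push_off d v = p (av + sv * d)"
  using shift_ends by (simp_all add: push_off_def)

lemma shift_deriv: "(shift d has_vector_derivative shift' d t) (at t)"
proof -
  have l: "(lu has_real_derivative - 1 / (v - u)) (at t)" "(lv has_real_derivative 1 / (v - u)) (at t)"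
  proof -
    have "((\<lambda>t. (v - t) / c) has_real_derivative - 1 / c) (at t)"
      "((\<lambda>t. (t - u) / c) has_real_derivative 1 / c) (at t)" if "c \<noteq> 0" for c
      using that by (auto intro!: derivative_eq_intros)
    then show "(lu has_real_derivative - 1 / (v - u)) (at t)" "(lv has_real_derivative 1 / (v - u)) (at t)"
      using uv unfolding lu_def[abs_def] lv_def[abs_def] by auto
  qed
  have lu': "((\<lambda>t. of_real (lu t) :: complex) has_vector_derivative of_real (- 1 / (v - u))) (at t)"
    by (rule has_vector_derivative_of_real[OF l(1)])
  have lv': "((\<lambda>t. of_real (lv t) :: complex) has_vector_derivative of_real (1 / (v - u))) (at t)"
    by (rule has_vector_derivative_of_real[OF l(2)])
  have "(rho has_real_derivative - 1 / (v - u) * \<bar>su\<bar> + 1 / (v - u) * \<bar>sv\<bar>) (at t)"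
    unfolding rho_def[abs_def] by (intro DERIV_add DERIV_cmult_right l)
  moreover have "- 1 / (v - u) * \<bar>su\<bar> + 1 / (v - u) * \<bar>sv\<bar> = (\<bar>sv\<bar> - \<bar>su\<bar>) / (v - u)"
    by (simp add: diff_divide_distrib)
  ultimately have "(rho has_real_derivative (\<bar>sv\<bar> - \<bar>su\<bar>) / (v - u)) (at t)" by simp
  then have "((\<lambda>t. d * rho t) has_real_derivative d * ((\<bar>sv\<bar> - \<bar>su\<bar>) / (v - u))) (at t)" by (rule DERIV_cmult)
  then have r: "((\<lambda>t. of_real (d * rho t) :: complex) has_vector_derivative of_real (d * ((\<bar>sv\<bar> - \<bar>su\<bar>) / (v - u)))) (at t)"
    by (rule has_vector_derivative_of_real)
  have 1: "((\<lambda>t. of_real (d * rho t) * w t) has_vector_derivative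
      of_real (d * rho t) * w' t + of_real (d * ((\<bar>sv\<bar> - \<bar>su\<bar>) / (v - u))) * w t) (at t)"
    by (rule has_vector_derivative_mult[OF r w_deriv])
  have 2: "((\<lambda>t. of_real (lu t) * ru d) has_vector_derivative of_real (- 1 / (v - u)) * ru d) (at t)"
    "((\<lambda>t. of_real (lv t) * rv d) has_vector_derivative of_real (1 / (v - u)) * rv d) (at t)"
    by (rule has_vector_derivative_mult_left[OF lu'], rule has_vector_derivative_mult_left[OF lv'])
  show ?thesis
    using has_vector_derivative_add[OF has_vector_derivative_add[OF 1 2(1)] 2(2)]
    unfolding shift_def[abs_def] shift'_def by (simp add: add.commute add.left_commute)
qed

lemma continuous_w: "continuous_on X w"
  using w_deriv by (meson continuous_at_imp_continuous_on has_vector_derivative_continuous)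

lemma continuous_shift': "continuous_on X (shift' d)"
proof -
  have "continuous_on X lu" "continuous_on X lv"
    unfolding lu_def[abs_def] lv_def[abs_def] using uv by (intro continuous_intros; simp)+
  then have "continuous_on X rho" unfolding rho_def[abs_def] by (intro continuous_intros)
  then show ?thesis unfolding shift'_def[abs_def]
    by (intro continuous_intros continuous_w continuous_on_subset[OF w'_cont]) auto
qed

text \<open>Crossings are not corners, so \<open>p\<close> has a two-sided derivative there. The
  factors \<open>\<bar>su\<bar>\<close> and \<open>\<bar>sv\<bar>\<close> record that the remainder
  vanishes when the end is no crossing.\<close>

lemma remainder_small:
  assumes "e > 0"
  shows "\<forall>\<^sub>F d in at_right 0. norm (ru d) \<le> e * \<bar>su\<bar> * d" "\<forall>\<^sub>F d in at_right 0. norm (rv d) \<le> e * \<bar>sv\<bar> * d"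
proof -
  have gen: "\<forall>\<^sub>F d in at_right 0. norm (p (a + s * d) - p a - of_real d * (of_real s * R a)) \<le> e * \<bar>s\<bar> * d"
    if s: "s \<in> {-1, 0, 1}" and c: "s \<noteq> 0 \<Longrightarrow> L a = R a" for a s
  proof (cases "s = 0")
    case False
    then have "(p has_vector_derivative R a) (at a)" using c two_sided by blast
    then have "((\<lambda>y. (p y - p a) / of_real (y - a)) \<longlongrightarrow> R a) (at a)" by (rule has_vector_derivative_quotient)
    then have "\<forall>\<^sub>F y in at a. dist ((p y - p a) / of_real (y - a)) (R a) < e" using assms by (rule tendstoD)
    then obtain d0 where d0: "d0 > 0" "\<And>y. y \<noteq> a \<Longrightarrow> dist y a < d0 \<Longrightarrow> dist ((p y - p a) / of_real (y - a)) (R a) < e"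
      unfolding eventually_at by auto
    have "norm (p (a + s * d) - p a - of_real d * (of_real s * R a)) \<le> e * \<bar>s\<bar> * d" if d: "0 < d" "d < d0" for d
    proof -
      let ?y = "a + s * d"
      have s1: "\<bar>s\<bar> = 1" using s False by auto
      have nz: "s * d \<noteq> 0" using False d by simp
      have "dist ?y a < d0" using d s1 by (simp add: dist_real_def abs_mult)
      then have "norm ((p ?y - p a) / of_real (?y - a) - R a) < e" using d0(2)[of ?y] nz by (simp add: dist_norm)
      moreover have "(p ?y - p a) / of_real (?y - a) - R a = (p ?y - p a - of_real d * (of_real s * R a)) / of_real (s * d)"
        using nz by (simp add: diff_divide_distrib)
      ultimately have "norm (p ?y - p a - of_real d * (of_real s * R a)) / (\<bar>s\<bar> * d) < e"
        using d by (simp add: norm_divide norm_mult)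
      then show ?thesis using s1 d by (simp add: divide_less_eq less_imp_le)
    qed
    then show ?thesis unfolding eventually_at_right_field using d0(1) by (intro exI[of _ d0]) auto
  qed simp
  show "\<forall>\<^sub>F d in at_right 0. norm (ru d) \<le> e * \<bar>su\<bar> * d"
    unfolding ru_def by (rule gen[OF su]) (use u_cross transverse in blast)
  show "\<forall>\<^sub>F d in at_right 0. norm (rv d) \<le> e * \<bar>sv\<bar> * d"
    unfolding rv_def by (rule gen[OF sv]) (use v_cross transverse in blast)
qed

text \<open>Weighted with \<open>lu\<close> and \<open>lv\<close>, the factors
  \<open>\<bar>su\<bar>\<close> and \<open>\<bar>sv\<bar>\<close> in the remainder estimates add up
  to \<open>rho\<close>. The remainders are thus small relative to \<open>d * rho t\<close>, even
  where \<open>rho\<close> tends to 0, and the direction of the shift stays close to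
  \<open>w\<close>.\<close>

lemma shift_form:
  assumes "r > 0"
  shows "\<forall>\<^sub>F d in at_right 0. \<forall>t\<in>{u..v}. \<exists>w''\<in>ball (w t) r. shift d t = of_real (d * rho t) * w''"
proof -
  have r2: "r / 2 > 0" using assms by simp
  show ?thesis
    using remainder_small[OF r2] eventually_at_right_0_less[OF zero_less_one]
  proof eventually_elim
    case (elim d)
    show ?case
    proof
      fix t assume t: "t \<in> {u..v}"
      let ?x = "of_real (lu t) * ru d + of_real (lv t) * rv d"
      have l: "lu t \<ge> 0" "lv t \<ge> 0" using lulv[OF t] by auto
      have "norm ?x \<le> lu t * norm (ru d) + lv t * norm (rv d)"
        using l by (intro order_trans[OF norm_triangle_ineq]) (simp add: norm_mult)
      also have "\<dots> \<le> lu t * (r / 2 * \<bar>su\<bar> * d) + lv t * (r / 2 * \<bar>sv\<bar> * d)"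
        using l elim by (intro add_mono mult_left_mono) auto
      also have "\<dots> = r / 2 * (d * rho t)" by (simp add: rho_def algebra_simps)
      finally have x: "norm ?x \<le> r / 2 * (d * rho t)" .
      show "\<exists>w''\<in>ball (w t) r. shift d t = of_real (d * rho t) * w''"
      proof (cases "rho t = 0")
        case True
        then have "?x = 0" using x by simp
        then show ?thesis using True assms by (intro bexI[of _ "w t"]) (simp_all add: shift_def add.assoc)
      next
        case False
        then have k: "d * rho t > 0" using rho_bounds[OF t] elim by simp
        define w'' where "w'' = w t + ?x / of_real (d * rho t)"
        have "norm (?x / of_real (d * rho t)) = norm ?x / (d * rho t)"
          unfolding norm_divide norm_of_real using k by simp
        also have "\<dots> \<le> r / 2" using x k by (simp add: divide_le_eq)
        also have "\<dots> < r" using assms by simp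
        finally have "w'' \<in> ball (w t) r" by (simp add: w''_def dist_norm)
        moreover have "complex_of_real (d * rho t) \<noteq> 0" using k by (metis of_real_eq_0_iff less_irrefl)
        then have "of_real (d * rho t) * (?x / of_real (d * rho t)) = ?x"
          by (simp only: times_divide_eq_right nonzero_mult_div_cancel_left not_False_eq_True)
        then have "shift d t = of_real (d * rho t) * w''"
          unfolding w''_def distrib_left[of "of_real (d * rho t)"] shift_def by (simp only: add.assoc)
        ultimately show ?thesis by blast
      qed
    qed
  qed
qed

lemma shift_bounds:
  obtains C where "C > 0" "\<forall>\<^sub>F d in at_right 0. \<forall>t\<in>{u..v}. norm (shift d t) \<le> C * d \<and> norm (shift' d t) \<le> C * d"
proof -
  have bnd: "\<exists>B\<ge>0. \<forall>t\<in>{u..v}. norm (f t) \<le> B" if "continuous_on {u..v} f" for f :: "real \<Rightarrow> complex"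
  proof -
    have "bounded (f ` {u..v})" by (intro compact_imp_bounded compact_continuous_image that compact_Icc)
    then obtain B where B: "\<forall>y\<in>f ` {u..v}. norm y \<le> B" unfolding bounded_iff by (elim exE)
    then show ?thesis by (intro exI[of _ "\<bar>B\<bar>"]) force
  qed
  obtain B where B: "B \<ge> 0" "\<And>t. t \<in> {u..v} \<Longrightarrow> norm (w t) \<le> B" using bnd[OF continuous_w] by blast
  obtain B' where B': "B' \<ge> 0" "\<And>t. t \<in> {u..v} \<Longrightarrow> norm (w' t) \<le> B'"
    using bnd[OF continuous_on_subset[OF w'_cont subset_UNIV]] by blast
  define k where "k = 1 / (v - u)"
  have k: "k > 0" using uv by (simp add: k_def)
  define C where "C = k * B + B' + k + k + B + 2"
  have C: "C > 0" "C \<ge> B + 2" "C \<ge> k * B + B' + k + k" using B(1) B'(1) k by (simp_all add: C_def add_nonneg_pos)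
  have "\<forall>\<^sub>F d in at_right 0. \<forall>t\<in>{u..v}. norm (shift d t) \<le> C * d \<and> norm (shift' d t) \<le> C * d"
    using remainder_small[OF zero_less_one] eventually_at_right_0_less[OF zero_less_one]
  proof eventually_elim
    case (elim d)
    have d: "d > 0" using elim by simp
    have r: "norm (ru d) \<le> d" "norm (rv d) \<le> d"
      using elim abs_s d by auto
    show ?case
    proof
      fix t assume t: "t \<in> {u..v}"
      note l = lulv[OF t] rho_bounds[OF t]
      have "norm (of_real (d * rho t) * w t) \<le> d * B"
      proof -
        have "norm (of_real (d * rho t) * w t) = d * (rho t * norm (w t))" using d l by (simp add: norm_mult)
        also have "\<dots> \<le> d * (1 * B)" using d l B t by (intro mult_left_mono mult_mono) auto
        finally show ?thesis by simp
      qed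
      moreover have "norm (of_real (lu t) * ru d) \<le> d" "norm (of_real (lv t) * rv d) \<le> d"
        using l r mult_mono[of "lu t" 1 "norm (ru d)" d] mult_mono[of "lv t" 1 "norm (rv d)" d] by (simp_all add: norm_mult)
      ultimately have "norm (shift d t) \<le> d * B + d + d"
        unfolding shift_def by (meson norm_triangle_mono)
      also have "\<dots> = (B + 2) * d" by (simp add: algebra_simps)
      also have "\<dots> \<le> C * d" using C(2) d by (intro mult_right_mono) auto
      finally have 1: "norm (shift d t) \<le> C * d" .
      have "norm (of_real (d * ((\<bar>sv\<bar> - \<bar>su\<bar>) / (v - u))) * w t) \<le> k * B * d"
      proof -
        have "\<bar>\<bar>sv\<bar> - \<bar>su\<bar>\<bar> \<le> 1" using abs_s by auto
        then have "\<bar>(\<bar>sv\<bar> - \<bar>su\<bar>) / (v - u)\<bar> \<le> k" using uv by (simp add: k_def divide_right_mono)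
        then have "\<bar>(\<bar>sv\<bar> - \<bar>su\<bar>) / (v - u)\<bar> * norm (w t) \<le> k * B" using B t k by (intro mult_mono) auto
        then have "d * (\<bar>(\<bar>sv\<bar> - \<bar>su\<bar>) / (v - u)\<bar> * norm (w t)) \<le> d * (k * B)" using d by (intro mult_left_mono) auto
        then show ?thesis using d by (simp only: norm_mult norm_of_real abs_mult abs_of_pos) (simp add: ac_simps)
      qed
      moreover have "norm (of_real (d * rho t) * w' t) \<le> d * B'"
      proof -
        have "norm (of_real (d * rho t) * w' t) = d * (rho t * norm (w' t))" using d l by (simp add: norm_mult)
        also have "\<dots> \<le> d * (1 * B')" using d l B' t by (intro mult_left_mono mult_mono) auto
        finally show ?thesis by simp
      qed
      moreover have "norm (of_real (- 1 / (v - u)) * ru d) \<le> k * d" "norm (of_real (1 / (v - u)) * rv d) \<le> k * d"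
      proof -
        have "norm (of_real x * y :: complex) \<le> k * d" if "\<bar>x\<bar> = k" "norm y \<le> d" for x and y :: complex
          using that k by (simp add: norm_mult)
        moreover have "\<bar>- 1 / (v - u)\<bar> = k" "\<bar>1 / (v - u)\<bar> = k" using uv by (simp_all add: k_def)
        ultimately show "norm (of_real (- 1 / (v - u)) * ru d) \<le> k * d" "norm (of_real (1 / (v - u)) * rv d) \<le> k * d"
          using r by blast+
      qed
      ultimately have "norm (shift' d t) \<le> k * B * d + d * B' + k * d + k * d"
        unfolding shift'_def by (meson norm_triangle_mono)
      also have "\<dots> = (k * B + B' + k + k) * d" by (simp add: algebra_simps)
      also have "\<dots> \<le> C * d" using C(3) d by (intro mult_right_mono) auto
      finally show "norm (shift d t) \<le> C * d \<and> norm (shift' d t) \<le> C * d" using 1 by simp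
    qed
  qed
  then show thesis using that C(1) by blast
qed

text \<open>The new arc is close to the followed one together with its first derivative, which is
  what transversality and injectivity survive.\<close>

lemma shift_small:
  assumes "e > 0"
  shows "\<forall>\<^sub>F d in at_right 0. \<forall>t\<in>{u..v}. norm (shift d t) < e \<and> norm (shift' d t) < e
    \<and> (\<forall>t'\<in>{u..v}. norm (shift d t - shift d t') \<le> e * \<bar>t - t'\<bar>)"
proof -
  obtain C where C: "C > 0" "\<forall>\<^sub>F d in at_right 0. \<forall>t\<in>{u..v}. norm (shift d t) \<le> C * d \<and> norm (shift' d t) \<le> C * d"
    using shift_bounds by blast
  have "e / C > 0" using assms C(1) by simp
  from C(2) eventually_at_right_0_less[OF this] show ?thesis
  proof eventually_elim
    case (elim d)
    have "C * d < e" using elim C(1) by (simp add: pos_less_divide_eq mult.commute)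
    then have b: "norm (shift d t) < e" "norm (shift' d t) < e" if "t \<in> {u..v}" for t
      using elim(1) that by fastforce+
    then have "norm (shift d t - shift d t') \<le> e * \<bar>t - t'\<bar>" if "t \<in> {u..v}" "t' \<in> {u..v}" for t t'
      using norm_diff_le_of_vector_derivative[of u v "shift d" "shift' d" e t t'] shift_deriv that by fastforce
    then show ?case using b by blast
  qed
qed

section \<open>Meetings of the parallel arc with the curve\<close>

lemma no_solution_near:
  assumes "p c0 \<noteq> p t0"
  shows "\<exists>N. open N \<and> (c0, t0) \<in> N \<and>
    (\<forall>\<^sub>F d in at_right 0. \<forall>(c, t)\<in>N. t \<in> {u..v} \<longrightarrow> p c \<noteq> push_off d t)"
proof -
  define e where "e = dist (p c0) (p t0) / 2"
  have e: "e > 0" using assms by (simp add: e_def)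
  have cp: "continuous_on UNIV p" by (rule continuous)
  define N where "N = {x. e < dist (p (fst x)) (p (snd x))}"
  have "open N" unfolding N_def
    by (intro open_Collect_less continuous_intros continuous_on_compose2[OF cp]) auto
  moreover have "(c0, t0) \<in> N" using e by (simp add: N_def e_def)
  moreover have "\<forall>\<^sub>F d in at_right 0. \<forall>(c, t)\<in>N. t \<in> {u..v} \<longrightarrow> p c \<noteq> push_off d t"
    using shift_small[OF e]
  proof eventually_elim
    case (elim d)
    have "p c \<noteq> push_off d t" if "(c, t) \<in> N" "t \<in> {u..v}" for c t
    proof
      assume "p c = push_off d t"
      then have "dist (p c) (p t) = norm (shift d t)" by (simp add: dist_norm push_off_def)
      then show False using elim that by (fastforce simp: N_def)
    qed
    then show ?case by blast
  qed
  ultimately show ?thesis by blast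
qed

text \<open>A solution would put \<open>p c - p t\<close>, which lies in the cone of velocities, on the transversal
  direction of the shift.\<close>

lemma only_tail_near:
  assumes t0: "t0 \<in> {u..v}" and c0: "c0 - t0 \<in> \<int>"
  shows "\<exists>N. open N \<and> (c0, t0) \<in> N \<and>
    (\<forall>\<^sub>F d in at_right 0. \<forall>(c, t)\<in>N. t \<in> {u..v} \<longrightarrow> p c = push_off d t \<longrightarrow> rho t = 0)"
proof -
  obtain \<eta> r m where h: "\<eta> > 0" "r > 0" "m > 0"
    "\<And>s w'. s \<in> ball t0 \<eta> \<Longrightarrow> w' \<in> ball (w t0) r \<Longrightarrow> \<sigma> * cross2 (L s) w' \<ge> m \<and> \<sigma> * cross2 (R s) w' \<ge> m"
    using transversal_nbhd[OF w_trans[OF t0] \<sigma>] by blast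
  obtain \<eta>' where h': "\<eta>' > 0" "\<And>t. dist t t0 < \<eta>' \<Longrightarrow> dist (w t) (w t0) < r / 2"
    using continuous_w[of UNIV] half_gt_zero[OF h(2)] unfolding continuous_on_iff by (metis UNIV_I)
  define e where "e = min \<eta> \<eta>'"
  have e: "e > 0" "e \<le> \<eta>" "e \<le> \<eta>'" using h(1) h'(1) by (auto simp: e_def)
  have r2: "r / 2 > 0" using h(2) by simp
  have "\<forall>\<^sub>F d in at_right 0. \<forall>(c, t)\<in>ball c0 e \<times> ball t0 e. t \<in> {u..v} \<longrightarrow> p c = push_off d t \<longrightarrow> rho t = 0"
    using shift_form[OF r2] eventually_at_right_0_less[OF zero_less_one]
  proof eventually_elim
    case (elim d)
    have "rho t = 0" if c: "c \<in> ball c0 e" and t: "t \<in> ball t0 e" "t \<in> {u..v}" and eq: "p c = push_off d t" for c t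
    proof -
      \<comment> \<open>Move \<open>c\<close> by an integer next to \<open>t0\<close>, so that the
        curve between \<open>c'\<close> and \<open>t\<close> has all its velocities in the cone at
        \<open>t0\<close>.\<close>
      define c' where "c' = c - (c0 - t0)"
      have "p c' = p c" by (rule p_int) (use c0 in \<open>simp add: c'_def Ints_minus[of "c0 - t0", simplified]\<close>)
      have c': "c' \<in> ball t0 e" using c by (simp add: c'_def dist_real_def)
      obtain w'' where w'': "w'' \<in> ball (w t) (r / 2)" "shift d t = of_real (d * rho t) * w''"
        using elim(1) t(2) by blast
      have "dist (w t0) w'' \<le> dist (w t0) (w t) + dist (w t) w''" by (rule dist_triangle)
      also have "\<dots> < r / 2 + r / 2" using w''(1) h'(2)[of t] t(1) e by (intro add_strict_mono) (auto simp: dist_commute)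
      finally have w0: "w'' \<in> ball (w t0) r" by simp
      \<comment> \<open>A normal of the line spanned by \<open>w''\<close>: the shift is orthogonal
        to \<open>n\<close>, whereas every velocity near \<open>t0\<close> has component at least
        \<open>m\<close> along \<open>n\<close>.\<close>
      define n where "n = of_real \<sigma> * (- \<i> * w'')"
      have n: "x \<bullet> n = \<sigma> * cross2 x w''" for x by (simp add: n_def cross2_def inner_complex_def algebra_simps)
      have Rn: "R s \<bullet> n \<ge> m" if "s \<in> ball t0 e" for s using h(4)[OF _ w0, of s] that e by (simp add: n)
      have "(p c' - p t) \<bullet> n = \<sigma> * cross2 (shift d t) w''" using eq \<open>p c' = p c\<close> by (simp add: n push_off_def)
      then have z: "(p c' - p t) \<bullet> n = 0" unfolding w''(2) cross2_scale cross2_self by simp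
      have seg: "{min c' t..max c' t} \<subseteq> ball t0 e"
        using c' t(1) by (auto simp: dist_real_def min_def max_def abs_less_iff split: if_splits)
      have "c' = t"
      proof (rule ccontr)
        assume "c' \<noteq> t"
        then consider "t < c'" | "c' < t" by linarith
        then show False
        proof cases
          case 1
          have "(p c' - p t) \<bullet> n \<ge> m * (c' - t)" using 1 seg Rn by (intro cone_lower_bound) auto
          then show False using z 1 h(3) by (smt (verit) mult_pos_pos)
        next
          case 2
          have "(p t - p c') \<bullet> n \<ge> m * (t - c')" using 2 seg Rn by (intro cone_lower_bound) auto
          moreover have "(p t - p c') \<bullet> n = 0" using z by (simp add: inner_diff_left)
          ultimately show False using 2 h(3) by (smt (verit) mult_pos_pos)
        qed
      qed
      then have "of_real (d * rho t) * w'' = 0" using eq \<open>p c' = p c\<close> w''(2) by (simp add: push_off_def)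
      moreover have "w'' \<noteq> 0" using Rn[of t0] e h(3) by (auto simp: n_def)
      ultimately show "rho t = 0" using elim by simp
    qed
    then show ?case by auto
  qed
  moreover have "open (ball c0 e \<times> ball t0 e)" "(c0, t0) \<in> ball c0 e \<times> ball t0 e" using e by (auto intro: open_Times)
  ultimately show ?thesis by blast
qed

text \<open>Near a crossing, \<open>p c - push_off d t\<close> is a perturbation of the linear map
  with columns \<open>R c0\<close> and \<open>- R t0\<close>, small in the Lipschitz sense. That map
  is injective with a definite rate, so there is at most one zero, and the strands are transverse at
  it.\<close>

lemma unique_solution_near:
  assumes t0: "t0 \<in> {u..v}" and cr: "p c0 = p t0" "c0 - t0 \<notin> \<int>"
  shows "\<exists>N. open N \<and> (c0, t0) \<in> N \<and>
    (\<forall>\<^sub>F d in at_right 0.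
      (\<forall>(c, t)\<in>N. \<forall>(c', t')\<in>N. t \<in> {u..v} \<longrightarrow> t' \<in> {u..v} \<longrightarrow> p c = push_off d t \<longrightarrow> p c' = push_off d t' \<longrightarrow> c = c' \<and> t = t') \<and>
      (\<forall>(c, t)\<in>N. t \<in> {u..v} \<longrightarrow> p c = push_off d t \<longrightarrow> rho t = 0 \<or>
         p c \<notin> crossing_points p \<and> L c = R c \<and> L t = R t \<and> cross2 (R c) (R t + shift' d t) \<noteq> 0))"
proof -
  have tr: "L c0 = R c0" "cross2 (R c0) (R t0) \<noteq> 0" using transverse[OF cr] by auto
  have cr': "p t0 = p c0" "t0 - c0 \<notin> \<int>" using cr by (simp, metis Ints_minus minus_diff_eq)
  have tr': "L t0 = R t0" using transverse[OF cr'] by simp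
  obtain \<mu> where mu: "\<mu> > 0" "\<And>x y. norm (x *\<^sub>R R c0 - y *\<^sub>R R t0) \<ge> \<mu> * (\<bar>x\<bar> + \<bar>y\<bar>)"
    using cross2_independent[OF tr(2)] by blast
  obtain \<epsilon>1 where e1: "\<epsilon>1 > 0" "\<And>x y. x \<in> ball (R c0) \<epsilon>1 \<Longrightarrow> y \<in> ball (R t0) \<epsilon>1 \<Longrightarrow> cross2 x y \<noteq> 0"
  proof -
    have "cross2 (R c0) (R t0) > 0 \<or> cross2 (R c0) (- R t0) > 0" using tr(2) by auto
    then show thesis
    proof
      assume "cross2 (R c0) (R t0) > 0"
      from cross2_pos_nbhd[OF this] show thesis using that by force
    next
      assume "cross2 (R c0) (- R t0) > 0"
      from cross2_pos_nbhd[OF this] obtain e m where em: "e > 0" "m > 0"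
        "\<And>v' w'. v' \<in> ball (R c0) e \<Longrightarrow> w' \<in> ball (- R t0) e \<Longrightarrow> cross2 v' w' \<ge> m" by blast
      show thesis
      proof (rule that[OF em(1)])
        fix x y assume "x \<in> ball (R c0) e" "y \<in> ball (R t0) e"
        then have "cross2 x (- y) \<ge> m" by (intro em(3)) (simp_all add: dist_minus)
        then show "cross2 x y \<noteq> 0" using em(2) by auto
      qed
    qed
  qed
  \<comment> \<open>The two linearization errors and the Lipschitz constant of the shift are each at
    most \<open>\<epsilon>\<close>, and \<open>3 * \<epsilon> < \<mu>\<close>. The bound by
    \<open>\<epsilon>1 / 2\<close> leaves room for adding \<open>shift'\<close> to a
    velocity.\<close>
  define \<epsilon> where "\<epsilon> = min (\<mu> / 4) (\<epsilon>1 / 2)"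
  have eps: "\<epsilon> > 0" "3 * \<epsilon> < \<mu>" "2 * \<epsilon> \<le> \<epsilon>1" using mu(1) e1(1) by (auto simp: \<epsilon>_def)
  obtain d1 where d1: "d1 > 0" "\<And>x. x \<in> ball c0 d1 \<Longrightarrow> R x \<in> ball (R c0) \<epsilon>"
    using velocity_near_union[OF eps(1), of c0] tr(1) by (metis Un_absorb)
  obtain d2 where d2: "d2 > 0" "\<And>x. x \<in> ball t0 d2 \<Longrightarrow> R x \<in> ball (R t0) \<epsilon>"
    using velocity_near_union[OF eps(1), of t0] tr' by (metis Un_absorb)
  obtain d3 where d3: "d3 > 0" "\<And>c. c \<in> ball c0 d3 \<Longrightarrow> p c \<in> crossing_points p \<Longrightarrow> c = c0"
    using crossing_times_isolated by metis
  obtain d4 where d4: "d4 > 0" "\<And>c. c \<in> ball c0 d4 \<Longrightarrow> L c = R c"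
    using corners_isolated[of c0] tr(1) by metis
  obtain d5 where d5: "d5 > 0" "\<And>c. c \<in> ball t0 d5 \<Longrightarrow> L c = R c"
    using corners_isolated[of t0] tr' by metis
  \<comment> \<open>Excludes meetings at an old crossing. Such a meeting has \<open>c = c0\<close>,
    so it is also one with the time \<open>t0\<close> of the followed strand itself, and by
    \<open>only_tail_near\<close> at \<open>(t0, t0)\<close> this forces
    \<open>rho t = 0\<close>.\<close>
  obtain N0 where N0: "open N0" "(t0, t0) \<in> N0"
    "\<forall>\<^sub>F d in at_right 0. \<forall>(c, t)\<in>N0. t \<in> {u..v} \<longrightarrow> p c = push_off d t \<longrightarrow> rho t = 0"
    using only_tail_near[OF t0, of t0] by auto
  obtain d6 where d6: "d6 > 0" "\<And>t. t \<in> ball t0 d6 \<Longrightarrow> (t0, t) \<in> N0"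
  proof -
    have "open ((\<lambda>t. (t0, t)) -` N0)" by (intro open_vimage N0 continuous_intros)
    moreover have "t0 \<in> (\<lambda>t. (t0, t)) -` N0" using N0 by simp
    ultimately obtain e where "e > 0" "ball t0 e \<subseteq> (\<lambda>t. (t0, t)) -` N0" using openE by blast
    then show thesis using that by blast
  qed
  define \<eta> where "\<eta> = min (min (min d1 d2) (min d3 d4)) (min d5 d6)"
  have eta: "\<eta> > 0" "\<eta> \<le> d1" "\<eta> \<le> d2" "\<eta> \<le> d3" "\<eta> \<le> d4" "\<eta> \<le> d5" "\<eta> \<le> d6"
    using d1 d2 d3 d4 d5 d6 by (auto simp: \<eta>_def)
  have sub: "ball x \<eta> \<subseteq> ball x d1" "ball x \<eta> \<subseteq> ball x d2" "ball x \<eta> \<subseteq> ball x d3" "ball x \<eta> \<subseteq> ball x d4"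
    "ball x \<eta> \<subseteq> ball x d5" "ball x \<eta> \<subseteq> ball x d6" for x :: real using eta by (auto intro: less_le_trans)
  define N where "N = ball c0 \<eta> \<times> ball t0 \<eta>"
  have lin: "norm (p y - p x - (y - x) *\<^sub>R R x0) \<le> \<epsilon> * \<bar>y - x\<bar>"
    if xy: "x \<in> ball x0 \<eta>" "y \<in> ball x0 \<eta>" and b: "\<And>x. x \<in> ball x0 \<eta> \<Longrightarrow> R x \<in> ball (R x0) \<epsilon>" for x y x0
  proof (rule near_linear)
    fix s assume "s \<in> closed_segment x y"
    then have "s \<in> ball x0 \<eta>" using xy convex_ball[of x0 \<eta>] closed_segment_subset by blast
    then show "norm (R s - R x0) \<le> \<epsilon>" using b[of s] by (simp add: dist_norm norm_minus_commute)
  qed (use eps in simp)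
  have "\<forall>\<^sub>F d in at_right 0.
      (\<forall>(c, t)\<in>N. \<forall>(c', t')\<in>N. t \<in> {u..v} \<longrightarrow> t' \<in> {u..v} \<longrightarrow> p c = push_off d t \<longrightarrow> p c' = push_off d t' \<longrightarrow> c = c' \<and> t = t') \<and>
      (\<forall>(c, t)\<in>N. t \<in> {u..v} \<longrightarrow> p c = push_off d t \<longrightarrow> rho t = 0 \<or>
         p c \<notin> crossing_points p \<and> L c = R c \<and> L t = R t \<and> cross2 (R c) (R t + shift' d t) \<noteq> 0)"
    using shift_small[OF eps(1)] N0(3)
  proof eventually_elim
    case (elim d)
    have A: "c = c' \<and> t = t'" if c: "c \<in> ball c0 \<eta>" "c' \<in> ball c0 \<eta>" and t: "t \<in> ball t0 \<eta>" "t' \<in> ball t0 \<eta>"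
      "t \<in> {u..v}" "t' \<in> {u..v}" and eq: "p c = push_off d t" "p c' = push_off d t'" for c c' t t'
    proof -
      define X where "X = p c' - p c - (c' - c) *\<^sub>R R c0"
      define Y where "Y = p t' - p t - (t' - t) *\<^sub>R R t0"
      define Z where "Z = shift d t' - shift d t"
      have X: "norm X \<le> \<epsilon> * \<bar>c' - c\<bar>" unfolding X_def by (rule lin[OF c(1,2)]) (use d1(2) sub in blast)
      have Y: "norm Y \<le> \<epsilon> * \<bar>t' - t\<bar>" unfolding Y_def by (rule lin[OF t(1,2)]) (use d2(2) sub in blast)
      have Z: "norm Z \<le> \<epsilon> * \<bar>t' - t\<bar>" unfolding Z_def using elim(1) t by blast
      have "p c' - p c = (p t' - p t) + Z" using eq by (simp add: push_off_def Z_def)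
      then have "(c' - c) *\<^sub>R R c0 - (t' - t) *\<^sub>R R t0 = Y + Z - X"
        by (simp add: X_def Y_def algebra_simps)
      then have "norm ((c' - c) *\<^sub>R R c0 - (t' - t) *\<^sub>R R t0) \<le> norm Y + norm Z + norm X"
        using norm_triangle_ineq4[of "Y + Z" X] norm_triangle_ineq[of Y Z] by simp
      then have "\<mu> * (\<bar>c' - c\<bar> + \<bar>t' - t\<bar>) \<le> norm Y + norm Z + norm X" using mu(2) order_trans by blast
      also have "\<dots> \<le> 3 * \<epsilon> * (\<bar>c' - c\<bar> + \<bar>t' - t\<bar>)"
      proof -
        have "0 \<le> \<epsilon> * \<bar>c' - c\<bar>" "0 \<le> \<epsilon> * \<bar>t' - t\<bar>" using eps(1) by simp_all
        moreover have "3 * \<epsilon> * (\<bar>c' - c\<bar> + \<bar>t' - t\<bar>) = 3 * (\<epsilon> * \<bar>c' - c\<bar>) + 3 * (\<epsilon> * \<bar>t' - t\<bar>)" by (simp add: algebra_simps)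
        ultimately show ?thesis using X Y Z by linarith
      qed
      finally have "(\<mu> - 3 * \<epsilon>) * (\<bar>c' - c\<bar> + \<bar>t' - t\<bar>) \<le> 0" by (simp add: algebra_simps)
      then have "\<bar>c' - c\<bar> + \<bar>t' - t\<bar> \<le> 0" using eps(2) by (simp add: mult_le_0_iff)
      then have "c' - c = 0" "t' - t = 0" by linarith+
      then show ?thesis by simp
    qed
    have B: "rho t = 0 \<or> p c \<notin> crossing_points p \<and> L c = R c \<and> L t = R t \<and> cross2 (R c) (R t + shift' d t) \<noteq> 0"
      if c: "c \<in> ball c0 \<eta>" and t: "t \<in> ball t0 \<eta>" "t \<in> {u..v}" and eq: "p c = push_off d t" for c t
    proof (cases "p c \<in> crossing_points p")
      case True
      then have "c = c0" using d3(2) c sub by blast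
      then have "p t0 = push_off d t" using eq cr by simp
      moreover have "(t0, t) \<in> N0" using d6(2) t(1) sub by blast
      ultimately have "rho t = 0" using elim(2) t(2) by blast
      then show ?thesis by simp
    next
      case False
      have "R c \<in> ball (R c0) \<epsilon>1"
      proof -
        have "R c \<in> ball (R c0) \<epsilon>" using d1(2) c sub by blast
        then show ?thesis using eps by simp
      qed
      moreover have "R t + shift' d t \<in> ball (R t0) \<epsilon>1"
      proof -
        have "R t \<in> ball (R t0) \<epsilon>" using d2(2) t(1) sub by blast
        moreover have "norm (shift' d t) < \<epsilon>" using elim(1) t(2) by blast
        moreover have "dist (R t0) (R t + shift' d t) \<le> dist (R t0) (R t) + norm (shift' d t)"
          using dist_triangle[of "R t0" "R t + shift' d t" "R t"] by (simp add: dist_norm)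
        ultimately show ?thesis using eps(3) by simp
      qed
      ultimately have "cross2 (R c) (R t + shift' d t) \<noteq> 0" by (rule e1(2))
      moreover have "L c = R c" using d4(2) c sub by blast
      moreover have "L t = R t" using d5(2) t(1) sub by blast
      ultimately show ?thesis using False by blast
    qed
    show ?case unfolding N_def using A B by auto
  qed
  moreover have "open N" "(c0, t0) \<in> N" using eta(1) by (auto simp: N_def intro: open_Times)
  ultimately show ?thesis by blast
qed

text \<open>The period is closed for the sake of compactness. Its start \<open>k\<close> will be no
  crossing time, so that each crossing is represented once.\<close>

definition crossing_pairs :: "real \<Rightarrow> (real \<times> real) set" where
  "crossing_pairs k = {(c, t). c \<in> {k..k+1} \<and> t \<in> {u..v} \<and> p c = p t \<and> c - t \<notin> \<int>}"

lemma finite_crossing_pairs: "finite (crossing_pairs k)"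
proof -
  have "crossing_pairs k \<subseteq> {c \<in> {k..k+1}. p c \<in> crossing_points p} \<times> {t \<in> {u..v}. p t \<in> crossing_points p}"
  proof
    fix y assume "y \<in> crossing_pairs k"
    then obtain c t where y: "y = (c, t)" "c \<in> {k..k+1}" "t \<in> {u..v}" "p c = p t" "c - t \<notin> \<int>"
      by (auto simp: crossing_pairs_def)
    then have "p t \<in> crossing_points p" unfolding crossing_iff by blast
    then show "y \<in> {c \<in> {k..k+1}. p c \<in> crossing_points p} \<times> {t \<in> {u..v}. p t \<in> crossing_points p}"
      using y by simp
  qed
  then show ?thesis by (rule finite_subset) (intro finite_cartesian_product finite_crossing_times)
qed

text \<open>A pair of times belongs to different points of the plane, to the same time modulo 1, or
  to a crossing; the three preceding lemmas treat these cases. The neighbourhoods are chosen before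
  \<open>d\<close>, so that the ends of the new arc can later be brought into them by shrinking
  \<open>d\<close>.\<close>

lemma arc_solutions:
  "\<exists>N. (\<forall>x\<in>crossing_pairs k. open (N x) \<and> x \<in> N x) \<and> (\<forall>\<^sub>F d in at_right 0.
     (\<forall>x\<in>crossing_pairs k. \<forall>(c, t)\<in>N x. \<forall>(c', t')\<in>N x. t \<in> {u..v} \<longrightarrow> t' \<in> {u..v} \<longrightarrow>
        p c = push_off d t \<longrightarrow> p c' = push_off d t' \<longrightarrow> c = c' \<and> t = t') \<and>
     (\<forall>c\<in>{k..k+1}. \<forall>t\<in>{u..v}. p c = push_off d t \<longrightarrow> rho t = 0 \<or>
        (\<exists>x\<in>crossing_pairs k. (c, t) \<in> N x) \<and> p c \<notin> crossing_points p \<and>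
           L c = R c \<and> L t = R t \<and> cross2 (R c) (R t + shift' d t) \<noteq> 0))"
proof -
  let ?U = "\<lambda>N d. (\<forall>(c, t)\<in>N. \<forall>(c', t')\<in>N. t \<in> {u..v} \<longrightarrow> t' \<in> {u..v} \<longrightarrow>
        p c = push_off d t \<longrightarrow> p c' = push_off d t' \<longrightarrow> c = c' \<and> t = t')"
  let ?G = "\<lambda>d c t. p c \<notin> crossing_points p \<and> L c = R c \<and> L t = R t \<and> cross2 (R c) (R t + shift' d t) \<noteq> 0"
  have "\<forall>x\<in>crossing_pairs k. \<exists>N. open N \<and> x \<in> N \<and> (\<forall>\<^sub>F d in at_right 0. ?U N d \<and>
      (\<forall>(c, t)\<in>N. t \<in> {u..v} \<longrightarrow> p c = push_off d t \<longrightarrow> rho t = 0 \<or> ?G d c t))"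
    using unique_solution_near by (auto simp: crossing_pairs_def)
  from bchoice[OF this] obtain N where N0: "\<forall>x\<in>crossing_pairs k. open (N x) \<and> x \<in> N x \<and> (\<forall>\<^sub>F d in at_right 0. ?U (N x) d \<and>
      (\<forall>(c, t)\<in>N x. t \<in> {u..v} \<longrightarrow> p c = push_off d t \<longrightarrow> rho t = 0 \<or> ?G d c t))"
    by (elim exE)
  have N: "open (N x)" "x \<in> N x" "\<forall>\<^sub>F d in at_right 0. ?U (N x) d"
    "\<forall>\<^sub>F d in at_right 0. \<forall>(c, t)\<in>N x. t \<in> {u..v} \<longrightarrow> p c = push_off d t \<longrightarrow> rho t = 0 \<or> ?G d c t"
    if "x \<in> crossing_pairs k" for x
    using bspec[OF N0 that] unfolding eventually_conj_iff by - (elim conjE, assumption)+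
  have 1: "\<forall>\<^sub>F d in at_right 0. \<forall>x\<in>crossing_pairs k. ?U (N x) d"
    by (rule eventually_ball_finite[OF finite_crossing_pairs]) (rule ballI, rule N(3))
  have 2: "\<forall>\<^sub>F d in at_right 0. \<forall>y\<in>{k..k+1} \<times> {u..v}. p (fst y) = push_off d (snd y) \<longrightarrow> rho (snd y) = 0 \<or>
      (\<exists>x\<in>crossing_pairs k. y \<in> N x) \<and> ?G d (fst y) (snd y)"
  proof (rule eventually_ball_compact)
    show "compact ({k..k+1} \<times> {u..v})" by (intro compact_Times compact_Icc)
    fix y assume y: "y \<in> {k..k+1} \<times> {u..v}"
    obtain c0 t0 where ct: "y = (c0, t0)" by (metis surj_pair)
    have t0: "t0 \<in> {u..v}" "c0 \<in> {k..k+1}" using y ct by auto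
    consider "p c0 \<noteq> p t0" | "c0 - t0 \<in> \<int>" | "p c0 = p t0" "c0 - t0 \<notin> \<int>" by blast
    then show "\<exists>U. open U \<and> y \<in> U \<and> (\<forall>\<^sub>F d in at_right 0. \<forall>y\<in>U \<inter> ({k..k+1} \<times> {u..v}).
       p (fst y) = push_off d (snd y) \<longrightarrow> rho (snd y) = 0 \<or> (\<exists>x\<in>crossing_pairs k. y \<in> N x) \<and> ?G d (fst y) (snd y))"
    proof cases
      case 1
      from no_solution_near[OF 1] obtain U where U: "open U" "(c0, t0) \<in> U"
        "\<forall>\<^sub>F d in at_right 0. \<forall>(c, t)\<in>U. t \<in> {u..v} \<longrightarrow> p c \<noteq> push_off d t" by blast
      from U(3) have "\<forall>\<^sub>F d in at_right 0. \<forall>y\<in>U \<inter> ({k..k+1} \<times> {u..v}).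
       p (fst y) = push_off d (snd y) \<longrightarrow> rho (snd y) = 0 \<or> (\<exists>x\<in>crossing_pairs k. y \<in> N x) \<and> ?G d (fst y) (snd y)"
        by (rule eventually_mono) auto
      then show ?thesis using U(1,2) ct by blast
    next
      case 2
      from only_tail_near[OF t0(1) 2] obtain U where U: "open U" "(c0, t0) \<in> U"
        "\<forall>\<^sub>F d in at_right 0. \<forall>(c, t)\<in>U. t \<in> {u..v} \<longrightarrow> p c = push_off d t \<longrightarrow> rho t = 0" by blast
      from U(3) have "\<forall>\<^sub>F d in at_right 0. \<forall>y\<in>U \<inter> ({k..k+1} \<times> {u..v}).
       p (fst y) = push_off d (snd y) \<longrightarrow> rho (snd y) = 0 \<or> (\<exists>x\<in>crossing_pairs k. y \<in> N x) \<and> ?G d (fst y) (snd y)"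
        by (rule eventually_mono) auto
      then show ?thesis using U(1,2) ct by blast
    next
      case 3
      then have x: "y \<in> crossing_pairs k" using t0 by (simp add: crossing_pairs_def ct)
      have "\<forall>\<^sub>F d in at_right 0. \<forall>(c, t)\<in>N y. t \<in> {u..v} \<longrightarrow> p c = push_off d t \<longrightarrow> rho t = 0 \<or> ?G d c t"
        by (rule N(4)[OF x])
      then have "\<forall>\<^sub>F d in at_right 0. \<forall>y'\<in>N y \<inter> ({k..k+1} \<times> {u..v}).
       p (fst y') = push_off d (snd y') \<longrightarrow> rho (snd y') = 0 \<or> (\<exists>x\<in>crossing_pairs k. y' \<in> N x) \<and> ?G d (fst y') (snd y')"
        by (rule eventually_mono) (use x in auto)
      then show ?thesis using N(1,2)[OF x] by blast
    qed
  qed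
  have 3: "\<forall>\<^sub>F d in at_right 0. (\<forall>x\<in>crossing_pairs k. ?U (N x) d) \<and>
     (\<forall>c\<in>{k..k+1}. \<forall>t\<in>{u..v}. p c = push_off d t \<longrightarrow> rho t = 0 \<or> (\<exists>x\<in>crossing_pairs k. (c, t) \<in> N x) \<and> ?G d c t)"
    using 1 2
  proof eventually_elim
    case (elim d)
    show ?case
    proof
      show "\<forall>x\<in>crossing_pairs k. ?U (N x) d" by (rule elim(1))
      show "\<forall>c\<in>{k..k+1}. \<forall>t\<in>{u..v}. p c = push_off d t \<longrightarrow> rho t = 0 \<or> (\<exists>x\<in>crossing_pairs k. (c, t) \<in> N x) \<and> ?G d c t"
      proof (intro ballI)
        fix c t assume "c \<in> {k..k+1}" "t \<in> {u..v}"
        then show "p c = push_off d t \<longrightarrow> rho t = 0 \<or> (\<exists>x\<in>crossing_pairs k. (c, t) \<in> N x) \<and> ?G d c t"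
          using bspec[OF elim(2), of "(c, t)"] by simp
      qed
    qed
  qed
  have 4: "\<forall>x\<in>crossing_pairs k. open (N x) \<and> x \<in> N x" using N by blast
  show ?thesis by (rule exI[of _ N], rule conjI[OF 4 3])
qed

text \<open>Near the diagonal, progress in the forward direction beats the Lipschitz constant of the
  shift. Away from it, \<open>p\<close> itself separates the points: at a double point one of the
  two times is an overcrossing, and the followed arc has none.\<close>

lemma arc_injective: "\<forall>\<^sub>F d in at_right 0. inj_on (push_off d) {u..v}"
proof -
  have "\<forall>\<^sub>F d in at_right 0. \<forall>y\<in>{u..v} \<times> {u..v}. push_off d (fst y) = push_off d (snd y) \<longrightarrow> fst y = snd y"
  proof (rule eventually_ball_compact)
    show "compact ({u..v} \<times> {u..v})" by (intro compact_Times compact_Icc)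
    fix y assume y: "y \<in> {u..v} \<times> {u..v}"
    obtain s0 t0 where st: "y = (s0, t0)" by (metis surj_pair)
    have T: "s0 \<in> {u..v}" "t0 \<in> {u..v}" using y st by auto
    show "\<exists>U. open U \<and> y \<in> U \<and> (\<forall>\<^sub>F d in at_right 0. \<forall>y\<in>U \<inter> ({u..v} \<times> {u..v}). push_off d (fst y) = push_off d (snd y) \<longrightarrow> fst y = snd y)"
    proof (cases "s0 = t0")
      case True
      obtain e m \<eta> where em: "m > 0" "\<eta> > 0" "\<And>s. s \<in> ball t0 \<eta> \<Longrightarrow> R s \<bullet> e \<ge> m \<and> L s \<bullet> e \<ge> m"
        using forward_direction[of t0] by metis
      have "e \<noteq> 0" using em(3)[of t0] em(1,2) by auto
      then have k: "m / (2 * norm e) > 0" using em(1) by simp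
      have "\<forall>\<^sub>F d in at_right 0. \<forall>y\<in>(ball t0 \<eta> \<times> ball t0 \<eta>) \<inter> ({u..v} \<times> {u..v}). push_off d (fst y) = push_off d (snd y) \<longrightarrow> fst y = snd y"
        using shift_small[OF k]
      proof eventually_elim
        case (elim d)
        have main: "s \<ge> t" if s: "s \<in> ball t0 \<eta>" "s \<in> {u..v}" and t: "t \<in> ball t0 \<eta>" "t \<in> {u..v}"
          and eq: "push_off d s = push_off d t" for s t
        proof (rule ccontr)
          assume "\<not> s \<ge> t"
          then have lt: "s < t" by simp
          have "m * (t - s) \<le> (p t - p s) \<bullet> e"
          proof (rule cone_lower_bound)
            fix x assume "x \<in> {s..t}"
            then have "x \<in> ball t0 \<eta>" using s t by (auto simp: dist_real_def abs_less_iff)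
            then show "m \<le> R x \<bullet> e" using em(3) by blast
          qed (use lt in simp)
          also have "p t - p s = shift d s - shift d t" using eq by (simp add: push_off_def algebra_simps)
          also have "(shift d s - shift d t) \<bullet> e \<le> norm (shift d s - shift d t) * norm e" by (rule norm_cauchy_schwarz)
          also have "\<dots> \<le> (m / (2 * norm e) * \<bar>s - t\<bar>) * norm e"
            using elim s t by (intro mult_right_mono) auto
          also have "\<dots> = m / 2 * (t - s)" using \<open>e \<noteq> 0\<close> lt by simp
          finally show False using em(1) lt by simp
        qed
        show ?case using main by (auto intro!: antisym)
      qed
      moreover have "open (ball t0 \<eta> \<times> ball t0 \<eta>)" by (intro open_Times open_ball)
      ultimately show ?thesis using em(2) True st by (intro exI[of _ "ball t0 \<eta> \<times> ball t0 \<eta>"]) auto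
    next
      case False
      have "p s0 \<noteq> p t0"
      proof
        assume e: "p s0 = p t0"
        have "s0 - t0 \<notin> \<int>"
        proof
          assume "s0 - t0 \<in> \<int>"
          moreover have "s0 \<in> {u..<u+1}" "t0 \<in> {u..<u+1}" using T uv by auto
          ultimately show False using Ints_diff_unit_interval False by blast
        qed
        then have "s0 \<in> over_times \<or> t0 \<in> over_times"
          using crossing_partner_over[OF e] over_under_crossing crossing_iff[of t0] e by blast
        then show False using T T_over by blast
      qed
      define e where "e = dist (p s0) (p t0) / 3"
      have e: "e > 0" using \<open>p s0 \<noteq> p t0\<close> by (simp add: e_def)
      have cp: "continuous_on UNIV p" by (rule continuous)
      define N where "N = {x. 2 * e < dist (p (fst x)) (p (snd x))}"
      have "open N" unfolding N_def
        by (intro open_Collect_less continuous_intros continuous_on_compose2[OF cp]) auto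
      moreover have "y \<in> N" using e by (simp add: N_def e_def st)
      moreover have "\<forall>\<^sub>F d in at_right 0. \<forall>y\<in>N \<inter> ({u..v} \<times> {u..v}). push_off d (fst y) = push_off d (snd y) \<longrightarrow> fst y = snd y"
        using shift_small[OF e]
      proof eventually_elim
        case (elim d)
        have False if "(s, t) \<in> N" "s \<in> {u..v}" "t \<in> {u..v}" "push_off d s = push_off d t" for s t
        proof -
          have "p s - p t = shift d t - shift d s" using that(4) by (simp add: push_off_def algebra_simps)
          then have "dist (p s) (p t) \<le> norm (shift d t) + norm (shift d s)"
            by (simp add: dist_norm norm_triangle_ineq4)
          moreover have "norm (shift d t) < e" "norm (shift d s) < e" using elim that by blast+
          ultimately show False using that(1) by (simp add: N_def)
        qed
        then show ?case by fastforce
      qed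
      ultimately show ?thesis by blast
    qed
  qed
  then show ?thesis by eventually_elim (force simp: inj_on_def)
qed

lemma arc_no_cusp: "\<forall>\<^sub>F d in at_right 0. \<forall>t\<in>{u..v}. 0 \<notin> closed_segment (L t + shift' d t) (R t + shift' d t)"
proof (rule eventually_ball_compact[OF compact_Icc])
  fix t0 assume "t0 \<in> {u..v}"
  obtain e m \<eta> where em: "m > 0" "\<eta> > 0" "\<And>s. s \<in> ball t0 \<eta> \<Longrightarrow> R s \<bullet> e \<ge> m \<and> L s \<bullet> e \<ge> m"
    using forward_direction[of t0] by metis
  have "e \<noteq> 0" using em(3)[of t0] em(1,2) by auto
  then have k: "m / (2 * norm e) > 0" using em(1) by simp
  have "\<forall>\<^sub>F d in at_right 0. \<forall>t\<in>ball t0 \<eta> \<inter> {u..v}. 0 \<notin> closed_segment (L t + shift' d t) (R t + shift' d t)"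
    using shift_small[OF k]
  proof eventually_elim
    case (elim d)
    show ?case
    proof
      fix t assume t: "t \<in> ball t0 \<eta> \<inter> {u..v}"
      have "norm (shift' d t) < m / (2 * norm e)" using elim t by blast
      then have "norm (shift' d t) * norm e < m / (2 * norm e) * norm e" using \<open>e \<noteq> 0\<close> by (intro mult_strict_right_mono) auto
      then have "\<bar>shift' d t \<bullet> e\<bar> < m / 2" using \<open>e \<noteq> 0\<close> Cauchy_Schwarz_ineq2[of "shift' d t" e] by simp
      then have "0 < (L t + shift' d t) \<bullet> e" "0 < (R t + shift' d t) \<bullet> e"
        using em(3)[of t] t em(1) by (auto simp: inner_add_left)
      moreover have "convex {x. 0 < x \<bullet> e}" using convex_halfspace_gt[of 0 e] by (simp add: inner_commute)
      ultimately have "closed_segment (L t + shift' d t) (R t + shift' d t) \<subseteq> {x. 0 < x \<bullet> e}"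
        by (intro closed_segment_subset) auto
      then show "0 \<notin> closed_segment (L t + shift' d t) (R t + shift' d t)" by auto
    qed
  qed
  then show "\<exists>U. open U \<and> t0 \<in> U \<and> (\<forall>\<^sub>F d in at_right 0. \<forall>t\<in>U \<inter> {u..v}. 0 \<notin> closed_segment (L t + shift' d t) (R t + shift' d t))"
    using em(2) by (intro exI[of _ "ball t0 \<eta>"]) auto
qed

end

section \<open>One-sided velocities\<close>

text \<open>A derivative from one side that is also the limit of both velocity functions from that
  side. Being symmetric in \<open>l\<close> and \<open>r\<close>, the notion survives a reversal of
  the direction, which exchanges the two.\<close>

definition one_sided :: "(real \<Rightarrow> complex) \<Rightarrow> (real \<Rightarrow> complex) \<Rightarrow> (real \<Rightarrow> complex) \<Rightarrow> complex \<Rightarrow> real \<Rightarrow> real set \<Rightarrow> bool" where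
  "one_sided f l r D t S \<longleftrightarrow> (f has_vector_derivative D) (at t within S) \<and>
     (l \<longlongrightarrow> D) (at t within S) \<and> (r \<longlongrightarrow> D) (at t within S)"

lemma one_sided_swap: "one_sided f l r D t S \<longleftrightarrow> one_sided f r l D t S"
  by (auto simp: one_sided_def)

lemma one_sided_affine:
  assumes o: "one_sided f l r D y T" and y: "y = b0 + k * t" and sub: "(\<lambda>v. b0 + k * v) ` S \<subseteq> T" and k: "k \<noteq> 0"
  shows "one_sided (\<lambda>v. f (b0 + k * v)) (\<lambda>v. of_real k * l (b0 + k * v)) (\<lambda>v. of_real k * r (b0 + k * v))
    (of_real k * D) t S"
proof -
  have "filterlim (\<lambda>v. b0 + k * v) (at y within T) (at t within S)"
    unfolding filterlim_at
  proof
    show "\<forall>\<^sub>F v in at t within S. b0 + k * v \<in> T \<and> b0 + k * v \<noteq> y"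
      unfolding eventually_at_filter using sub y k by (intro always_eventually) auto
    show "((\<lambda>v. b0 + k * v) \<longlongrightarrow> y) (at t within S)" unfolding y by (intro tendsto_intros)
  qed
  from filterlim_compose[OF _ this] have c: "((\<lambda>v. h (b0 + k * v)) \<longlongrightarrow> D) (at t within S)"
    if "(h \<longlongrightarrow> D) (at y within T)" for h using that by blast
  show ?thesis
    unfolding one_sided_def
  proof (intro conjI tendsto_mult tendsto_const)
    show "((\<lambda>v. f (b0 + k * v)) has_vector_derivative of_real k * D) (at t within S)"
      by (rule has_vector_derivative_reflect[OF _ y sub]) (use o in \<open>simp add: one_sided_def\<close>)
    show "((\<lambda>v. l (b0 + k * v)) \<longlongrightarrow> D) (at t within S)" "((\<lambda>v. r (b0 + k * v)) \<longlongrightarrow> D) (at t within S)"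
      using o by (auto simp: one_sided_def intro: c)
  qed
qed

lemma has_vector_derivative_cong_eventually:
  fixes f :: "real \<Rightarrow> complex"
  assumes "(f has_vector_derivative D) (at x within S)" "\<forall>\<^sub>F y in at x within S. f y = g y" "f x = g x"
  shows "(g has_vector_derivative D) (at x within S)"
proof -
  have b: "bounded_linear (\<lambda>h. h *\<^sub>R D)" and
    t: "((\<lambda>y. norm (f y - f x - (y - x) *\<^sub>R D) / norm (y - x)) \<longlongrightarrow> 0) (at x within S)"
    using assms(1) unfolding has_vector_derivative_def has_derivative_iff_norm by auto
  have "\<forall>\<^sub>F y in at x within S. norm (f y - f x - (y - x) *\<^sub>R D) / norm (y - x)
      = norm (g y - g x - (y - x) *\<^sub>R D) / norm (y - x)"
    using assms(2) by eventually_elim (simp add: assms(3))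
  then have "((\<lambda>y. norm (g y - g x - (y - x) *\<^sub>R D) / norm (y - x)) \<longlongrightarrow> 0) (at x within S)"
    using t by (rule Lim_transform_eventually[rotated])
  then show ?thesis unfolding has_vector_derivative_def has_derivative_iff_norm using b by blast
qed

lemma one_sided_cong:
  assumes "one_sided f l r D t S" "\<forall>\<^sub>F x in at t within S. f x = f' x \<and> l x = l' x \<and> r x = r' x" "f t = f' t"
  shows "one_sided f' l' r' D t S"
  using assms unfolding one_sided_def eventually_conj_iff
  by (auto intro: has_vector_derivative_cong_eventually Lim_transform_eventually)

lemma (in immersed_curve) one_sided:
  "one_sided p L R (R t) t {t<..}" "one_sided p L R (L t) t {..<t}"
  using left right lim_left lim_right lim_L by (auto simp: one_sided_def)

section \<open>Gluing two arcs into a closed curve\<close>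

definition wrap :: "real \<Rightarrow> real \<Rightarrow> real" where
  "wrap a t = t - of_int \<lfloor>t - a\<rfloor>"

lemma wrap_bounds: "wrap a t \<in> {a..<a+1}"
  unfolding wrap_def by auto linarith+

lemma wrap_id: "t \<in> {a..<a+1} \<Longrightarrow> wrap a t = t"
  by (simp add: wrap_def floor_eq_iff)

lemma wrap_add_int: "wrap a (t + of_int n) = wrap a t"
proof -
  have "\<lfloor>t + of_int n - a\<rfloor> = \<lfloor>t - a\<rfloor> + n" by (simp add: floor_eq_iff)
  then show ?thesis by (simp add: wrap_def)
qed

lemma wrap_int: "wrap a t - t \<in> \<int>"
  by (simp add: wrap_def)

definition glue :: "real \<Rightarrow> real \<Rightarrow> (real \<Rightarrow> complex) \<Rightarrow> (real \<Rightarrow> complex) \<Rightarrow> real \<Rightarrow> complex" where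
  "glue a b f1 f2 t = (if wrap a t \<le> b then f1 (wrap a t) else f2 (wrap a t))"
text \<open>At \<open>a\<close> the curve arrives along the second piece, at the end
  \<open>a + 1\<close> of the preceding period.\<close>

definition glue_left :: "real \<Rightarrow> real \<Rightarrow> (real \<Rightarrow> complex) \<Rightarrow> (real \<Rightarrow> complex) \<Rightarrow> real \<Rightarrow> complex" where
  "glue_left a b l1 l2 t = (if wrap a t = a then l2 (a + 1) else if wrap a t \<le> b then l1 (wrap a t) else l2 (wrap a t))"
definition glue_right :: "real \<Rightarrow> real \<Rightarrow> (real \<Rightarrow> complex) \<Rightarrow> (real \<Rightarrow> complex) \<Rightarrow> real \<Rightarrow> complex" where
  "glue_right a b r1 r2 t = (if wrap a t < b then r1 (wrap a t) else r2 (wrap a t))"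

text \<open>The pieces need not fit smoothly: at the two junctions \<open>ca\<close> and
  \<open>cb\<close> only exclude cusps, and the junctions may become corners.\<close>

lemma immersed_curve_glue:
  assumes ab: "a < b" "b < a + 1" and e: "f1 b = f2 b" "f1 a = f2 (a + 1)"
    and r1: "\<And>t. t \<in> {a..<b} \<Longrightarrow> one_sided f1 l1 r1 (r1 t) t {t<..}"
    and l1: "\<And>t. t \<in> {a<..b} \<Longrightarrow> one_sided f1 l1 r1 (l1 t) t {..<t}"
    and r2: "\<And>t. t \<in> {b..<a+1} \<Longrightarrow> one_sided f2 l2 r2 (r2 t) t {t<..}"
    and l2: "\<And>t. t \<in> {b<..a+1} \<Longrightarrow> one_sided f2 l2 r2 (l2 t) t {..<t}"
    and c1: "\<And>t. t \<in> {a<..<b} \<Longrightarrow> 0 \<notin> closed_segment (l1 t) (r1 t)"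
    and c2: "\<And>t. t \<in> {b<..<a+1} \<Longrightarrow> 0 \<notin> closed_segment (l2 t) (r2 t)"
    and ca: "0 \<notin> closed_segment (l2 (a + 1)) (r1 a)" and cb: "0 \<notin> closed_segment (l1 b) (r2 b)"
    and fin: "finite {t \<in> {a..b}. l1 t \<noteq> r1 t}" "finite {t \<in> {b..a+1}. l2 t \<noteq> r2 t}"
  shows "immersed_curve (glue a b f1 f2) (glue_left a b l1 l2) (glue_right a b r1 r2)"
proof -
  let ?g = "glue a b f1 f2" and ?l = "glue_left a b l1 l2" and ?r = "glue_right a b r1 r2"
  note defs = glue_def glue_left_def glue_right_def
  have per: "?g (t + of_int n) = ?g t" "?l (t + of_int n) = ?l t" "?r (t + of_int n) = ?r t" for t n
    unfolding defs wrap_add_int by simp_all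
  have right: "one_sided ?g ?l ?r (?r s) s {s<..}" if s: "s \<in> {a..<a+1}" for s
  proof (cases "s < b")
    case True
    have "\<forall>\<^sub>F x in at_right s. x \<in> {s<..<b}" using eventually_at_right_real[OF True] .
    then have ev: "\<forall>\<^sub>F x in at_right s. f1 x = ?g x \<and> l1 x = ?l x \<and> r1 x = ?r x"
      by eventually_elim (use s ab in \<open>simp add: defs wrap_id\<close>)
    have "?r s = r1 s" "f1 s = ?g s" using s True by (simp_all add: defs wrap_id)
    then show ?thesis using one_sided_cong[OF r1 ev] s True by simp
  next
    case False
    have "\<forall>\<^sub>F x in at_right s. x \<in> {s<..<a+1}" using eventually_at_right_real[of s "a+1"] s by simp
    then have ev: "\<forall>\<^sub>F x in at_right s. f2 x = ?g x \<and> l2 x = ?l x \<and> r2 x = ?r x"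
      by eventually_elim (use s ab False in \<open>simp add: defs wrap_id\<close>)
    have "?r s = r2 s" "f2 s = ?g s" using s False e(1) by (auto simp: defs wrap_id)
    then show ?thesis using one_sided_cong[OF r2 ev] s False by simp
  qed
  have left: "one_sided ?g ?l ?r (?l s) s {..<s}" if s: "s \<in> {a..<a+1}" for s
  proof -
    consider "s = a" | "s \<in> {a<..b}" | "s \<in> {b<..<a+1}" using s by fastforce
    then show ?thesis
    proof cases
      case 1
      have "one_sided (\<lambda>v. f2 (1 + 1 * v)) (\<lambda>v. of_real 1 * l2 (1 + 1 * v)) (\<lambda>v. of_real 1 * r2 (1 + 1 * v))
        (of_real 1 * l2 (a + 1)) a {..<a}"
        by (rule one_sided_affine[OF l2]) (use ab in auto)
      moreover have "\<forall>\<^sub>F x in at_left a. x \<in> {b-1<..<a}" using eventually_at_left_real[of "b-1" a] ab by simp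
      then have "\<forall>\<^sub>F x in at_left a. f2 (1 + 1 * x) = ?g x \<and> of_real 1 * l2 (1 + 1 * x) = ?l x \<and> of_real 1 * r2 (1 + 1 * x) = ?r x"
      proof eventually_elim
        case (elim x)
        have "wrap a x = wrap a (x + of_int 1)" by (rule wrap_add_int[symmetric])
        also have "\<dots> = x + 1" using elim ab by (simp add: wrap_id)
        finally show ?case using elim ab by (simp add: defs add.commute)
      qed
      ultimately have "one_sided ?g ?l ?r (of_real 1 * l2 (a + 1)) a {..<a}"
        by (rule one_sided_cong) (use ab e in \<open>simp add: defs wrap_id add.commute\<close>)
      moreover have "?l a = l2 (a + 1)" by (simp add: defs wrap_id)
      ultimately show ?thesis using 1 by simp
    next
      case 2
      have "\<forall>\<^sub>F x in at_left s. x \<in> {a<..<s}" using eventually_at_left_real[of a s] 2 by simp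
      then have ev: "\<forall>\<^sub>F x in at_left s. f1 x = ?g x \<and> l1 x = ?l x \<and> r1 x = ?r x"
        by eventually_elim (use s 2 in \<open>simp add: defs wrap_id\<close>)
      have "?l s = l1 s" "f1 s = ?g s" using s 2 by (simp_all add: defs wrap_id)
      then show ?thesis using one_sided_cong[OF l1 ev] 2 by simp
    next
      case 3
      have "\<forall>\<^sub>F x in at_left s. x \<in> {b<..<s}" using eventually_at_left_real[of b s] 3 by simp
      then have ev: "\<forall>\<^sub>F x in at_left s. f2 x = ?g x \<and> l2 x = ?l x \<and> r2 x = ?r x"
        by eventually_elim (use s 3 ab in \<open>simp add: defs wrap_id\<close>)
      have "?l s = l2 s" "f2 s = ?g s" using s 3 ab by (simp_all add: defs wrap_id)
      then show ?thesis using one_sided_cong[OF l2 ev] 3 by simp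
    qed
  qed
  have all: "one_sided ?g ?l ?r (?r t) t {t<..} \<and> one_sided ?g ?l ?r (?l t) t {..<t}" for t
  proof -
    define n where "n = \<lfloor>t - a\<rfloor>"
    define s where "s = wrap a t"
    have s: "s \<in> {a..<a+1}" "s = - of_int n + 1 * t" using wrap_bounds by (auto simp: s_def wrap_def n_def)
    have "t = s + of_int n" using s by simp
    then have v: "?r t = ?r s" "?l t = ?l s" using per by simp_all
    have sh: "?g (- of_int n + 1 * v) = ?g v" "?l (- of_int n + 1 * v) = ?l v" "?r (- of_int n + 1 * v) = ?r v" for v
      using per[of "- of_int n + 1 * v" n] by simp_all
    have "one_sided ?g ?l ?r D t S" if "one_sided ?g ?l ?r D s T" "(\<lambda>v. - of_int n + 1 * v) ` S \<subseteq> T" for D S T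
      using one_sided_affine[OF that(1) s(2) that(2)] unfolding sh by simp
    moreover have "(\<lambda>v. - of_int n + 1 * v) ` {t<..} \<subseteq> {s<..}" "(\<lambda>v. - of_int n + 1 * v) ` {..<t} \<subseteq> {..<s}"
      unfolding s(2) by auto
    ultimately show ?thesis unfolding v using right[OF s(1)] left[OF s(1)] by blast
  qed
  have cusp: "0 \<notin> closed_segment (?l t) (?r t)" for t
  proof -
    define s where "s = wrap a t"
    have s: "s \<in> {a..<a+1}" using wrap_bounds by (auto simp: s_def)
    consider "s = a" | "s \<in> {a<..<b}" | "s = b" | "s \<in> {b<..<a+1}" using s by fastforce
    then show ?thesis
      by cases (use ab ca cb c1[of s] c2[of s] in \<open>auto simp: defs s_def[symmetric]\<close>)
  qed
  have "finite {t \<in> {0..<1}. ?l t \<noteq> ?r t}"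
  proof -
    let ?F = "{t \<in> {a..b}. l1 t \<noteq> r1 t} \<union> {t \<in> {b..a+1}. l2 t \<noteq> r2 t} \<union> {a, b}"
    have "{t \<in> {0..<1}. ?l t \<noteq> ?r t} \<subseteq> (\<lambda>(c, n). c + of_int n) ` (?F \<times> {\<lfloor>0 - a\<rfloor>..\<lfloor>1 - a\<rfloor>})"
    proof
      fix t assume t: "t \<in> {t \<in> {0..<1}. ?l t \<noteq> ?r t}"
      define s where "s = wrap a t"
      have s: "s \<in> {a..<a+1}" using wrap_bounds by (auto simp: s_def)
      have "s \<in> ?F"
      proof (rule ccontr)
        assume n: "s \<notin> ?F"
        then consider "s \<in> {a<..<b}" "l1 s = r1 s" | "s \<in> {b<..<a+1}" "l2 s = r2 s" using s by fastforce
        then have "?l t = ?r t" by cases (use ab in \<open>auto simp: defs s_def[symmetric]\<close>)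
        then show False using t by simp
      qed
      moreover have "\<lfloor>t - a\<rfloor> \<in> {\<lfloor>0 - a\<rfloor>..\<lfloor>1 - a\<rfloor>}" using t by (auto intro!: floor_mono)
      moreover have "t = s + of_int \<lfloor>t - a\<rfloor>" by (simp add: s_def wrap_def)
      ultimately show "t \<in> (\<lambda>(c, n). c + of_int n) ` (?F \<times> {\<lfloor>0 - a\<rfloor>..\<lfloor>1 - a\<rfloor>})"
        by (intro image_eqI[of _ _ "(s, \<lfloor>t - a\<rfloor>)"]) auto
    qed
    then show ?thesis by (rule finite_subset) (use fin in auto)
  qed
  moreover have "?g (t + 1) = ?g t" for t using per(1)[of t 1] by simp
  ultimately show ?thesis
    using all cusp by unfold_locales (auto simp: one_sided_def)
qed

lemma cross2_no_cusp:
  assumes "cross2 x y \<noteq> 0" shows "0 \<notin> closed_segment x y"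
proof
  assume "0 \<in> closed_segment x y"
  then obtain s where s: "0 = (1 - s) *\<^sub>R x + s *\<^sub>R y" unfolding closed_segment_def by blast
  have "cross2 x ((1 - s) *\<^sub>R x + s *\<^sub>R y) = s * cross2 x y"
    "cross2 ((1 - s) *\<^sub>R x + s *\<^sub>R y) y = (1 - s) * cross2 x y" by (simp_all add: cross2_def algebra_simps)
  moreover have "cross2 x 0 = 0" "cross2 0 y = 0" by (simp_all add: cross2_def)
  ultimately have "s * cross2 x y = 0" "(1 - s) * cross2 x y = 0" unfolding s[symmetric] by linarith+
  then show False using assms by auto
qed

lemma (in immersed_curve) piecewise_C1_immersion: "piecewise_C1_immersion p"
  unfolding piecewise_C1_immersion_def
  using finite_corners left right lim_left lim_right no_cusp by blast

context parallel_arc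
begin

lemma push_off_one_sided:
  "one_sided (push_off d) (\<lambda>t. L t + shift' d t) (\<lambda>t. R t + shift' d t) (R t + shift' d t) t {t<..}"
  "one_sided (push_off d) (\<lambda>t. L t + shift' d t) (\<lambda>t. R t + shift' d t) (L t + shift' d t) t {..<t}"
proof -
  have s: "(shift d has_vector_derivative shift' d t) (at t within S)" for S
    by (rule has_vector_derivative_at_within[OF shift_deriv])
  have "isCont (shift' d) t" using continuous_shift'[of UNIV] by (simp add: continuous_on_eq_continuous_at)
  then have c: "(shift' d \<longlongrightarrow> shift' d t) (at t within S)" for S
    unfolding isCont_def by (rule tendsto_within_subset) simp
  show "one_sided (push_off d) (\<lambda>t. L t + shift' d t) (\<lambda>t. R t + shift' d t) (R t + shift' d t) t {t<..}"
    "one_sided (push_off d) (\<lambda>t. L t + shift' d t) (\<lambda>t. R t + shift' d t) (L t + shift' d t) t {..<t}"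
    using one_sided unfolding one_sided_def push_off_def[abs_def]
    by (auto intro!: has_vector_derivative_add tendsto_add s c)
qed

text \<open>Where the new arc runs into the followed one, the shift vanishes but its derivative is a
  nonzero multiple of \<open>w\<close> plus a small error. So the two tangents there are not
  parallel.\<close>

lemma tail_transversal:
  "\<forall>\<^sub>F d in at_right 0. (su = 0 \<longrightarrow> cross2 (R u) (shift' d u) \<noteq> 0) \<and> (sv = 0 \<longrightarrow> cross2 (L v) (shift' d v) \<noteq> 0)"
proof -
  have mem: "u \<in> {u..v}" "v \<in> {u..v}" using uv by auto
  have key: "\<forall>\<^sub>F d in at_right 0. \<forall>r. norm r \<le> e / 2 * d \<longrightarrow> \<sigma> * cross2 (L t) (of_real (1 / d) * (of_real d * w t + r)) > 0 \<and>
     \<sigma> * cross2 (R t) (of_real (1 / d) * (of_real d * w t + r)) > 0"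
    if e: "e > 0" "m > 0" "\<forall>w'\<in>ball (w t) e. \<sigma> * cross2 (L t) w' \<ge> m \<and> \<sigma> * cross2 (R t) w' \<ge> m" for t e m
    using eventually_at_right_0_less[OF zero_less_one]
  proof eventually_elim
    case (elim d)
    show ?case
    proof (intro allI impI)
      fix r :: complex assume r: "norm r \<le> e / 2 * d"
      have "of_real (1 / d) * (of_real d * w t + r) - w t = r / of_real d" using elim by (simp add: field_simps)
      then have "norm (of_real (1 / d) * (of_real d * w t + r) - w t) = norm r / d"
        using elim by (simp add: norm_divide)
      then have "dist (w t) (of_real (1 / d) * (of_real d * w t + r)) = norm r / d"
        unfolding dist_norm by (metis norm_minus_commute)
      also have "\<dots> \<le> e / 2" using r elim by (simp add: divide_le_eq)
      also have "\<dots> < e" using e by simp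
      finally have "of_real (1 / d) * (of_real d * w t + r) \<in> ball (w t) e" by simp
      from bspec[OF e(3) this] show "\<sigma> * cross2 (L t) (of_real (1 / d) * (of_real d * w t + r)) > 0 \<and>
         \<sigma> * cross2 (R t) (of_real (1 / d) * (of_real d * w t + r)) > 0" using e(2) by linarith
    qed
  qed
  obtain d1 e1 m1 where 1: "d1 > 0" "e1 > 0" "m1 > 0"
    "\<And>s w'. s \<in> ball u d1 \<Longrightarrow> w' \<in> ball (w u) e1 \<Longrightarrow> \<sigma> * cross2 (L s) w' \<ge> m1 \<and> \<sigma> * cross2 (R s) w' \<ge> m1"
    using transversal_nbhd[OF w_trans[OF mem(1)] \<sigma>] by blast
  obtain d2 e2 m2 where 2: "d2 > 0" "e2 > 0" "m2 > 0"
    "\<And>s w'. s \<in> ball v d2 \<Longrightarrow> w' \<in> ball (w v) e2 \<Longrightarrow> \<sigma> * cross2 (L s) w' \<ge> m2 \<and> \<sigma> * cross2 (R s) w' \<ge> m2"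
    using transversal_nbhd[OF w_trans[OF mem(2)] \<sigma>] by blast
  have k1: "\<forall>w'\<in>ball (w u) e1. \<sigma> * cross2 (L u) w' \<ge> m1 \<and> \<sigma> * cross2 (R u) w' \<ge> m1"
    using 1(4)[of u] 1(1) by simp
  have k2: "\<forall>w'\<in>ball (w v) e2. \<sigma> * cross2 (L v) w' \<ge> m2 \<and> \<sigma> * cross2 (R v) w' \<ge> m2"
    using 2(4)[of v] 2(1) by simp
  have h1: "e1 / 2 > 0" and h2: "e2 / 2 > 0" using 1(2) 2(2) by auto
  show ?thesis
    using key[OF 1(2,3) k1] key[OF 2(2,3) k2] remainder_small(2)[OF h1] remainder_small(1)[OF h2]
      eventually_at_right_0_less[OF zero_less_one]
  proof eventually_elim
    case (elim d)
    let ?k = "1 / (v - u)"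
    have kp: "?k \<noteq> 0" using uv by simp
    show ?case
    proof (intro conjI impI)
      assume z: "su = 0"
      then have s1: "\<bar>sv\<bar> = 1" using not_both abs_s by auto
      have "rho u = 0" "ru d = 0" unfolding rho_def lu_ends ru_def using z by simp_all
      then have "shift' d u = of_real ?k * (of_real d * w u + rv d)"
        unfolding shift'_def s1 using z by (simp add: algebra_simps)
      also have "\<dots> = of_real (?k * d) * (of_real (1 / d) * (of_real d * w u + rv d))"
        using elim(5) by simp
      finally have e: "cross2 (R u) (shift' d u) = ?k * d * cross2 (R u) (of_real (1 / d) * (of_real d * w u + rv d))"
        by (simp only: cross2_scale)
      have "norm (rv d) \<le> e1 / 2 * d" using elim(3) s1 by simp
      then have "cross2 (R u) (of_real (1 / d) * (of_real d * w u + rv d)) \<noteq> 0" using elim(1) by force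
      then show "cross2 (R u) (shift' d u) \<noteq> 0" unfolding e using kp elim(5) by simp
    next
      assume z: "sv = 0"
      then have s1: "\<bar>su\<bar> = 1" using not_both abs_s by auto
      have "rho v = 0" "rv d = 0" unfolding rho_def lu_ends rv_def using z by simp_all
      then have "shift' d v = of_real (- ?k) * (of_real d * w v + ru d)"
        unfolding shift'_def s1 using z by (simp add: algebra_simps)
      also have "\<dots> = of_real (- ?k * d) * (of_real (1 / d) * (of_real d * w v + ru d))"
        using elim(5) by simp
      finally have e: "cross2 (L v) (shift' d v) = - ?k * d * cross2 (L v) (of_real (1 / d) * (of_real d * w v + ru d))"
        by (simp only: cross2_scale)
      have "norm (ru d) \<le> e2 / 2 * d" using elim(4) s1 by simp
      then have "cross2 (L v) (of_real (1 / d) * (of_real d * w v + ru d)) \<noteq> 0" using elim(2) by force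
      then show "cross2 (L v) (shift' d v) \<noteq> 0" unfolding e using kp elim(5) by simp
    qed
  qed
qed

end

section \<open>Rerouting an arc\<close>

lemma card_image_diff_bound:
  fixes X :: "'a set"
  assumes "finite X" "Rem \<subseteq> X" "Y \<subseteq> (X - Rem) \<union> New" "finite New" "card New \<le> m" "n \<le> card Rem"
  shows "finite Y \<and> card Y + n \<le> card X + m"
proof
  have f: "finite ((X - Rem) \<union> New)" using assms by simp
  then show "finite Y" using assms(3) finite_subset by blast
  have "card Y \<le> card ((X - Rem) \<union> New)" by (rule card_mono[OF f assms(3)])
  also have "\<dots> \<le> card (X - Rem) + card New" by (rule card_Un_le)
  also have "card (X - Rem) = card X - card Rem" using assms by (simp add: card_Diff_subset finite_subset)
  finally have "card Y \<le> card X - card Rem + card New" .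
  moreover have "card Rem \<le> card X" using assms by (simp add: card_mono)
  ultimately show "card Y + n \<le> card X + m" using assms by linarith
qed

lemma sub_notin_Ints: "0 < \<bar>x - y\<bar> \<Longrightarrow> \<bar>x - y\<bar> < 1 \<Longrightarrow> x - y \<notin> (\<int> :: real set)"
proof
  assume h: "0 < \<bar>x - y\<bar>" "\<bar>x - y\<bar> < 1" "x - y \<in> \<int>"
  then obtain n where "x - y = of_int n" by (auto elim: Ints_cases)
  then have "real_of_int 0 < real_of_int \<bar>n\<bar>" "real_of_int \<bar>n\<bar> < real_of_int 1" using h by auto
  then show False unfolding of_int_less_iff by linarith
qed

lemma Ints_diff_trans: "x - y \<in> \<int> \<Longrightarrow> y - z \<in> \<int> \<Longrightarrow> x - z \<in> (\<int> :: real set)"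
  using Ints_add[of "x - y" "y - z"] by simp

lemma Ints_diff_sym: "x - y \<in> \<int> \<Longrightarrow> y - x \<in> (\<int> :: real set)"
  using Ints_minus[of "x - y"] by simp

lemma wrap_eq_Ints: "wrap a s = wrap a t \<Longrightarrow> s - t \<in> \<int>"
proof -
  assume "wrap a s = wrap a t"
  then have "s - t = of_int (\<lfloor>s - a\<rfloor> - \<lfloor>t - a\<rfloor>)" by (simp add: wrap_def)
  then show ?thesis by (metis Ints_of_int)
qed

lemma crossing_pointsI:
  assumes "p s = p t" "s - t \<notin> \<int>" shows "p s \<in> crossing_points p" "p t \<in> crossing_points p"
proof -
  have "\<exists>s' t'. s' - t' \<notin> \<int> \<and> p s' = p t \<and> p t' = p t" using assms by blast
  then show "p s \<in> crossing_points p" "p t \<in> crossing_points p" unfolding crossing_points_def assms(1) by blast+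
qed

context parallel_arc
begin

text \<open>\<open>ta\<close> and \<open>tb\<close> are the ends of the followed arc that match the
  ends \<open>a0\<close> and \<open>a1\<close> of the old one; the first alternative of
  \<open>ends\<close> is the case of equal directions, the second that of opposite ones. New
  crossings come only from undercrossings inside the followed arc. All crossings between the cuts
  \<open>a0 + s0 * d\<close> and \<open>a1 + s1 * d\<close> disappear, and \<open>s0\<close> puts at
  least one of \<open>a0\<close> and \<open>a1\<close> strictly between the cuts, whence the
  \<open>+ 1\<close>.\<close>

theorem reroute_along:
  assumes ends: "(a0, s0, ta, a1, s1, tb) = (au, su, u, av, sv, v) \<and> su \<noteq> 0 \<and> sv \<noteq> 0 \<or>
      (a0, s0, ta, a1, s1, tb) = (av, sv, v, au, su, u)"
    and a01: "a0 < a1" "a1 < a0 + 1" and under: "{a0..a1} \<inter> under_times = {}"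
    and s0: "s0 \<noteq> 1" "s0 = 0 \<Longrightarrow> s1 = 1"
    and tails: "su = 0 \<Longrightarrow> p u \<notin> crossing_points p" "sv = 0 \<Longrightarrow> p v \<notin> crossing_points p"
  shows "\<exists>q. isotopic_curves (\<lambda>t. (p t, z t)) q \<and> regular_closed_curve (fst \<circ> q) \<and>
    card (crossing_points (fst \<circ> q)) + (card (over_times \<inter> {a0<..<a1}) + 1)
      \<le> card (crossing_points p) + card (under_times \<inter> {u<..<v})"
proof -
  let ?X = "crossing_points p"
  have times: "t \<in> over_times \<union> under_times \<longleftrightarrow> p t \<in> ?X" for t using over_under_crossing by blast
  have s0': "s0 = -1 \<or> s0 = 0" and s1': "s1 = -1 \<or> s1 = 0 \<or> s1 = 1" using ends su sv s0(1) by auto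
  have tab: "{ta, tb} = {u, v}" "ta \<in> {u..v}" "tb \<in> {u..v}" "ta \<noteq> tb" using ends uv by auto
  have cr0: "s0 \<noteq> 0 \<Longrightarrow> p a0 = p ta \<and> a0 - ta \<notin> \<int>" and cr1: "s1 \<noteq> 0 \<Longrightarrow> p a1 = p tb \<and> a1 - tb \<notin> \<int>"
    using ends u_cross v_cross by auto
  have tl0: "s0 = 0 \<Longrightarrow> a0 = ta \<and> p a0 \<notin> ?X" and tl1: "s1 = 0 \<Longrightarrow> a1 = tb \<and> p a1 \<notin> ?X"
    using ends u_tail v_tail tails by auto
  have over0: "s0 \<noteq> 0 \<Longrightarrow> a0 \<in> over_times" and over1: "s1 \<noteq> 0 \<Longrightarrow> a1 \<in> over_times"
  proof -
    have "a0 \<in> {a0..a1}" "a1 \<in> {a0..a1}" using a01 by auto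
    then have "a0 \<notin> under_times" "a1 \<notin> under_times" using under by blast+
    moreover have "p a0 \<in> ?X" if "s0 \<noteq> 0" using cr0[OF that] crossing_pointsI(1)[of p a0 ta] by blast
    moreover have "p a1 \<in> ?X" if "s1 \<noteq> 0" using cr1[OF that] crossing_pointsI(1)[of p a1 tb] by blast
    ultimately show "s0 \<noteq> 0 \<Longrightarrow> a0 \<in> over_times" "s1 \<noteq> 0 \<Longrightarrow> a1 \<in> over_times"
      using times[of a0] times[of a1] by blast+
  qed
  \<comment> \<open>A cut point for the parameter circle away from the crossings.\<close>
  obtain k where k: "a1 - 1 < k" "k < a0" "p k \<notin> ?X"
  proof -
    have "infinite {a1 - 1<..<a0}" using a01 by (simp add: infinite_Ioo)
    moreover have "finite {t \<in> {a1-1..a0}. p t \<in> ?X}" by (rule finite_crossing_times)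
    ultimately have "infinite ({a1 - 1<..<a0} - {t \<in> {a1-1..a0}. p t \<in> ?X})" by (rule Diff_infinite_finite[rotated])
    then have "{a1 - 1<..<a0} - {t \<in> {a1-1..a0}. p t \<in> ?X} \<noteq> {}" by (metis finite.emptyI)
    then obtain x where x: "x \<in> {a1 - 1<..<a0} - {t \<in> {a1-1..a0}. p t \<in> ?X}" by blast
    show thesis by (rule that[of x]) (use x in auto)
  qed
  have rep_unique: "c = c'" if "c \<in> {k..k+1}" "c' \<in> {k..k+1}" "c - c' \<in> \<int>" "p c \<in> ?X" for c c'
  proof (rule ccontr)
    assume "c \<noteq> c'"
    have pe: "p c = p c'" by (rule p_int[OF that(3)])
    have "p (k + 1) = p k" by (rule p_periodic)
    then have ne: "c \<noteq> k" "c \<noteq> k + 1" "c' \<noteq> k" "c' \<noteq> k + 1" using that(4) pe k(3) by auto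
    then have "\<bar>c - c'\<bar> < 1" using that by (auto simp: abs_less_iff less_le)
    then show False using sub_notin_Ints[of c c'] \<open>c \<noteq> c'\<close> that(3) by simp
  qed
  obtain N where N12: "\<forall>x\<in>crossing_pairs k. open (N x) \<and> x \<in> N x" and N3: "\<forall>\<^sub>F d in at_right 0.
     (\<forall>x\<in>crossing_pairs k. \<forall>(c, t)\<in>N x. \<forall>(c', t')\<in>N x. t \<in> {u..v} \<longrightarrow> t' \<in> {u..v} \<longrightarrow>
        p c = push_off d t \<longrightarrow> p c' = push_off d t' \<longrightarrow> c = c' \<and> t = t') \<and>
     (\<forall>c\<in>{k..k+1}. \<forall>t\<in>{u..v}. p c = push_off d t \<longrightarrow> rho t = 0 \<or>
        (\<exists>x\<in>crossing_pairs k. (c, t) \<in> N x) \<and> p c \<notin> crossing_points p \<and>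
           L c = R c \<and> L t = R t \<and> cross2 (R c) (R t + shift' d t) \<noteq> 0)"
    using arc_solutions[of k] by (elim exE conjE) (rule that; assumption)
  have N: "open (N x)" "x \<in> N x" if "x \<in> crossing_pairs k" for x using bspec[OF N12 that] by simp_all
  have pair0: "(a0, ta) \<in> crossing_pairs k" if "s0 \<noteq> 0"
    using cr0[OF that] tab(2) k a01 by (simp add: crossing_pairs_def)
  have pair1: "(a1, tb) \<in> crossing_pairs k" if "s1 \<noteq> 0"
    using cr1[OF that] tab(3) k a01 by (simp add: crossing_pairs_def)
  have nb: "\<forall>\<^sub>F d in at_right 0. (a + s * d, t) \<in> U" if "open U" "(a, t) \<in> U" for a s t :: real and U
  proof -
    have "((\<lambda>d. (a + s * d, t)) \<longlongrightarrow> (a + s * 0, t)) (at_right 0)" by (intro tendsto_intros)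
    then show ?thesis using topological_tendstoD[OF _ that(1)] that(2) by simp
  qed
  have ev0: "\<forall>\<^sub>F d in at_right 0. s0 \<noteq> 0 \<longrightarrow> (a0 + s0 * d, ta) \<in> N (a0, ta)"
  proof (cases "s0 = 0")
    case False
    from nb[OF N(1)[OF pair0[OF False]] N(2)[OF pair0[OF False]], of s0] show ?thesis by (rule eventually_mono) simp
  qed simp
  have ev1: "\<forall>\<^sub>F d in at_right 0. s1 \<noteq> 0 \<longrightarrow> (a1 + s1 * d, tb) \<in> N (a1, tb)"
  proof (cases "s1 = 0")
    case False
    from nb[OF N(1)[OF pair1[OF False]] N(2)[OF pair1[OF False]], of s1] show ?thesis by (rule eventually_mono) simp
  qed simp
  obtain e0 where e0: "e0 > 0" "\<And>c. c \<in> ball a0 e0 \<Longrightarrow> p c \<in> ?X \<Longrightarrow> c = a0" using crossing_times_isolated by metis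
  obtain e1 where e1: "e1 > 0" "\<And>c. c \<in> ball a1 e1 \<Longrightarrow> p c \<in> ?X \<Longrightarrow> c = a1" using crossing_times_isolated by metis
  define e where "e = min (min e0 e1) (min (min (a0 - k) (k + 1 - a1)) (min ((a1 - a0) / 4) ((a0 + 1 - a1) / 4)))"
  have e: "e > 0" using e0(1) e1(1) k a01 by (simp add: e_def)
  have "\<forall>\<^sub>F d in at_right 0. 0 < d \<and> d < e" by (rule eventually_at_right_0_less[OF e])
  note EV = eventually_conj[OF this eventually_conj[OF N3 eventually_conj[OF ev0
    eventually_conj[OF ev1 eventually_conj[OF arc_injective eventually_conj[OF arc_no_cusp tail_transversal]]]]]]
  obtain d where d: "0 < d" "d < e"
    and DU: "\<forall>x\<in>crossing_pairs k. \<forall>(c, t)\<in>N x. \<forall>(c', t')\<in>N x. t \<in> {u..v} \<longrightarrow> t' \<in> {u..v} \<longrightarrow>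
        p c = push_off d t \<longrightarrow> p c' = push_off d t' \<longrightarrow> c = c' \<and> t = t'"
    and DS: "\<forall>c\<in>{k..k+1}. \<forall>t\<in>{u..v}. p c = push_off d t \<longrightarrow> rho t = 0 \<or>
        (\<exists>x\<in>crossing_pairs k. (c, t) \<in> N x) \<and> p c \<notin> crossing_points p \<and>
           L c = R c \<and> L t = R t \<and> cross2 (R c) (R t + shift' d t) \<noteq> 0"
    and Na0': "s0 \<noteq> 0 \<longrightarrow> (a0 + s0 * d, ta) \<in> N (a0, ta)" and Na1': "s1 \<noteq> 0 \<longrightarrow> (a1 + s1 * d, tb) \<in> N (a1, tb)"
    and inj: "inj_on (push_off d) {u..v}"
    and cusp': "\<forall>t\<in>{u..v}. 0 \<notin> closed_segment (L t + shift' d t) (R t + shift' d t)"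
    and tail': "su = 0 \<longrightarrow> cross2 (R u) (shift' d u) \<noteq> 0" "sv = 0 \<longrightarrow> cross2 (L v) (shift' d v) \<noteq> 0"
    using eventually_happens'[OF trivial_limit_at_right_real EV] by (elim exE conjE) (rule that; assumption)
  have N_unique: "c = c' \<and> t = t'" if "x \<in> crossing_pairs k" "(c, t) \<in> N x" "(c', t') \<in> N x" "t \<in> {u..v}" "t' \<in> {u..v}"
      "p c = push_off d t" "p c' = push_off d t'" for x c t c' t'
  proof -
    from bspec[OF bspec[OF DU that(1)] that(2)] have "\<forall>(c', t')\<in>N x. t \<in> {u..v} \<longrightarrow> t' \<in> {u..v} \<longrightarrow>
        p c = push_off d t \<longrightarrow> p c' = push_off d t' \<longrightarrow> c = c' \<and> t = t'" unfolding prod.case .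
    from bspec[OF this that(3)] show ?thesis unfolding prod.case using that(4-) by (elim impE; simp)
  qed
  have N_solution: "(\<exists>x\<in>crossing_pairs k. (c, t) \<in> N x) \<and> p c \<notin> crossing_points p \<and>
           L c = R c \<and> L t = R t \<and> cross2 (R c) (R t + shift' d t) \<noteq> 0"
    if "c \<in> {k..k+1}" "t \<in> {u..v}" "p c = push_off d t" "rho t \<noteq> 0" for c t
    using bspec[OF bspec[OF DS that(1)] that(2)] that(3,4) by blast
  have Na0: "(a0 + s0 * d, ta) \<in> N (a0, ta)" if "s0 \<noteq> 0" using Na0' that by blast
  have Na1: "(a1 + s1 * d, tb) \<in> N (a1, tb)" if "s1 \<noteq> 0" using Na1' that by blast
  have cusp: "0 \<notin> closed_segment (L t + shift' d t) (R t + shift' d t)" if "t \<in> {u..v}" for t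
    by (rule bspec[OF cusp' that])
  have tail: "su = 0 \<Longrightarrow> cross2 (R u) (shift' d u) \<noteq> 0" "sv = 0 \<Longrightarrow> cross2 (L v) (shift' d v) \<noteq> 0"
    using tail' by blast+
  define a where "a = a0 + s0 * d"
  define b where "b = a1 + s1 * d"
  have de: "d < e0" "d < e1" "d < a0 - k" "d < k + 1 - a1" "d < (a1 - a0) / 4" "d < (a0 + 1 - a1) / 4"
    using d(2) unfolding e_def min_less_iff_conj by blast+
  have bds: "a0 - d \<le> a" "a \<le> a0" "a1 - d \<le> b" "b \<le> a1 + d" using s0' s1' d(1) by (auto simp: a_def b_def)
  have ab: "a < b" "b < a + 1" "k < a" "b < k + 1" using bds de by (auto simp: field_simps)
  have na: "p a \<notin> ?X"
  proof (cases "s0 = 0")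
    case True
    then have "a = a0" by (simp add: a_def)
    then show ?thesis using tl0[OF True] by blast
  next
    case False
    have "a \<in> ball a0 e0" "a \<noteq> a0" using s0' False d(1) de(1) by (auto simp: a_def dist_real_def)
    then show ?thesis using e0(2) by blast
  qed
  have nb: "p b \<notin> ?X"
  proof (cases "s1 = 0")
    case True
    then have "b = a1" by (simp add: b_def)
    then show ?thesis using tl1[OF True] by blast
  next
    case False
    have "b \<in> ball a1 e1" "b \<noteq> a1" using s1' False d(1) de(2) by (auto simp: b_def dist_real_def)
    then show ?thesis using e1(2) by blast
  qed
  have under': "{a..b} \<inter> under_times = {}"
  proof -
    have "t \<notin> under_times" if t: "t \<in> {a..b}" for t
    proof (cases "t \<in> {a0..a1}")
      case True then show ?thesis using under by blast
    next
      case False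
      then have "t < a0 \<or> a1 < t" by auto
      then have "t \<in> ball a0 e0 \<and> t \<noteq> a0 \<or> t \<in> ball a1 e1 \<and> t \<noteq> a1"
      proof
        assume "t < a0"
        then show ?thesis using t bds(1) de(1) by (simp add: dist_real_def)
      next
        assume "a1 < t"
        then show ?thesis using t bds(4) de(2) by (simp add: dist_real_def)
      qed
      then have "p t \<notin> ?X" using e0(2) e1(2) by blast
      then show ?thesis using times by blast
    qed
    then show ?thesis by blast
  qed
  have pea: "push_off d ta = p a" "push_off d tb = p b" using ends arc_ends[of d] by (auto simp: a_def b_def)
  \<comment> \<open>The speed of the affine change of parameter from the cut-out interval to the
    followed arc. It is negative if that arc is run backwards, and then the left and right
    velocities change roles in \<open>l1\<close> and \<open>r1\<close>.\<close>
  define \<kappa> where "\<kappa> = (tb - ta) / (b - a)"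
  have \<kappa>: "\<kappa> \<noteq> 0" using tab ab by (simp add: \<kappa>_def)
  define \<theta>0 where "\<theta>0 = ta - \<kappa> * a"
  define \<theta> where "\<theta> t = \<theta>0 + \<kappa> * t" for t
  have \<theta>a: "\<theta> a = ta" by (simp add: \<theta>_def \<theta>0_def)
  have \<theta>b: "\<theta> b = tb"
  proof -
    have "\<theta> b = ta + \<kappa> * (b - a)" by (simp add: \<theta>_def \<theta>0_def algebra_simps)
    then show ?thesis using ab by (simp add: \<kappa>_def)
  qed
  have \<theta>_inj: "\<theta> s = \<theta> t \<longleftrightarrow> s = t" for s t using \<kappa> by (simp add: \<theta>_def)
  have \<theta>_T: "\<theta> t \<in> {u..v}" if "t \<in> {a..b}" for t
  proof (cases "\<kappa> > 0")
    case True
    then have "\<theta> a \<le> \<theta> t" "\<theta> t \<le> \<theta> b" using that by (auto simp: \<theta>_def)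
    then show ?thesis using tab by (simp add: \<theta>a \<theta>b)
  next
    case False
    then have "\<kappa> < 0" using \<kappa> by simp
    then have "\<theta> b \<le> \<theta> t" "\<theta> t \<le> \<theta> a" using that by (auto simp: \<theta>_def)
    then show ?thesis using tab by (simp add: \<theta>a \<theta>b)
  qed
  have \<theta>_open: "\<theta> t \<in> {u<..<v}" if t: "t \<in> {a<..<b}" for t
  proof -
    have "\<theta> t \<in> {u..v}" using t by (intro \<theta>_T) auto
    moreover have "\<theta> t \<noteq> ta" "\<theta> t \<noteq> tb" using \<theta>_inj[of t a] \<theta>_inj[of t b] t \<theta>a \<theta>b by auto
    ultimately show ?thesis using tab(1) by (auto simp: doubleton_eq_iff less_le)
  qed
  define f1 where "f1 t = push_off d (\<theta> t)" for t
  define LL where "LL t = of_real \<kappa> * (L (\<theta> t) + shift' d (\<theta> t))" for t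
  define RR where "RR t = of_real \<kappa> * (R (\<theta> t) + shift' d (\<theta> t))" for t
  define l1 where "l1 = (if \<kappa> > 0 then LL else RR)"
  define r1 where "r1 = (if \<kappa> > 0 then RR else LL)"
  have f1ab: "f1 a = p a" "f1 b = p b" by (simp_all add: f1_def \<theta>a \<theta>b pea)
  have im: "(\<lambda>v. \<theta>0 + \<kappa> * v) ` (if \<kappa> > 0 then {t<..} else {..<t}) \<subseteq> {\<theta>0 + \<kappa> * t<..}"
    "(\<lambda>v. \<theta>0 + \<kappa> * v) ` (if \<kappa> > 0 then {..<t} else {t<..}) \<subseteq> {..<\<theta>0 + \<kappa> * t}" for t
    using \<kappa> by (auto simp: mult_less_cancel_left)
  have osr: "one_sided f1 LL RR (RR t) t (if \<kappa> > 0 then {t<..} else {..<t})" for t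
    unfolding f1_def[abs_def] LL_def[abs_def] RR_def[abs_def] \<theta>_def
    by (rule one_sided_affine[OF push_off_one_sided(1) refl im(1) \<kappa>])
  have osl: "one_sided f1 LL RR (LL t) t (if \<kappa> > 0 then {..<t} else {t<..})" for t
    unfolding f1_def[abs_def] LL_def[abs_def] RR_def[abs_def] \<theta>_def
    by (rule one_sided_affine[OF push_off_one_sided(2) refl im(2) \<kappa>])
  have os1': "one_sided f1 l1 r1 (r1 t) t {t<..} \<and> one_sided f1 l1 r1 (l1 t) t {..<t}" for t
  proof (cases "\<kappa> > 0")
    case True
    then show ?thesis using osr[of t] osl[of t] by (simp add: l1_def r1_def)
  next
    case False
    then show ?thesis using osr[of t] osl[of t] one_sided_swap[of f1 RR LL] by (simp add: l1_def r1_def)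
  qed
  then have os1: "one_sided f1 l1 r1 (r1 t) t {t<..}" "one_sided f1 l1 r1 (l1 t) t {..<t}" for t by blast+
  have c1: "0 \<notin> closed_segment (l1 t) (r1 t)" if t: "t \<in> {a..b}" for t
  proof -
    let ?x = "L (\<theta> t) + shift' d (\<theta> t)" and ?y = "R (\<theta> t) + shift' d (\<theta> t)"
    have n: "0 \<notin> closed_segment ?x ?y" by (rule cusp[OF \<theta>_T[OF t]])
    have "closed_segment (LL t) (RR t) = (\<lambda>x. of_real \<kappa> * x) ` closed_segment ?x ?y"
      using closed_segment_linear_image[of "\<lambda>x. of_real \<kappa> * x" ?x ?y] by (simp add: LL_def RR_def bounded_linear.linear bounded_linear_mult_right)
    then have "0 \<notin> closed_segment (LL t) (RR t)" using n \<kappa> by auto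
    then show ?thesis by (auto simp: l1_def r1_def closed_segment_commute)
  qed
  \<comment> \<open>The junctions of the new arc with the old curve are corners, but not cusps.\<close>
  have cross_scale: "0 \<notin> closed_segment x (of_real \<kappa> * y)" "0 \<notin> closed_segment (of_real \<kappa> * y) x" if "cross2 x y \<noteq> 0" for x y
  proof -
    have "cross2 x (of_real \<kappa> * y) \<noteq> 0" using that \<kappa> by simp
    then show "0 \<notin> closed_segment x (of_real \<kappa> * y)" by (rule cross2_no_cusp)
    then show "0 \<notin> closed_segment (of_real \<kappa> * y) x" by (simp add: closed_segment_commute)
  qed
  have rho_end: "rho ta \<noteq> 0" if "s0 \<noteq> 0" using ends that lu_ends by (auto simp: rho_def)
  have rho_end': "rho tb \<noteq> 0" if "s1 \<noteq> 0" using ends that lu_ends by (auto simp: rho_def)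
  have dec: "\<kappa> < 0 \<and> ta = v \<and> tb = u \<and> s0 = sv \<and> s1 = su" if "su = 0 \<or> sv = 0"
  proof -
    have e: "ta = v \<and> tb = u \<and> s0 = sv \<and> s1 = su" using ends that by blast
    then show ?thesis using uv ab unfolding \<kappa>_def by (simp add: divide_neg_pos)
  qed
  have ca: "0 \<notin> closed_segment (L (a + 1)) (r1 a)"
  proof (cases "s0 = 0")
    case False
    have "a \<in> {k..k+1}" using ab by simp
    from N_solution[OF this tab(2) _ rho_end[OF False]] pea
    have h: "L a = R a" "L ta = R ta" "cross2 (R a) (R ta + shift' d ta) \<noteq> 0" by auto
    have "r1 a = of_real \<kappa> * (R ta + shift' d ta)" using h(2) by (simp add: r1_def LL_def RR_def \<theta>a)
    then show ?thesis using cross_scale(1)[OF h(3)] h(1) by (simp add: velocity_periodic)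
  next
    case True
    then have o: "\<kappa> < 0" "ta = v" "sv = 0" using ends uv ab dec by auto
    have "a = v" using tl0[OF True] True o by (simp add: a_def)
    moreover have "r1 a = of_real \<kappa> * (L v + shift' d v)" using o by (simp add: r1_def LL_def \<theta>a)
    moreover have "cross2 (L v) (L v + shift' d v) \<noteq> 0" using tail(2)[OF o(3)] by (simp add: cross2_add)
    ultimately show ?thesis using cross_scale(1) by (simp add: velocity_periodic)
  qed
  have cb: "0 \<notin> closed_segment (l1 b) (R b)"
  proof (cases "s1 = 0")
    case False
    have "b \<in> {k..k+1}" using ab by simp
    from N_solution[OF this tab(3) _ rho_end'[OF False]] pea
    have h: "L b = R b" "L tb = R tb" "cross2 (R b) (R tb + shift' d tb) \<noteq> 0" by auto
    have "l1 b = of_real \<kappa> * (R tb + shift' d tb)" using h(2) by (simp add: l1_def LL_def RR_def \<theta>b)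
    then show ?thesis using cross_scale(2)[OF h(3)] by simp
  next
    case True
    then have o: "\<kappa> < 0" "tb = u" "su = 0" using ends uv ab dec by auto
    have "b = u" using tl1[OF True] True o by (simp add: b_def)
    moreover have "l1 b = of_real \<kappa> * (R u + shift' d u)" using o by (simp add: l1_def RR_def \<theta>b)
    moreover have "cross2 (R u) (R u + shift' d u) \<noteq> 0" using tail(1)[OF o(3)] by (simp add: cross2_add)
    ultimately show ?thesis using cross_scale(2) by simp
  qed
  define g where "g = glue a b f1 p"
  define Lg where "Lg = glue_left a b l1 L"
  define Rg where "Rg = glue_right a b r1 R"
  have fin1: "finite {t \<in> {a..b}. l1 t \<noteq> r1 t}"
  proof -
    have "\<theta> ` {t \<in> {a..b}. l1 t \<noteq> r1 t} \<subseteq> {t \<in> {u..v}. L t \<noteq> R t}"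
      using \<theta>_T by (auto simp: l1_def r1_def LL_def RR_def split: if_splits)
    then have "finite (\<theta> ` {t \<in> {a..b}. l1 t \<noteq> r1 t})" using finite_corners_Icc finite_subset by blast
    then show ?thesis by (rule finite_imageD) (simp add: inj_on_def \<theta>_inj)
  qed
  interpret G: immersed_curve g Lg Rg
    unfolding g_def Lg_def Rg_def
    by (rule immersed_curve_glue[OF ab(1,2)])
       (use f1ab os1 one_sided c1 no_cusp ca cb fin1 finite_corners_Icc p_periodic in auto)
  have gs: "g s = f1 s" "Lg t = l1 t" "Rg t = r1 t" if "s \<in> {a..b}" "t \<in> {a<..<b}" for s t
    using that ab by (simp_all add: g_def Lg_def Rg_def glue_def glue_left_def glue_right_def wrap_id)
  have go: "g t = p t" "Lg t = L t" "Rg t = R t" if "t \<in> {b<..<a+1}" for t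
    using that ab by (simp_all add: g_def Lg_def Rg_def glue_def glue_left_def glue_right_def wrap_id)
  have g_old: "g t = p t" if "t \<in> {b..a+1}" for t
  proof -
    have "g a = p a" "g b = p b" using gs(1)[of a "(a+b)/2"] gs(1)[of b "(a+b)/2"] ab f1ab by simp_all
    moreover have "g (a + 1) = g a" "p (a + 1) = p a" by (rule G.periodic, rule p_periodic)
    moreover have "t = b \<or> t = a + 1 \<or> t \<in> {b<..<a+1}" using that by auto
    ultimately show ?thesis using go(1)[of t] by auto
  qed
  have g_int: "g s = g t" "Lg s = Lg t" "Rg s = Rg t" if "s - t \<in> \<int>" for s t
    using periodic_eq[of g, OF G.periodic that] periodic_eq[of Lg, OF G.velocity_periodic(1) that]
      periodic_eq[of Rg, OF G.velocity_periodic(2) that] by auto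
  \<comment> \<open>The meetings of the new arc with the remaining part of the old curve,
    represented in the period that starts at \<open>k\<close>; that period contains
    \<open>[a, b]\<close>, which is left out.\<close>
  define Sol where "Sol = {(c, t). c \<in> {k..k+1} \<and> c \<notin> {a..b} \<and> t \<in> {u<..<v} \<and> p c = push_off d t}"
  have old_rep: "\<exists>c. c \<in> {k..k+1} \<and> c \<notin> {a..b} \<and> c - s \<in> \<int> \<and> p c = p s \<and> L c = L s \<and> R c = R s" if s: "s \<in> {b<..<a+1}" for s
  proof (cases "s \<le> k + 1")
    case True
    then show ?thesis using s ab by (intro exI[of _ s]) auto
  next
    case False
    have i: "s - 1 - s \<in> \<int>" by simp
    have "p (s - 1) = p s" "L (s - 1) = L s" "R (s - 1) = R s"
      using p_periodic[of "s - 1"] velocity_periodic[of "s - 1"] by simp_all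
    then show ?thesis using s ab False i by (intro exI[of _ "s - 1"]) auto
  qed
  have double: "s \<in> {b<..<a+1} \<and> t \<in> {b<..<a+1} \<and> p s = p t \<or>
      s \<in> {b<..<a+1} \<and> t \<in> {a<..<b} \<and> p s = push_off d (\<theta> t) \<or>
      t \<in> {b<..<a+1} \<and> s \<in> {a<..<b} \<and> p t = push_off d (\<theta> s)"
    if st: "s \<in> {a..<a+1}" "t \<in> {a..<a+1}" "s \<noteq> t" "g s = g t" for s t
  proof -
    have new: "g x = push_off d (\<theta> x)" if "x \<in> {a..b}" for x using gs(1)[OF that, of "(a+b)/2"] ab by (simp add: f1_def)
    have mixed: "y \<in> {a<..<b} \<and> p x = push_off d (\<theta> y)" if xy: "x \<in> {b<..<a+1}" "y \<in> {a..b}" "g x = g y" for x y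
    proof -
      have 1: "p x = push_off d (\<theta> y)" using xy go(1)[of x] new[of y] by simp
      have ni: "x - y \<notin> \<int>" using xy ab by (intro sub_notin_Ints) auto
      have "y \<noteq> a"
      proof
        assume "y = a"
        then have "p x = p a" using 1 \<theta>a pea by simp
        then show False using na ni \<open>y = a\<close> unfolding crossing_points_def by blast
      qed
      moreover have "y \<noteq> b"
      proof
        assume "y = b"
        then have "p x = p b" using 1 \<theta>b pea by simp
        then show False using nb ni \<open>y = b\<close> unfolding crossing_points_def by blast
      qed
      ultimately show ?thesis using 1 xy by auto
    qed
    consider "s \<in> {a..b}" "t \<in> {a..b}" | "s \<in> {b<..<a+1}" "t \<in> {b<..<a+1}"
      | "s \<in> {b<..<a+1}" "t \<in> {a..b}" | "s \<in> {a..b}" "t \<in> {b<..<a+1}" using st(1,2) by fastforce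
    then show ?thesis
    proof cases
      case 1
      then have "push_off d (\<theta> s) = push_off d (\<theta> t)" using st(4) new by simp
      then have "\<theta> s = \<theta> t" using inj_onD[OF inj] \<theta>_T 1 by blast
      then show ?thesis using st(3) \<theta>_inj by simp
    next
      case 2 then show ?thesis using go(1) st(4) by simp
    next
      case 3 then show ?thesis using mixed[of s t] st(4) by simp
    next
      case 4 then show ?thesis using mixed[of t s] st(4) by simp
    qed
  qed
  have solution: "(\<exists>c. (c, \<theta> t) \<in> Sol \<and> p c = p s) \<and> p s \<notin> ?X \<and> L s = R s \<and> L (\<theta> t) = R (\<theta> t) \<and>
      cross2 (R s) (R (\<theta> t) + shift' d (\<theta> t)) \<noteq> 0"
    if s: "s \<in> {b<..<a+1}" and t: "t \<in> {a<..<b}" and eq: "p s = push_off d (\<theta> t)" for s t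
  proof -
    obtain c where c: "c \<in> {k..k+1}" "c \<notin> {a..b}" "p c = p s" "L c = L s" "R c = R s" using old_rep[OF s] by blast
    have o: "\<theta> t \<in> {u<..<v}" by (rule \<theta>_open[OF t])
    then have T: "\<theta> t \<in> {u..v}" and r: "rho (\<theta> t) \<noteq> 0" using rho_pos[OF o] by auto
    have "p c = push_off d (\<theta> t)" using eq c(3) by simp
    from N_solution[OF c(1) T this r] c o this show ?thesis by (auto simp: Sol_def)
  qed
  have Lg_new: "Lg t = Rg t \<and> Rg t = of_real \<kappa> * (R (\<theta> t) + shift' d (\<theta> t))" if "t \<in> {a<..<b}" "L (\<theta> t) = R (\<theta> t)" for t
    using gs(2,3)[of a t] that ab by (simp add: l1_def r1_def LL_def RR_def)
  have tr_pair: "Lg s = Rg s \<and> Lg t = Rg t \<and> cross2 (Rg s) (Rg t) \<noteq> 0" if st: "s - t \<notin> \<int>" "g s = g t" for s t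
  proof -
    define s' t' where "s' = wrap a s" and "t' = wrap a t"
    have i: "s' - s \<in> \<int>" "t' - t \<in> \<int>" using wrap_int by (auto simp: s'_def t'_def)
    have m: "s' \<in> {a..<a+1}" "t' \<in> {a..<a+1}" using wrap_bounds by (auto simp: s'_def t'_def)
    have "s' \<noteq> t'" using st(1) wrap_eq_Ints unfolding s'_def t'_def by blast
    have "g s' = g t'" using g_int(1)[OF i(1)] g_int(1)[OF i(2)] st(2) by simp
    consider (old) "s' \<in> {b<..<a+1}" "t' \<in> {b<..<a+1}" "p s' = p t'"
      | (st) "s' \<in> {b<..<a+1}" "t' \<in> {a<..<b}" "p s' = push_off d (\<theta> t')"
      | (ts) "t' \<in> {b<..<a+1}" "s' \<in> {a<..<b}" "p t' = push_off d (\<theta> s')"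
      using double[OF m \<open>s' \<noteq> t'\<close> \<open>g s' = g t'\<close>] by blast
    then have "Lg s' = Rg s' \<and> Lg t' = Rg t' \<and> cross2 (Rg s') (Rg t') \<noteq> 0"
    proof cases
      case old
      have "s' - t' \<notin> \<int>" using old \<open>s' \<noteq> t'\<close> ab by (intro sub_notin_Ints) auto
      moreover have "t' - s' \<notin> \<int>" using calculation Ints_diff_sym by blast
      ultimately show ?thesis using transverse[of s' t'] transverse[of t' s'] old go(2,3) by simp
    next
      case st
      note sl = solution[OF st]
      show ?thesis using Lg_new[OF st(2)] sl go(2,3)[OF st(1)] \<kappa> by simp
    next
      case ts
      note sl = solution[OF ts]
      have "cross2 (of_real \<kappa> * (R (\<theta> s') + shift' d (\<theta> s'))) (R t') \<noteq> 0"
        using sl \<kappa> cross2_commute[of "R t'"] by simp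
      then show ?thesis using Lg_new[OF ts(2)] sl go(2,3)[OF ts(1)] by simp
    qed
    then show ?thesis using g_int[OF i(1)] g_int[OF i(2)] by simp
  qed
  have triple: "r - s \<in> \<int> \<or> s - t \<in> \<int> \<or> r - t \<in> \<int>" if e: "g r = g s" "g s = g t" for r s t
  proof (rule ccontr)
    assume n: "\<not> (r - s \<in> \<int> \<or> s - t \<in> \<int> \<or> r - t \<in> \<int>)"
    define r' s' t' where "r' = wrap a r" and "s' = wrap a s" and "t' = wrap a t"
    have i: "r' - r \<in> \<int>" "s' - s \<in> \<int>" "t' - t \<in> \<int>" using wrap_int by (auto simp: r'_def s'_def t'_def)
    have m: "r' \<in> {a..<a+1}" "s' \<in> {a..<a+1}" "t' \<in> {a..<a+1}" using wrap_bounds by (auto simp: r'_def s'_def t'_def)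
    have ne: "r' \<noteq> s'" "s' \<noteq> t'" "r' \<noteq> t'"
      using n wrap_eq_Ints unfolding r'_def s'_def t'_def by blast+
    have ge: "g r' = g s'" "g s' = g t'" "g r' = g t'" using g_int(1)[OF i(1)] g_int(1)[OF i(2)] g_int(1)[OF i(3)] e by simp_all
    have two: False if x: "x \<in> {b<..<a+1}" and y: "y \<in> {b<..<a+1}" and w: "w \<in> {a..<a+1}"
      and xy: "x \<noteq> y" "x \<noteq> w" "y \<noteq> w" and gg: "g x = g y" "g x = g w" for x y w
    proof -
      have pxy: "p x = p y" using gg(1) go(1) x y by simp
      have nxy: "x - y \<notin> \<int>" using x y xy ab by (intro sub_notin_Ints) auto
      have X: "p x \<in> ?X" by (rule crossing_pointsI(1)[OF pxy nxy])
      have "x \<in> {a..<a+1}" using x ab by auto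
      from double[OF this w xy(2) gg(2)] show False
      proof (elim disjE conjE)
        assume w': "w \<in> {b<..<a+1}" "p x = p w"
        have "y - w \<notin> \<int>" by (rule sub_notin_Ints) (use x y w' xy ab in auto)
        moreover have "x - w \<notin> \<int>" by (rule sub_notin_Ints) (use x y w' xy ab in auto)
        ultimately
        show False using no_triple_points[of x y w] pxy w'(2) nxy by simp
      next
        assume "w \<in> {a<..<b}" "p x = push_off d (\<theta> w)"
        then show False using solution[OF x] X by blast
      next
        assume "x \<in> {a<..<b}" then show False using x by auto
      qed
    qed
    have d1: "r' \<in> {b<..<a+1} \<or> s' \<in> {b<..<a+1}" using double[OF m(1,2) ne(1) ge(1)] by blast
    have d2: "s' \<in> {b<..<a+1} \<or> t' \<in> {b<..<a+1}" using double[OF m(2,3) ne(2) ge(2)] by blast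
    have d3: "r' \<in> {b<..<a+1} \<or> t' \<in> {b<..<a+1}" using double[OF m(1,3) ne(3) ge(3)] by blast
    from d1 d2 d3 consider "r' \<in> {b<..<a+1}" "s' \<in> {b<..<a+1}" | "s' \<in> {b<..<a+1}" "t' \<in> {b<..<a+1}"
      | "r' \<in> {b<..<a+1}" "t' \<in> {b<..<a+1}" by blast
    then show False
    proof cases
      case 1 then show False using two[of r' s' t'] m ne ge by auto
    next
      case 2 then show False using two[of s' t' r'] m ne ge by auto
    next
      case 3 then show False using two[of r' t' s'] m ne ge by auto
    qed
  qed
  define Rem where "Rem = p ` (over_times \<inter> {a<..<b})"
  define New where "New = (\<lambda>(c, t). p c) ` Sol"
  \<comment> \<open>Each new crossing lies near a crossing of the old curve with the arc that is followed.\<close>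
  have Sol_fin: "finite Sol" and Sol_card: "card Sol \<le> card (under_times \<inter> {u<..<v})"
  proof -
    have ex: "\<forall>y\<in>Sol. \<exists>x. x \<in> crossing_pairs k \<and> y \<in> N x"
    proof
      fix y assume "y \<in> Sol"
      then obtain c t where y: "y = (c, t)" "c \<in> {k..k+1}" "t \<in> {u<..<v}" "p c = push_off d t" by (auto simp: Sol_def)
      have "t \<in> {u..v}" "rho t \<noteq> 0" using y(3) rho_pos[OF y(3)] by auto
      from N_solution[OF y(2) this(1) y(4) this(2)] show "\<exists>x. x \<in> crossing_pairs k \<and> y \<in> N x" using y(1) by blast
    qed
    from bchoice[OF ex] obtain h where h: "\<forall>y\<in>Sol. h y \<in> crossing_pairs k \<and> y \<in> N (h y)" by (elim exE)
    have hinj: "y = y'" if "y \<in> Sol" "y' \<in> Sol" "h y = h y'" for y y'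
    proof -
      obtain c t c' t' where y: "y = (c, t)" "y' = (c', t')" by (metis surj_pair)
      have "c = c' \<and> t = t'"
        using N_unique[of "h y" c t c' t'] bspec[OF h that(1)] bspec[OF h that(2)] that y by (auto simp: Sol_def)
      then show ?thesis using y by simp
    qed
    have partner: "c = c'" if "c \<in> {k..k+1}" "c' \<in> {k..k+1}" "p c = p t" "p c' = p t" "c - t \<notin> \<int>" "c' - t \<notin> \<int>" for c c' t
    proof (rule rep_unique[OF that(1,2)])
      have "c - t \<in> \<int> \<or> t - c' \<in> \<int> \<or> c - c' \<in> \<int>"
        by (rule no_triple_points[OF that(3) that(4)[symmetric]])
      then show "c - c' \<in> \<int>" using that(5,6) Ints_diff_sym[of t c'] by blast
      show "p c \<in> ?X" by (rule crossing_pointsI(1)[OF that(3,5)])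
    qed
    have snd_inj: "inj_on (snd \<circ> h) Sol"
    proof (rule inj_onI)
      fix y y' assume yy: "y \<in> Sol" "y' \<in> Sol" "(snd \<circ> h) y = (snd \<circ> h) y'"
      obtain c t c' where hy: "h y = (c, t)" "h y' = (c', t)" using yy(3) by (metis comp_apply prod.collapse)
      have "h y \<in> crossing_pairs k" "h y' \<in> crossing_pairs k" using h yy by blast+
      then have "c = c'" unfolding hy by (intro partner[of c c' t]) (simp_all add: crossing_pairs_def)
      then have "h y = h y'" using hy by simp
      then show "y = y'" by (rule hinj[OF yy(1,2)])
    qed
    \<comment> \<open>The neighbourhood of an end pair already contains the end of the new arc
      itself, so by uniqueness no other meeting lies in it. An end without a crossing belongs to no
      pair. Hence only inner undercrossings are counted.\<close>
    have ne_end: "t \<noteq> tx" if y: "y \<in> Sol" "h y = (c, t)" and x: "s \<noteq> 0 \<Longrightarrow> (ax, tx) \<in> crossing_pairs k"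
      "s \<noteq> 0 \<Longrightarrow> (ax + s * d, tx) \<in> N (ax, tx)" "push_off d tx = p (ax + s * d)" "s = 0 \<Longrightarrow> p tx \<notin> ?X"
      "tx \<in> {u, v}" for y c t s ax tx
    proof
      assume t: "t = tx"
      have "h y = (c, tx)" using y(2) t by simp
      with bspec[OF h y(1)] have hy: "(c, tx) \<in> crossing_pairs k" "y \<in> N (c, tx)" by simp_all
      then have "p tx \<in> ?X" using crossing_pointsI(2)[of p c tx] by (simp add: crossing_pairs_def)
      then have s: "s \<noteq> 0" using x(4) by blast
      have "c = ax" by (rule partner[of c ax tx]) (use hy(1) x(1)[OF s] in \<open>simp_all add: crossing_pairs_def\<close>)
      obtain c' t' where y': "y = (c', t')" "t' \<in> {u<..<v}" "p c' = push_off d t'" using y(1) by (auto simp: Sol_def)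
      have "c' = ax + s * d \<and> t' = tx"
      proof (rule N_unique[OF x(1)[OF s] _ x(2)[OF s]])
        show "(c', t') \<in> N (ax, tx)" using hy(2) y'(1) \<open>c = ax\<close> by simp
        show "t' \<in> {u..v}" "tx \<in> {u..v}" using y'(2) x(5) uv by auto
      qed (use y'(3) x(3) in simp_all)
      then show False using y'(2) x(5) by auto
    qed
    have snd_im: "(snd \<circ> h) ` Sol \<subseteq> under_times \<inter> {u<..<v}"
    proof
      fix t assume "t \<in> (snd \<circ> h) ` Sol"
      then obtain y where y0: "y \<in> Sol" "t = (snd \<circ> h) y" by (elim imageE)
      define c where "c = fst (h y)"
      have y: "y \<in> Sol" "h y = (c, t)" using y0 by (simp_all add: c_def prod_eq_iff)
      have hy: "(c, t) \<in> crossing_pairs k" using bspec[OF h y(1)] y(2) by simp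
      have "t \<noteq> ta"
      proof (rule ne_end[OF y, of s0 a0 ta])
        show "push_off d ta = p (a0 + s0 * d)" using pea(1) by (simp add: a_def)
        show "p ta \<notin> ?X" if "s0 = 0"
        proof -
          have e: "ta = a0" and n: "p a0 \<notin> ?X" using tl0[OF that] by blast+
          show ?thesis unfolding e by (rule n)
        qed
        show "ta \<in> {u, v}" using tab(1) by blast
      qed (rule pair0 Na0; assumption)+
      moreover have "t \<noteq> tb"
      proof (rule ne_end[OF y, of s1 a1 tb])
        show "push_off d tb = p (a1 + s1 * d)" using pea(2) by (simp add: b_def)
        show "p tb \<notin> ?X" if "s1 = 0"
        proof -
          have e: "tb = a1" and n: "p a1 \<notin> ?X" using tl1[OF that] by blast+
          show ?thesis unfolding e by (rule n)
        qed
        show "tb \<in> {u, v}" using tab(1) by blast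
      qed (rule pair1 Na1; assumption)+
      moreover have T: "t \<in> {u..v}" using hy by (auto simp: crossing_pairs_def)
      ultimately have "t \<in> {u<..<v}" using tab(1) by (auto simp: doubleton_eq_iff less_le)
      moreover have "p t \<in> ?X" using crossing_pointsI(2)[of p c t] hy by (simp add: crossing_pairs_def)
      then have "t \<in> under_times" using times[of t] T T_over by blast
      ultimately show "t \<in> under_times \<inter> {u<..<v}" by blast
    qed
    have fu: "finite (under_times \<inter> {u<..<v})"
      by (rule finite_subset[OF _ finite_crossing_times[of u v]]) (use times in auto)
    show "finite Sol" using snd_inj snd_im fu by (meson finite_imageD finite_subset)
    show "card Sol \<le> card (under_times \<inter> {u<..<v})" by (rule card_inj_on_le[OF snd_inj snd_im fu])
  qed
  have New: "finite New" "card New \<le> card (under_times \<inter> {u<..<v})"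
    unfolding New_def using Sol_fin card_image_le[OF Sol_fin, of "\<lambda>(c, t). p c"] Sol_card by (simp, linarith)
  have over_ab: "p o1 = p o2 \<Longrightarrow> o1 = o2" if "o1 \<in> over_times \<inter> {a<..<b}" "o2 \<in> over_times \<inter> {a<..<b}" for o1 o2
  proof (rule ccontr)
    assume h: "p o1 = p o2" "o1 \<noteq> o2"
    have "o1 - o2 \<notin> \<int>" using that h ab by (intro sub_notin_Ints) auto
    then have "o2 \<in> under_times" using crossing_partner_over[OF h(1)] that by blast
    then show False using that over_under_disjoint by blast
  qed
  have Rem: "card (over_times \<inter> {a0<..<a1}) + 1 \<le> card Rem"
  proof -
    have fo: "finite (over_times \<inter> {a<..<b})"
      by (rule finite_subset[OF _ finite_crossing_times[of a b]]) (use times in auto)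
    have sub: "over_times \<inter> {a0<..<a1} \<subseteq> over_times \<inter> {a<..<b}"
    proof
      fix t assume t: "t \<in> over_times \<inter> {a0<..<a1}"
      have "t < b"
      proof (rule ccontr)
        assume "\<not> t < b"
        then have "t \<in> ball a1 e1" "t \<noteq> a1" using t bds de(2) by (auto simp: dist_real_def)
        then show False using e1(2)[of t] t times[of t] by blast
      qed
      then show "t \<in> over_times \<inter> {a<..<b}" using t bds by auto
    qed
    \<comment> \<open>The additional crossing that disappears: \<open>a0\<close> if the cut is made
      before it, and otherwise \<open>a1\<close>, which then has its cut behind it because
      \<open>s1 = 1\<close>.\<close>
    obtain x where x: "x \<in> over_times \<inter> {a<..<b}" "x \<notin> over_times \<inter> {a0<..<a1}"
    proof (cases "s0 = 0")
      case True
      then have "s1 = 1" by (rule s0(2))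
      then have "b = a1 + d" by (simp add: b_def)
      then have "a1 \<in> over_times \<inter> {a<..<b}" using over1 \<open>s1 = 1\<close> bds(2) a01(1) d(1) by simp
      then show thesis using that[of a1] by auto
    next
      case False
      then have "a = a0 - d" using s0' by (auto simp: a_def)
      then have "a0 \<in> over_times \<inter> {a<..<b}" using over0[OF False] bds(3) de(5) a01(1) d(1) by simp
      then show thesis using that[of a0] by auto
    qed
    have "card (insert x (over_times \<inter> {a0<..<a1})) \<le> card (over_times \<inter> {a<..<b})"
      by (rule card_mono[OF fo]) (use sub x in auto)
    moreover have "finite (over_times \<inter> {a0<..<a1})" using sub fo finite_subset by blast
    ultimately have "card (over_times \<inter> {a0<..<a1}) + 1 \<le> card (over_times \<inter> {a<..<b})" using x(2) by simp
    also have "\<dots> = card Rem" unfolding Rem_def using over_ab by (intro card_image[symmetric] inj_onI)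
    finally show ?thesis .
  qed
  have RemX: "Rem \<subseteq> ?X" unfolding Rem_def using times by blast
  have crossing_g: "crossing_points g \<subseteq> (?X - Rem) \<union> New"
  proof
    fix x assume "x \<in> crossing_points g"
    then obtain s t where st: "s - t \<notin> \<int>" "g s = x" "g t = x" unfolding crossing_points_def by blast
    define s' t' where "s' = wrap a s" and "t' = wrap a t"
    have i: "s' - s \<in> \<int>" "t' - t \<in> \<int>" using wrap_int by (auto simp: s'_def t'_def)
    have m: "s' \<in> {a..<a+1}" "t' \<in> {a..<a+1}" using wrap_bounds by (auto simp: s'_def t'_def)
    have ne: "s' \<noteq> t'" using st(1) wrap_eq_Ints unfolding s'_def t'_def by blast
    have gx: "g s' = x" "g t' = x" using g_int(1)[OF i(1)] g_int(1)[OF i(2)] st by simp_all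
    have newx: "x \<in> New" if yw: "y \<in> {b<..<a+1}" "w \<in> {a<..<b}" "p y = push_off d (\<theta> w)" and gy: "g y = x" for y w
    proof -
      obtain c where "(c, \<theta> w) \<in> Sol" "p c = p y" using solution[OF yw] by blast
      moreover have "p y = x" using yw(1) gy go(1) by simp
      ultimately show ?thesis unfolding New_def by force
    qed
    have "g s' = g t'" using gx by simp
    consider (old) "s' \<in> {b<..<a+1}" "t' \<in> {b<..<a+1}" "p s' = p t'"
      | "s' \<in> {b<..<a+1}" "t' \<in> {a<..<b}" "p s' = push_off d (\<theta> t')"
      | "t' \<in> {b<..<a+1}" "s' \<in> {a<..<b}" "p t' = push_off d (\<theta> s')"
      using double[OF m ne \<open>g s' = g t'\<close>] by blast
    then show "x \<in> (?X - Rem) \<union> New"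
    proof cases
      case old
      have n: "s' - t' \<notin> \<int>" using old ne ab by (intro sub_notin_Ints) auto
      have px: "p s' = x" "p t' = x" using old gx go(1) by auto
      have "x \<notin> Rem"
      proof
        assume "x \<in> Rem"
        then obtain w where w: "w \<in> {a<..<b}" "p w = x" unfolding Rem_def by blast
        have "s' - w \<notin> \<int>" by (rule sub_notin_Ints) (use old w ab in auto)
        moreover have "t' - w \<notin> \<int>" by (rule sub_notin_Ints) (use old w ab in auto)
        ultimately show False using no_triple_points[of s' t' w] px w(2) n by simp
      qed
      moreover have "x \<in> ?X" using crossing_pointsI(1)[OF old(3) n] px by simp
      ultimately show ?thesis by blast
    next
      case 2 then show ?thesis using newx gx by blast
    next
      case 3 then show ?thesis using newx gx by blast
    qed
  qed
  note count = card_image_diff_bound[OF finite_crossings RemX crossing_g New Rem]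
  have reg: "regular_closed_curve g"
    unfolding regular_closed_curve_def
  proof (intro conjI allI impI)
    show "g (t + 1) = g t" for t by (rule G.periodic)
    show "piecewise_C1_immersion g" by (rule G.piecewise_C1_immersion)
    show "finite (crossing_points g)" using count by blast
    show "r - s \<in> \<int> \<or> s - t \<in> \<int> \<or> r - t \<in> \<int>" if "g r = g s \<and> g s = g t" for r s t using triple that by blast
    show "\<exists>A B. (g has_vector_derivative A) (at s) \<and> (g has_vector_derivative B) (at t) \<and> \<not> collinear {0, A, B}"
      if "s - t \<notin> \<int> \<and> g s = g t" for s t
      using tr_pair[of s t] that G.two_sided[of s] G.two_sided[of t] collinear_cross2 by blast
  qed
  \<comment> \<open>Together with the finiteness of the crossings this provides the interval behind
    \<open>b\<close> that \<open>isotopic_reroute\<close> requires for the descent.\<close>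
  have gb: "g b \<notin> crossing_points g"
  proof
    assume "g b \<in> crossing_points g"
    then obtain s t where st: "s - t \<notin> \<int>" "g s = g b" "g t = g b" unfolding crossing_points_def by blast
    then have "\<not> (s - b \<in> \<int> \<and> t - b \<in> \<int>)" using Ints_diff_trans[of s b t] Ints_diff_sym[of t b] by blast
    then obtain y where y: "y - b \<notin> \<int>" "g y = g b" using st by blast
    define y' where "y' = wrap a y"
    have i: "y' - y \<in> \<int>" using wrap_int by (auto simp: y'_def)
    have m: "y' \<in> {a..<a+1}" "b \<in> {a..<a+1}" using wrap_bounds ab by (auto simp: y'_def)
    have "y' \<noteq> b" using y(1) i Ints_diff_sym by blast
    moreover have "g y' = g b" using g_int(1)[OF i] y(2) by simp
    ultimately show False using double[OF m] by auto
  qed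
  obtain d0 where d0: "d0 > 0" "\<And>t. t \<in> {b..b+d0} \<Longrightarrow> g t \<notin> crossing_points g"
  proof -
    have "finite (crossing_points g)" using count by blast
    then have "open (- crossing_points g)" by (simp add: finite_imp_closed open_Compl)
    then have "open (g -` (- crossing_points g))" by (intro open_vimage G.continuous)
    moreover have "b \<in> g -` (- crossing_points g)" using gb by simp
    ultimately obtain r where r: "r > 0" "ball b r \<subseteq> g -` (- crossing_points g)" using openE by blast
    show thesis
    proof (rule that[of "r / 2"])
      show "r / 2 > 0" using r by simp
      fix t assume "t \<in> {b..b+r/2}"
      then have "t \<in> ball b r" using r(1) by (auto simp: dist_real_def)
      then show "g t \<notin> crossing_points g" using r(2) by blast
    qed
  qed
  have "\<exists>z'. isotopic_curves (\<lambda>t. (p t, z t)) (\<lambda>t. (g t, z' t))"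
  proof (rule isotopic_reroute[OF ab(1,2) under' _ _ G.continuous G.periodic g_old d0(1)])
    show "a \<notin> over_times" "b \<notin> over_times" using na nb times by blast+
    show "g t \<notin> crossing_points g" if "t \<in> {b..b+d0}" for t by (rule d0(2)[OF that])
    show "(p has_vector_derivative L b) (at_left b)" "(p has_vector_derivative R b) (at_right b)"
      "(g has_vector_derivative Lg b) (at_left b)" by (rule left right G.left)+
    show "0 \<notin> closed_segment (L b) (R b)" by (rule no_cusp)
    have "Lg b = l1 b" using ab by (simp add: Lg_def glue_left_def wrap_id)
    then show "0 \<notin> closed_segment (Lg b) (R b)" using cb by simp
  qed
  then obtain z' where z': "isotopic_curves (\<lambda>t. (p t, z t)) (\<lambda>t. (g t, z' t))" by blast
  have "fst \<circ> (\<lambda>t. (g t, z' t)) = g" by auto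
  then show ?thesis using z' reg count by (intro exI[of _ "\<lambda>t. (g t, z' t)"]) simp
qed

end

section \<open>Overpasses and underpasses\<close>

definition decomposition :: "real set \<Rightarrow> real set \<Rightarrow> nat \<Rightarrow> (nat \<Rightarrow> real) \<Rightarrow> (nat \<Rightarrow> real) \<Rightarrow> bool" where
  "decomposition A B k s f \<longleftrightarrow> k \<ge> 1 \<and> s k = s 0 + 1 \<and>
     (\<forall>i<k. s i < f i \<and> f i < s (Suc i) \<and> s i \<notin> A \<union> B \<and> f i \<notin> A \<union> B \<and>
        {s i..f i} \<inter> A \<noteq> {} \<and> {s i..f i} \<inter> B = {} \<and>
        {f i..s (Suc i)} \<inter> B \<noteq> {} \<and> {f i..s (Suc i)} \<inter> A = {})"

locale decomposed =
  fixes A B :: "real set" and k :: nat and s f :: "nat \<Rightarrow> real"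
  assumes dec: "decomposition A B k s f"
begin

lemma k_pos: "k \<ge> 1" and s_k: "s k = s 0 + 1"
  using dec by (auto simp: decomposition_def)

lemma step:
  assumes "i < k"
  shows "s i < f i" "f i < s (Suc i)" "s i \<notin> A \<union> B" "f i \<notin> A \<union> B" "{s i..f i} \<inter> A \<noteq> {}" "{s i..f i} \<inter> B = {}"
    "{f i..s (Suc i)} \<inter> B \<noteq> {}" "{f i..s (Suc i)} \<inter> A = {}"
  using dec assms unfolding decomposition_def by blast+

lemma s_mono: "i \<le> j \<Longrightarrow> j \<le> k \<Longrightarrow> s i \<le> s j"
proof (induction j rule: dec_induct)
  case (step n)
  then show ?case using decomposed.step(1,2)[OF decomposed_axioms, of n] by simp
qed simp

lemma f_less_s: "i < j \<Longrightarrow> j \<le> k \<Longrightarrow> f i < s j"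
  using step(2)[of i] s_mono[of "Suc i" j] by linarith

lemma window: "i < k \<Longrightarrow> s 0 \<le> s i \<and> f i < s 0 + 1 \<and> s (Suc i) \<le> s 0 + 1"
  using s_mono[of 0 i] f_less_s[of i k] s_mono[of "Suc i" k] s_k by simp

lemma interval_index: "y \<in> {s 0..<s n} \<Longrightarrow> n \<le> k \<Longrightarrow> \<exists>i<n. y \<in> {s i..<s (Suc i)}"
proof (induction n)
  case (Suc n)
  show ?case
  proof (cases "y < s n")
    case True
    then obtain i where "i < n" "y \<in> {s i..<s (Suc i)}" using Suc by auto
    then show ?thesis by (intro exI[of _ i]) simp
  next
    case False
    then show ?thesis using Suc.prems by (intro exI[of _ n]) auto
  qed
qed simp

lemma A_index:
  assumes "y \<in> A" "y \<in> {s 0..<s 0 + 1}" obtains i where "i < k" "y \<in> {s i..f i}"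
proof -
  obtain i where i: "i < k" "y \<in> {s i..<s (Suc i)}" using interval_index[of y k] assms(2) s_k by auto
  have "\<not> f i \<le> y"
  proof
    assume "f i \<le> y"
    then have "y \<in> {f i..s (Suc i)}" using i(2) by simp
    then show False using step(8)[OF i(1)] assms(1) by blast
  qed
  then show thesis using that[of i] i by auto
qed

lemma B_index:
  assumes "y \<in> B" "y \<in> {s 0..<s 0 + 1}" obtains i where "i < k" "y \<in> {f i..s (Suc i)}"
proof -
  obtain i where i: "i < k" "y \<in> {s i..<s (Suc i)}" using interval_index[of y k] assms(2) s_k by auto
  have "\<not> y \<le> f i"
  proof
    assume "y \<le> f i"
    then have "y \<in> {s i..f i}" using i(2) by simp
    then show False using step(6)[OF i(1)] assms(1) by blast
  qed
  then show thesis using that[of i] i by auto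
qed

lemma index_unique: "y \<in> {s i..f i} \<Longrightarrow> y \<in> {s j..f j} \<Longrightarrow> i < k \<Longrightarrow> j < k \<Longrightarrow> i = j"
  using f_less_s[of i j] f_less_s[of j i] by (cases i j rule: linorder_cases) auto

end

section \<open>Colour changes of a periodic two-coloured set\<close>

locale two_coloured =
  fixes A B :: "real set"
  assumes A_periodic: "t + 1 \<in> A \<longleftrightarrow> t \<in> A" and B_periodic: "t + 1 \<in> B \<longleftrightarrow> t \<in> B"
    and finite_A: "finite (A \<inter> {a..b})" and finite_B: "finite (B \<inter> {a..b})"
    and disjoint: "A \<inter> B = {}" and A_ne: "A \<noteq> {}" and B_ne: "B \<noteq> {}"
begin

text \<open>The number of passes is the number of switches per period.\<close>

definition switches :: "real set" where
  "switches = {t \<in> A. \<exists>w\<in>B. t < w \<and> {t<..<w} \<inter> (A \<union> B) = {}}"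

lemma finite_A': "X \<subseteq> {a..b} \<Longrightarrow> finite (A \<inter> X)"
  using finite_A[of a b] by (auto intro: finite_subset[rotated])

lemma shift_nat: "t + real n \<in> A \<longleftrightarrow> t \<in> A" "t + real n \<in> B \<longleftrightarrow> t \<in> B"
proof -
  have "(t + real n \<in> A \<longleftrightarrow> t \<in> A) \<and> (t + real n \<in> B \<longleftrightarrow> t \<in> B)"
    by (induction n) (use A_periodic B_periodic in \<open>auto simp: add.assoc[symmetric] add.commute[of 1]\<close>)
  then show "t + real n \<in> A \<longleftrightarrow> t \<in> A" "t + real n \<in> B \<longleftrightarrow> t \<in> B" by blast+
qed

lemma switch_between:
  assumes "x \<in> A" "w \<in> B" "x < w" shows "\<exists>t\<in>switches. x \<le> t \<and> t < w"
proof -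
  let ?W = "B \<inter> {x..w}"
  have W: "finite ?W" "?W \<noteq> {}" using assms finite_B by auto
  define w' where "w' = Min ?W"
  have w': "w' \<in> B" "x \<le> w'" "w' \<le> w" using Min_in[OF W] by (auto simp: w'_def)
  have "x \<noteq> w'" using assms(1) w'(1) disjoint by blast
  then have xw: "x < w'" using w'(2) by simp
  let ?T = "A \<inter> {x..<w'}"
  have "{x..<w'} \<subseteq> {x..w'}" by auto
  then have T: "finite ?T" "?T \<noteq> {}" using finite_A'[of "{x..<w'}" x w'] assms(1) xw by auto
  define t where "t = Max ?T"
  have t: "t \<in> A" "x \<le> t" "t < w'" using Max_in[OF T] by (auto simp: t_def)
  have "y \<notin> A \<union> B" if y: "y \<in> {t<..<w'}" for y
  proof
    assume "y \<in> A \<union> B"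
    then show False
    proof
      assume "y \<in> A"
      then have "y \<le> t" unfolding t_def using T y t(2) by (intro Max_ge) auto
      then show False using y by simp
    next
      assume "y \<in> B"
      then have "w' \<le> y" unfolding w'_def using W y t(2) w'(3) by (intro Min_le) auto
      then show False using y by simp
    qed
  qed
  then have "t \<in> switches" unfolding switches_def using t w'(1) by blast
  then show ?thesis using t w' by (intro bexI[of _ t]) auto
qed

lemma switches_periodic: "t + 1 \<in> switches \<longleftrightarrow> t \<in> switches"
proof
  assume "t + 1 \<in> switches"
  then obtain w where w: "t + 1 \<in> A" "w \<in> B" "t + 1 < w" "{t+1<..<w} \<inter> (A \<union> B) = {}" by (auto simp: switches_def)
  have "w - 1 \<in> B" using B_periodic[of "w - 1"] w(2) by simp
  moreover have "{t<..<w-1} \<inter> (A \<union> B) = {}"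
  proof -
    have "y \<notin> A \<union> B" if "y \<in> {t<..<w-1}" for y
    proof -
      have "y + 1 \<in> {t+1<..<w}" using that by auto
      then have "y + 1 \<notin> A \<union> B" using w(4) by blast
      then show ?thesis using A_periodic[of y] B_periodic[of y] by blast
    qed
    then show ?thesis by blast
  qed
  ultimately show "t \<in> switches" unfolding switches_def using w(1,3) A_periodic[of t]
    by (auto intro!: bexI[of _ "w - 1"])
next
  assume "t \<in> switches"
  then obtain w where w: "t \<in> A" "w \<in> B" "t < w" "{t<..<w} \<inter> (A \<union> B) = {}" by (auto simp: switches_def)
  have "w + 1 \<in> B" using B_periodic[of w] w(2) by simp
  moreover have "{t+1<..<w+1} \<inter> (A \<union> B) = {}"
  proof -
    have "y \<notin> A \<union> B" if "y \<in> {t+1<..<w+1}" for y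
    proof -
      have "y - 1 \<in> {t<..<w}" using that by auto
      then have "y - 1 \<notin> A \<union> B" using w(4) by blast
      then show ?thesis using A_periodic[of "y - 1"] B_periodic[of "y - 1"] by simp
    qed
    then show ?thesis by blast
  qed
  ultimately show "t + 1 \<in> switches" unfolding switches_def using w(1,3) A_periodic[of t]
    by (auto intro!: bexI[of _ "w + 1"])
qed

lemma switches_int: "x - y \<in> \<int> \<Longrightarrow> x \<in> switches \<longleftrightarrow> y \<in> switches"
  using periodic_eq[of "\<lambda>t. t \<in> switches" x y] switches_periodic by blast

text \<open>Shifts by integers match the switches of any two periods. This is needed because two
  decompositions may start at different points.\<close>

lemma card_switches_window: "card (switches \<inter> {x..<x+1}) = card (switches \<inter> {y..<y+1})"
proof -
  have inj: "s = t" if "s \<in> {a..<a+1}" "t \<in> {a..<a+1}" "s - t \<in> \<int>" for a s t :: real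
  proof (rule ccontr)
    assume "s \<noteq> t"
    then have "0 < \<bar>s - t\<bar>" "\<bar>s - t\<bar> < 1" using that(1,2) by (auto simp: abs_less_iff)
    then show False using sub_notin_Ints[of s t] that(3) by blast
  qed
  have "bij_betw (wrap y) (switches \<inter> {x..<x+1}) (switches \<inter> {y..<y+1})"
  proof (rule bij_betw_byWitness[where f' = "wrap x"])
    have w: "wrap b (wrap a t) = t" if "t \<in> {b..<b+1}" for a b t
    proof (rule inj[of _ b])
      show "wrap b (wrap a t) \<in> {b..<b+1}" by (rule wrap_bounds)
      show "wrap b (wrap a t) - t \<in> \<int>" by (rule Ints_diff_trans[OF wrap_int wrap_int])
    qed (rule that)
    show "\<forall>t\<in>switches \<inter> {x..<x+1}. wrap x (wrap y t) = t" "\<forall>t\<in>switches \<inter> {y..<y+1}. wrap y (wrap x t) = t"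
      using w by blast+
    have "wrap b ` (switches \<inter> X) \<subseteq> switches \<inter> {b..<b+1}" for b X
      using switches_int[OF wrap_int] wrap_bounds by blast
    then show "wrap y ` (switches \<inter> {x..<x+1}) \<subseteq> switches \<inter> {y..<y+1}"
      "wrap x ` (switches \<inter> {y..<y+1}) \<subseteq> switches \<inter> {x..<x+1}" by blast+
  qed
  then show ?thesis by (rule bij_betw_same_card)
qed

text \<open>The last time of \<open>A\<close> in each interval \<open>{s i..f i}\<close> is a
  switch, and every switch of the period arises from exactly one interval.\<close>

lemma decomposition_card:
  assumes "decomposition A B k s f" shows "k = card (switches \<inter> {s 0..<s 0 + 1})"
proof -
  interpret decomposed A B k s f by unfold_locales (rule assms)
  define t where "t i = Max (A \<inter> {s i..f i})" for i
  have t: "t i \<in> A" "t i \<in> {s i..f i}" "\<And>y. y \<in> A \<Longrightarrow> y \<in> {s i..f i} \<Longrightarrow> y \<le> t i" if "i < k" for i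
  proof -
    have F: "finite (A \<inter> {s i..f i})" "A \<inter> {s i..f i} \<noteq> {}" using finite_A step(5)[OF that] by (auto simp: Int_commute)
    show "t i \<in> A" "t i \<in> {s i..f i}" using Max_in[OF F] by (auto simp: t_def)
    show "y \<le> t i" if "y \<in> A" "y \<in> {s i..f i}" for y unfolding t_def using F that by (intro Max_ge) auto
  qed
  have ts: "t i \<in> switches" if i: "i < k" for i
  proof -
    let ?W = "B \<inter> {f i..s (Suc i)}"
    have W: "finite ?W" "?W \<noteq> {}" using finite_B step(7)[OF i] by (auto simp: Int_commute)
    define w where "w = Min ?W"
    have w: "w \<in> B" "f i \<le> w" "w \<le> s (Suc i)" using Min_in[OF W] by (auto simp: w_def)
    have "y \<notin> A \<union> B" if y: "y \<in> {t i<..<w}" for y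
    proof
      assume yAB: "y \<in> A \<union> B"
      show False
      proof (cases "y \<le> f i")
        case True
        then have yi: "y \<in> {s i..f i}" using t(2)[OF i] y by auto
        then have "y \<in> A" using yAB step(6)[OF i] by blast
        then show False using t(3)[OF i _ yi] y by simp
      next
        case False
        then have yi: "y \<in> {f i..s (Suc i)}" using y w by auto
        then have "y \<in> B" using yAB step(8)[OF i] by blast
        then have "w \<le> y" unfolding w_def using W yi by (intro Min_le) auto
        then show False using y by simp
      qed
    qed
    moreover have "t i < w"
    proof -
      have "t i \<noteq> f i" using t(1)[OF i] step(4)[OF i] by auto
      then show ?thesis using t(2)[OF i] w(2) by auto
    qed
    ultimately show ?thesis unfolding switches_def using t(1)[OF i] w(1) by blast
  qed
  have im: "t ` {..<k} = switches \<inter> {s 0..<s 0 + 1}"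
  proof
    show "t ` {..<k} \<subseteq> switches \<inter> {s 0..<s 0 + 1}"
      using ts t(2) window by fastforce
    show "switches \<inter> {s 0..<s 0 + 1} \<subseteq> t ` {..<k}"
    proof
      fix y assume y: "y \<in> switches \<inter> {s 0..<s 0 + 1}"
      then obtain w where w: "y \<in> A" "w \<in> B" "y < w" "{y<..<w} \<inter> (A \<union> B) = {}" by (auto simp: switches_def)
      obtain i where i: "i < k" "y \<in> {s i..f i}" using A_index w(1) y by blast
      have "\<not> w \<le> f i"
      proof
        assume "w \<le> f i"
        then have "w \<in> {s i..f i}" using i(2) w(3) by auto
        then show False using step(6)[OF i(1)] w(2) by blast
      qed
      have "t i = y"
      proof (rule ccontr)
        assume "t i \<noteq> y"
        moreover have "y \<le> t i" by (rule t(3)[OF i(1) w(1) i(2)])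
        ultimately have "t i \<in> {y<..<w}" using t(2)[OF i(1)] \<open>\<not> w \<le> f i\<close> by auto
        then show False using w(4) t(1)[OF i(1)] by blast
      qed
      then show "y \<in> t ` {..<k}" using i(1) by blast
    qed
  qed
  have "inj_on t {..<k}"
  proof (rule inj_onI)
    fix i j assume "i \<in> {..<k}" "j \<in> {..<k}" "t i = t j"
    then show "i = j" using index_unique[of "t i" i j] t(2)[of i] t(2)[of j] by simp
  qed
  then have "card (t ` {..<k}) = k" by (simp add: card_image)
  then show ?thesis unfolding im by simp
qed

lemma decomposition_unique: "decomposition A B k s f \<Longrightarrow> decomposition A B k' s' f' \<Longrightarrow> k = k'"
  using decomposition_card card_switches_window by metis

text \<open>After the switch \<open>x\<close> come times of \<open>B\<close> and then times of
  \<open>A\<close> up to \<open>y\<close>, since any further change from \<open>A\<close> to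
  \<open>B\<close> would be a switch. So \<open>f\<close> is put between \<open>x\<close> and the
  first time of \<open>B\<close>, and \<open>s\<close> between the last time of \<open>B\<close> and
  the first time of \<open>A\<close> after it.\<close>

lemma gap:
  assumes T: "x \<in> switches" "y \<in> switches" "x < y" "switches \<inter> {x<..<y} = {}"
  obtains f s where "x < f" "f < s" "s < y" "f \<notin> A \<union> B" "s \<notin> A \<union> B" "{x<..f} \<inter> (A \<union> B) = {}"
    "{f..s} \<inter> A = {}" "{f..s} \<inter> B \<noteq> {}" "{s..y} \<inter> B = {}"
proof -
  obtain w where w: "x \<in> A" "w \<in> B" "x < w" "{x<..<w} \<inter> (A \<union> B) = {}" using T(1) by (auto simp: switches_def)
  have yA: "y \<in> A" using T(2) by (simp add: switches_def)
  have wy: "w < y"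
  proof (rule ccontr)
    assume "\<not> w < y"
    then have "y \<in> {x<..<w} \<or> y = w" using T(3) by auto
    then show False using w(2,4) yA disjoint by blast
  qed
  let ?O = "A \<inter> {x<..y}"
  have "{x<..y} \<subseteq> {x..y}" by auto
  then have O: "finite ?O" "?O \<noteq> {}" using finite_A'[of "{x<..y}" x y] yA T(3) by auto
  define z where "z = Min ?O"
  have z: "z \<in> A" "x < z" "z \<le> y" using Min_in[OF O] by (auto simp: z_def)
  have zmin: "z \<le> v" if "v \<in> A" "v \<in> {x<..y}" for v unfolding z_def using O that by (intro Min_le) auto
  have wz: "w < z"
  proof (rule ccontr)
    assume "\<not> w < z"
    then have "z \<in> {x<..<w} \<or> z = w" using z by auto
    then show False using w(2,4) z(1) disjoint by blast
  qed
  let ?W = "B \<inter> {w..z}"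
  have W: "finite ?W" "?W \<noteq> {}" using finite_B w(2) wz by auto
  define l where "l = Max ?W"
  have l: "l \<in> B" "w \<le> l" "l \<le> z" using Max_in[OF W] by (auto simp: l_def)
  have lmax: "v \<le> l" if "v \<in> B" "v \<in> {w..z}" for v unfolding l_def using W that by (intro Max_ge) auto
  have lz: "l < z" using l z(1) disjoint by (metis IntI empty_iff less_le)
  have zy: "{z..y} \<inter> B = {}"
  proof -
    have False if v: "v \<in> {z..y}" "v \<in> B" for v
    proof -
      have "z < v" using v z(1) disjoint by (metis IntI atLeastAtMost_iff empty_iff less_le)
      from switch_between[OF z(1) v(2) this] obtain t where "t \<in> switches" "z \<le> t" "t < v" by blast
      then have "t \<in> switches \<inter> {x<..<y}" using z(2) v(1) by auto
      then show False using T(4) by blast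
    qed
    then show ?thesis by blast
  qed
  define f where "f = (x + w) / 2"
  define s where "s = (l + z) / 2"
  have fs: "x < f" "f < w" "l < s" "s < z" using w(3) lz by (auto simp: f_def s_def)
  show thesis
  proof (rule that[of f s])
    show "x < f" "f < s" "s < y" using fs l z by auto
    show "f \<notin> A \<union> B"
    proof -
      have "f \<in> {x<..<w}" using fs by simp
      then show ?thesis using w(4) by blast
    qed
    have nA: "v \<notin> A" if "v \<in> {f..s}" for v
    proof
      assume "v \<in> A"
      then have "z \<le> v" using that fs z by (intro zmin) auto
      then show False using that fs by auto
    qed
    then show "{f..s} \<inter> A = {}" by blast
    have nB: "v \<notin> B" if v: "v \<in> {s..y}" for v
    proof
      assume vB: "v \<in> B"
      show False
      proof (cases "v \<le> z")
        case True
        then have "v \<le> l" using v vB fs l by (intro lmax) auto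
        then show False using v fs by auto
      next
        case False
        then have "v \<in> {z..y}" using v by simp
        then show False using zy vB by blast
      qed
    qed
    then show "{s..y} \<inter> B = {}" by blast
    show "s \<notin> A \<union> B" using nA[of s] nB[of s] fs l z by auto
    show "{x<..f} \<inter> (A \<union> B) = {}"
    proof -
      have "{x<..f} \<subseteq> {x<..<w}" using fs by auto
      then show ?thesis using w(4) by blast
    qed
    have "w \<in> {f..s}" using fs l by simp
    then show "{f..s} \<inter> B \<noteq> {}" using w(2) by blast
  qed
qed

text \<open>The consecutive switches of one period are the last times of \<open>A\<close> in their
  passes; \<open>gap\<close> inserts between two of them the end of one \<open>A\<close> interval
  and the start of the next.\<close>

lemma decomposition_exists: "\<exists>k s f. decomposition A B k s f"
proof -
  obtain x w where xw: "x \<in> A" "w \<in> B" using A_ne B_ne by blast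
  obtain n :: nat where "x - w < real n" using reals_Archimedean2 by blast
  then have "x < w + real n" "w + real n \<in> B" using shift_nat(2)[of w n] xw by auto
  from switch_between[OF xw(1) this(2,1)] obtain x0 where x0: "x0 \<in> switches" by blast
  let ?S = "switches \<inter> {x0..<x0+1}"
  have fS: "finite ?S" by (rule finite_subset[OF _ finite_A[of x0 "x0+1"]]) (auto simp: switches_def)
  define xs where "xs = sorted_list_of_set ?S"
  define k where "k = length xs"
  have xs: "set xs = ?S" "sorted_wrt (<) xs" using fS by (simp_all add: xs_def)
  have k: "k \<ge> 1"
  proof -
    have "xs \<noteq> []" using xs(1) x0 by auto
    then show ?thesis by (simp add: k_def Suc_le_eq)
  qed
  define \<tau> where "\<tau> i = (if i < k then xs ! i else x0 + 1)" for i
  have in_S: "\<tau> i \<in> ?S" if "i < k" for i using that xs(1) nth_mem[of i xs] by (simp add: \<tau>_def k_def)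
  have \<tau>0: "\<tau> 0 = x0"
  proof -
    have "x0 \<in> set xs" using xs(1) x0 by simp
    then obtain j where j: "j < k" "xs ! j = x0" by (auto simp: in_set_conv_nth k_def)
    have "j = 0"
    proof (rule ccontr)
      assume "j \<noteq> 0"
      then have "xs ! 0 < xs ! j" using sorted_wrt_nth_less[OF xs(2), of 0 j] j by (simp add: k_def)
      then show False using in_S[of 0] k j by (simp add: \<tau>_def)
    qed
    then show ?thesis using j by (simp add: \<tau>_def)
  qed
  have \<tau>k: "\<tau> k = x0 + 1" by (simp add: \<tau>_def)
  have mono: "\<tau> i < \<tau> j" if "i < j" "j \<le> k" for i j
  proof (cases "j = k")
    case True then show ?thesis using in_S[of i] that by (simp add: \<tau>k)
  next
    case False
    then show ?thesis using sorted_wrt_nth_less[OF xs(2), of i j] that by (simp add: \<tau>_def k_def)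
  qed
  have sw: "\<tau> i \<in> switches" if "i \<le> k" for i
    using in_S[of i] that switches_periodic[of x0] x0 by (cases "i = k") (auto simp: \<tau>k)
  have mono': "\<tau> i \<le> \<tau> j" if "i \<le> j" "j \<le> k" for i j using mono[of i j] that by (cases "i = j") auto
  have none: "switches \<inter> {\<tau> i<..<\<tau> (Suc i)} = {}" if i: "i < k" for i
  proof -
    have False if y: "y \<in> switches" "\<tau> i < y" "y < \<tau> (Suc i)" for y
    proof -
      have "x0 \<le> \<tau> i" "\<tau> (Suc i) \<le> x0 + 1" using mono'[of 0 i] mono'[of "Suc i" k] i by (simp_all add: \<tau>0 \<tau>k)
      then have "y \<in> set xs" using xs(1) y by auto
      then obtain j where j: "j < k" "y = \<tau> j" by (auto simp: in_set_conv_nth k_def \<tau>_def)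
      show False
      proof (cases "j \<le> i")
        case True then show False using mono'[of j i] i y j by simp
      next
        case False then show False using mono'[of "Suc i" j] j y by simp
      qed
    qed
    then show ?thesis by auto
  qed
  have "\<forall>i\<in>{..<k}. \<exists>fs. \<tau> i < fst fs \<and> fst fs < snd fs \<and> snd fs < \<tau> (Suc i) \<and> fst fs \<notin> A \<union> B \<and> snd fs \<notin> A \<union> B \<and>
     {\<tau> i<..fst fs} \<inter> (A \<union> B) = {} \<and> {fst fs..snd fs} \<inter> A = {} \<and> {fst fs..snd fs} \<inter> B \<noteq> {} \<and> {snd fs..\<tau> (Suc i)} \<inter> B = {}"
    (is "\<forall>i\<in>{..<k}. \<exists>fs. ?P i fs")
  proof
    fix i assume "i \<in> {..<k}"
    then have i: "i < k" by simp
    from gap[OF sw[of i] sw[of "Suc i"] mono[of i "Suc i"] none[OF i]] i obtain f s where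
      "\<tau> i < f" "f < s" "s < \<tau> (Suc i)" "f \<notin> A \<union> B" "s \<notin> A \<union> B" "{\<tau> i<..f} \<inter> (A \<union> B) = {}"
    "{f..s} \<inter> A = {}" "{f..s} \<inter> B \<noteq> {}" "{s..\<tau> (Suc i)} \<inter> B = {}" by auto
    then show "\<exists>fs. ?P i fs" by (intro exI[of _ "(f, s)"]) (simp only: fst_conv snd_conv, blast)
  qed
  from bchoice[OF this] obtain h where h0: "\<forall>i\<in>{..<k}. ?P i (h i)" by (elim exE)
  have h: "?P i (h i)" if "i < k" for i using bspec[OF h0, of i] that by simp
  \<comment> \<open>The start before the first switch is the one found after the last switch, moved
    back by one period.\<close>
  define s where "s i = (if i = 0 then snd (h (k - 1)) - 1 else snd (h (i - 1)))" for i
  define f where "f i = fst (h i)" for i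
  have k1: "k - 1 < k" "Suc (k - 1) = k" using k by auto
  have AB1: "t + 1 \<in> A \<union> B \<longleftrightarrow> t \<in> A \<union> B" for t using A_periodic B_periodic by blast
  have sk: "s k = s 0 + 1" using k by (simp add: s_def)
  have sbefore: "s i < \<tau> i \<and> s i \<notin> A \<union> B \<and> {s i..\<tau> i} \<inter> B = {}" if i: "i < k" for i
  proof (cases "i = 0")
    case False
    then have "i - 1 < k" "Suc (i - 1) = i" using i by auto
    then show ?thesis using h[of "i - 1"] False by (simp add: s_def)
  next
    case True
    have h': "snd (h (k-1)) < x0 + 1" "snd (h (k-1)) \<notin> A \<union> B" "{snd (h (k-1))..x0+1} \<inter> B = {}"
      using h[OF k1(1)] unfolding k1(2) \<tau>k by blast+
    have s0: "s 0 = snd (h (k-1)) - 1" by (simp add: s_def)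
    have "s 0 < \<tau> 0" using h'(1) by (simp add: s0 \<tau>0)
    moreover have "s 0 \<notin> A \<union> B" using AB1[of "s 0"] h'(2) by (simp add: s0)
    moreover have "{s 0..\<tau> 0} \<inter> B = {}"
    proof -
      have "t \<notin> B" if "t \<in> {s 0..\<tau> 0}" for t
      proof -
        have "t + 1 \<in> {snd (h (k-1))..x0+1}" using that by (auto simp: s0 \<tau>0)
        then have "t + 1 \<notin> B" using h'(3) by blast
        then show ?thesis using B_periodic by blast
      qed
      then show ?thesis by blast
    qed
    ultimately show ?thesis using True by simp
  qed
  have "decomposition A B k s f"
    unfolding decomposition_def
  proof (intro conjI allI impI)
    show "1 \<le> k" "s k = s 0 + 1" by (rule k, rule sk)
    fix i assume i: "i < k"
    have sS: "s (Suc i) = snd (h i)" by (simp add: s_def)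
    note hi = h[OF i, folded f_def sS]
    have b: "s i < \<tau> i" "s i \<notin> A \<union> B" "{s i..\<tau> i} \<inter> B = {}" using sbefore[OF i] by blast+
    have c: "\<tau> i < f i" "f i < s (Suc i)" "f i \<notin> A \<union> B" "{\<tau> i<..f i} \<inter> (A \<union> B) = {}"
      "{f i..s (Suc i)} \<inter> A = {}" "{f i..s (Suc i)} \<inter> B \<noteq> {}" using hi by blast+
    have \<tau>A: "\<tau> i \<in> A" using sw[of i] i by (simp add: switches_def)
    show "s i < f i" "f i < s (Suc i)" using b c by auto
    show "s i \<notin> A \<union> B" "f i \<notin> A \<union> B" by (rule b, rule c)
    have "\<tau> i \<in> {s i..f i}" using b(1) c(1) by simp
    then show "{s i..f i} \<inter> A \<noteq> {}" using \<tau>A by blast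
    show "{s i..f i} \<inter> B = {}"
    proof -
      have "{s i..f i} \<subseteq> {s i..\<tau> i} \<union> {\<tau> i<..f i}" by auto
      then show ?thesis using b(3) c(4) by blast
    qed
    show "{f i..s (Suc i)} \<inter> B \<noteq> {}" "{f i..s (Suc i)} \<inter> A = {}" by (rule c)+
  qed
  then show ?thesis by blast
qed

end

text \<open>Overpass \<open>i\<close> is adjacent to underpass \<open>i\<close> and to its cyclic
  predecessor. For \<open>k = 1\<close> these coincide, and the truncated \<open>k - 2\<close> is
  still right: no pair remains.\<close>

lemma card_cyclic_nonadjacent:
  fixes k :: nat
  shows "card {(i, j). i < k \<and> j < k \<and> j \<noteq> i \<and> Suc j mod k \<noteq> i} \<le> k * (k - 2)"
proof -
  have "card {j. j < k \<and> j \<noteq> i \<and> Suc j mod k \<noteq> i} \<le> k - 2" if i: "i < k" for i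
  proof -
    define i' where "i' = (if i = 0 then k - 1 else i - 1)"
    have i': "i' < k" "Suc i' mod k = i" using i by (auto simp: i'_def)
    have sub: "{j. j < k \<and> j \<noteq> i \<and> Suc j mod k \<noteq> i} \<subseteq> {..<k} - {i, i'}" using i'(2) by auto
    show ?thesis
    proof (cases "k = 1")
      case True
      then show ?thesis using i by simp
    next
      case False
      then have "i' \<noteq> i" using i by (auto simp: i'_def)
      then have "card ({..<k} - {i, i'}) = k - 2" using i i' by (simp add: card_Diff_subset)
      then show ?thesis using card_mono[OF _ sub] by simp
    qed
  qed
  then have "(\<Sum>i<k. card {j. j < k \<and> j \<noteq> i \<and> Suc j mod k \<noteq> i}) \<le> (\<Sum>i<k. k - 2)" by (intro sum_mono) simp
  moreover have "{(i, j). i < k \<and> j < k \<and> j \<noteq> i \<and> Suc j mod k \<noteq> i} = (SIGMA i:{..<k}. {j. j < k \<and> j \<noteq> i \<and> Suc j mod k \<noteq> i})"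
    by auto
  ultimately show ?thesis by (simp add: card_SigmaI)
qed

section \<open>Minimal diagrams\<close>

context transverse_curve
begin

definition minimal :: bool where
  "minimal \<longleftrightarrow> (\<forall>q. isotopic_curves (\<lambda>t. (p t, z t)) q \<longrightarrow> regular_closed_curve (fst \<circ> q) \<longrightarrow>
     card (crossing_points p) \<le> card (crossing_points (fst \<circ> q)))"

text \<open>Either \<open>s\<close> is the direction in which one has to leave the time
  \<open>a\<close> on the other strand in order to reach the side \<open>\<sigma>\<close> of the
  followed arc, or \<open>s = 0\<close> and the new arc runs into the followed one away from
  crossings.\<close>

definition end_condition :: "real \<Rightarrow> real \<Rightarrow> real \<Rightarrow> real \<Rightarrow> bool" where
  "end_condition t a s \<sigma> \<longleftrightarrow> (s \<noteq> 0 \<longrightarrow> p a = p t \<and> a - t \<notin> \<int> \<and> transversal \<sigma> t (of_real s * R a)) \<and>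
     (s = 0 \<longrightarrow> a = t \<and> p t \<notin> crossing_points p)"

lemma cross_end:
  assumes "p a = p t" "a - t \<notin> \<int>"
  shows "transversal \<sigma> t (of_real s * R a) \<longleftrightarrow> \<sigma> * (s * cross2 (R t) (R a)) > 0" and "cross2 (R t) (R a) \<noteq> 0"
proof -
  have "t - a \<notin> \<int>" using assms(2) Ints_diff_sym by blast
  then have "L t = R t" "cross2 (R t) (R a) \<noteq> 0" using transverse[of t a] assms by auto
  then show "transversal \<sigma> t (of_real s * R a) \<longleftrightarrow> \<sigma> * (s * cross2 (R t) (R a)) > 0" "cross2 (R t) (R a) \<noteq> 0"
    by (auto simp: transversal_def)
qed

text \<open>For the end at which the direction is prescribed: it determines the side on which the
  parallel arc runs. At the other end \<open>sign_exists\<close> adapts the direction to that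
  side.\<close>

lemma side_exists:
  assumes "p a = p t" "a - t \<notin> \<int>" "s = 1 \<or> s = -1"
  obtains \<sigma> where "\<sigma> = 1 \<or> \<sigma> = -1" "end_condition t a s \<sigma>"
proof -
  let ?c = "cross2 (R t) (R a)"
  have "1 * (s * ?c) > 0 \<or> -1 * (s * ?c) > 0" using cross_end(2)[OF assms(1,2)] assms(3) by auto
  then have "transversal 1 t (of_real s * R a) \<or> transversal (-1) t (of_real s * R a)"
    using cross_end(1)[OF assms(1,2)] by blast
  then show thesis
  proof
    assume "transversal 1 t (of_real s * R a)"
    then show thesis using that[of 1] assms by (auto simp: end_condition_def)
  next
    assume "transversal (-1) t (of_real s * R a)"
    then show thesis using that[of "-1"] assms by (auto simp: end_condition_def)
  qed
qed

lemma sign_exists: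
  assumes "p a = p t" "a - t \<notin> \<int>" "\<sigma> = 1 \<or> \<sigma> = -1"
  obtains s where "s = 1 \<or> s = -1" "end_condition t a s \<sigma>"
proof -
  let ?c = "cross2 (R t) (R a)"
  have "\<sigma> * (1 * ?c) > 0 \<or> \<sigma> * (-1 * ?c) > 0" using cross_end(2)[OF assms(1,2)] assms(3) by auto
  then have "transversal \<sigma> t (of_real 1 * R a) \<or> transversal \<sigma> t (of_real (-1) * R a)"
    using cross_end(1)[OF assms(1,2)] by blast
  then show thesis
  proof
    assume "transversal \<sigma> t (of_real 1 * R a)"
    then show thesis using that[of 1] assms(1,2) by (auto simp: end_condition_def)
  next
    assume "transversal \<sigma> t (of_real (-1) * R a)"
    then show thesis using that[of "-1"] assms(1,2) by (auto simp: end_condition_def)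
  qed
qed

text \<open>Rerouting changes the number of crossings by at most the right-hand side minus the
  left-hand side minus 1. If the inequality failed, this would be negative, against
  minimality.\<close>

lemma minimal_bound_aux:
  assumes min: minimal and uv: "u < v" "v < u + 1" and over: "{u..v} \<inter> over_times = {}"
    and a01: "a0 < a1" "a1 < a0 + 1" and under: "{a0..a1} \<inter> under_times = {}"
    and \<sigma>: "\<sigma> = 1 \<or> \<sigma> = -1" and s: "su \<in> {-1, 0, 1}" "sv \<in> {-1, 0, 1}" "su \<noteq> 0 \<or> sv \<noteq> 0"
    and E: "end_condition u au su \<sigma>" "end_condition v av sv \<sigma>"
    and ends: "(a0, s0, ta, a1, s1, tb) = (au, su, u, av, sv, v) \<and> su \<noteq> 0 \<and> sv \<noteq> 0 \<or>
      (a0, s0, ta, a1, s1, tb) = (av, sv, v, au, su, u)"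
    and s0: "s0 \<noteq> 1" "s0 = 0 \<Longrightarrow> s1 = 1"
  shows "card (over_times \<inter> {a0<..<a1}) < card (under_times \<inter> {u<..<v})"
proof -
  have ex: "\<exists>x. transversal \<sigma> t x \<and> (s \<noteq> 0 \<longrightarrow> x = of_real s * R a)" if "end_condition t a s \<sigma>" for t a s
  proof (cases "s = 0")
    case True then show ?thesis using transversal_exists[OF \<sigma>] by blast
  next
    case False then show ?thesis using that by (auto simp: end_condition_def)
  qed
  obtain wu where wu: "transversal \<sigma> u wu" "su \<noteq> 0 \<longrightarrow> wu = of_real su * R au" using ex[OF E(1)] by blast
  obtain wv where wv: "transversal \<sigma> v wv" "sv \<noteq> 0 \<longrightarrow> wv = of_real sv * R av" using ex[OF E(2)] by blast
  obtain w w' where w: "\<And>t. (w has_vector_derivative w' t) (at t)" "continuous_on UNIV w'"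
    "w u = wu" "w v = wv" "\<And>t. t \<in> {u..v} \<Longrightarrow> transversal \<sigma> t (w t)"
    using transversal_field[OF \<sigma> uv(1) wu(1) wv(1)] by blast
  interpret P: parallel_arc p z L R u v au av su sv \<sigma> w w'
    by unfold_locales (use uv over s E \<sigma> w wu(2) wv(2) in \<open>auto simp: end_condition_def\<close>)
  have "\<exists>q. isotopic_curves (\<lambda>t. (p t, z t)) q \<and> regular_closed_curve (fst \<circ> q) \<and>
    card (crossing_points (fst \<circ> q)) + (card (over_times \<inter> {a0<..<a1}) + 1)
      \<le> card (crossing_points p) + card (under_times \<inter> {u<..<v})"
    by (rule P.reroute_along[OF ends a01 under s0]) (use E in \<open>auto simp: end_condition_def\<close>)
  then obtain q where q: "isotopic_curves (\<lambda>t. (p t, z t)) q" "regular_closed_curve (fst \<circ> q)"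
    "card (crossing_points (fst \<circ> q)) + (card (over_times \<inter> {a0<..<a1}) + 1)
      \<le> card (crossing_points p) + card (under_times \<inter> {u<..<v})" by blast
  then show ?thesis using min unfolding minimal_def by fastforce
qed

text \<open>In the reversed case the overcrossing arc and the undercrossing arc are traversed in opposite
  directions, and may be adjacent.\<close>

definition meet :: "bool \<Rightarrow> real \<Rightarrow> real \<Rightarrow> bool" where
  "meet r a t \<longleftrightarrow> p a = p t \<and> a - t \<notin> \<int> \<or> r \<and> a = t \<and> p t \<notin> crossing_points p"

text \<open>If \<open>a0\<close> is at a crossing, the direction \<open>-1\<close> there removes
  this crossing. Otherwise \<open>ne\<close> makes \<open>a1\<close> a crossing, and the direction
  \<open>1\<close> removes that one. The end so prescribed fixes the side.\<close>

lemma minimal_bound: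
  assumes min: minimal and uv: "u < v" "v < u + 1" and over: "{u..v} \<inter> over_times = {}"
    and a01: "a0 < a1" "a1 < a0 + 1" and under: "{a0..a1} \<inter> under_times = {}"
    and m: "meet r a0 (if r then v else u)" "meet r a1 (if r then u else v)"
    and ne: "a0 \<noteq> (if r then v else u) \<or> a1 \<noteq> (if r then u else v)"
  shows "card (over_times \<inter> {a0<..<a1}) < card (under_times \<inter> {u<..<v})"
proof -
  note B = minimal_bound_aux[OF min uv over a01 under]
  define ta where "ta = (if r then v else u)"
  define tb where "tb = (if r then u else v)"
  consider (cc) "p a0 = p ta \<and> a0 - ta \<notin> \<int>" "p a1 = p tb \<and> a1 - tb \<notin> \<int>"
    | (tc) "r" "a0 = ta" "p ta \<notin> crossing_points p" "p a1 = p tb \<and> a1 - tb \<notin> \<int>"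
    | (ct) "r" "p a0 = p ta \<and> a0 - ta \<notin> \<int>" "a1 = tb" "p tb \<notin> crossing_points p"
    using m ne unfolding meet_def ta_def[symmetric] tb_def[symmetric] by blast
  then show ?thesis
  proof cases
    case cc
    obtain \<sigma> where \<sigma>: "\<sigma> = 1 \<or> \<sigma> = -1" "end_condition ta a0 (-1) \<sigma>" using side_exists[of a0 ta "-1"] cc by auto
    obtain s1 where s1: "s1 = 1 \<or> s1 = -1" "end_condition tb a1 s1 \<sigma>" using sign_exists[of a1 tb \<sigma>] cc \<sigma>(1) by auto
    show ?thesis
    proof (cases r)
      case True
      show ?thesis
        by (rule B[where \<sigma> = \<sigma> and au = a1 and su = s1 and av = a0 and sv = "-1" and ?s0.0 = "-1" and ?s1.0 = s1 and ta = v and tb = u])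
          (use \<sigma> s1 True in \<open>auto simp: ta_def tb_def\<close>)
    next
      case False
      show ?thesis
        by (rule B[where \<sigma> = \<sigma> and au = a0 and su = "-1" and av = a1 and sv = s1 and ?s0.0 = "-1" and ?s1.0 = s1 and ta = u and tb = v])
          (use \<sigma> s1 False in \<open>auto simp: ta_def tb_def\<close>)
    qed
  next
    case tc
    obtain \<sigma> where \<sigma>: "\<sigma> = 1 \<or> \<sigma> = -1" "end_condition tb a1 1 \<sigma>" using side_exists[of a1 tb 1] tc by auto
    have "end_condition ta a0 0 \<sigma>" using tc by (simp add: end_condition_def)
    then show ?thesis
      by (intro B[where \<sigma> = \<sigma> and au = a1 and su = 1 and av = a0 and sv = 0 and ?s0.0 = 0 and ?s1.0 = 1 and ta = v and tb = u])
        (use \<sigma> tc in \<open>auto simp: ta_def tb_def\<close>)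
  next
    case ct
    obtain \<sigma> where \<sigma>: "\<sigma> = 1 \<or> \<sigma> = -1" "end_condition ta a0 (-1) \<sigma>" using side_exists[of a0 ta "-1"] ct by auto
    have "end_condition tb a1 0 \<sigma>" using ct by (simp add: end_condition_def)
    then show ?thesis
      by (intro B[where \<sigma> = \<sigma> and au = a1 and su = 0 and av = a0 and sv = "-1" and ?s0.0 = "-1" and ?s1.0 = 0 and ta = v and tb = u])
        (use \<sigma> ct in \<open>auto simp: ta_def tb_def\<close>)
  qed
qed

text \<open>Negating the height keeps the plane curve and exchanges overcrossings and
  undercrossings, so \<open>minimal_bound\<close> also applies with the two arcs
  interchanged.\<close>

lemma mirror_curve: "transverse_curve p (\<lambda>t. - z t) L R"
proof -
  have "projected_curve p (\<lambda>t. - z t)"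
  proof
    show "p (t + 1) = p t" "- z (t + 1) = - z t" for t by (simp_all only: p_periodic z_periodic)
    show "continuous_on UNIV p" "continuous_on UNIV (\<lambda>t. - z t)"
      by (rule continuous_p, rule continuous_on_minus[OF continuous_z])
    show "s - t \<in> \<int>" if "p s = p t" "- z s = - z t" for s t using embedded[of s t] that by simp
  qed (rule finite_crossings, rule no_triple_points)
  then show ?thesis
    using immersed_curve_axioms transverse_curve_axioms unfolding transverse_curve_def by blast
qed

lemma mirror_times:
  "projected_curve.over_times p (\<lambda>t. - z t) = under_times" "projected_curve.under_times p (\<lambda>t. - z t) = over_times"
proof -
  interpret M: transverse_curve p "\<lambda>t. - z t" L R by (rule mirror_curve)
  show "projected_curve.over_times p (\<lambda>t. - z t) = under_times" "projected_curve.under_times p (\<lambda>t. - z t) = over_times"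
    by (simp_all add: M.over_times_def M.under_times_def over_times_def under_times_def)
qed

lemma mirror_minimal:
  assumes minimal shows "transverse_curve.minimal p (\<lambda>t. - z t)"
proof -
  interpret M: transverse_curve p "\<lambda>t. - z t" L R by (rule mirror_curve)
  show ?thesis unfolding M.minimal_def
  proof (intro allI impI)
    fix q assume q: "isotopic_curves (\<lambda>t. (p t, - z t)) q" "regular_closed_curve (fst \<circ> q)"
    have e: "mirror \<circ> (\<lambda>t. (p t, - z t)) = (\<lambda>t. (p t, z t))" by (auto simp: mirror_def)
    have f: "fst \<circ> (mirror \<circ> q) = fst \<circ> q" by (auto simp: mirror_def)
    have "isotopic_curves (\<lambda>t. (p t, z t)) (mirror \<circ> q)" using isotopic_curves_mirror[OF q(1)] unfolding e .
    then have "card (crossing_points p) \<le> card (crossing_points (fst \<circ> (mirror \<circ> q)))"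
      using assms q(2) unfolding minimal_def f[symmetric] by blast
    then show "card (crossing_points p) \<le> card (crossing_points (fst \<circ> q))" unfolding f .
  qed
qed

text \<open>Of the two arcs, the one with at least as many crossings can be rerouted along the other.\<close>

theorem minimal_no_bigon:
  assumes min: minimal and uv: "u < v" "v < u + 1" and over: "{u..v} \<inter> over_times = {}"
    and a01: "a0 < a1" "a1 < a0 + 1" and under: "{a0..a1} \<inter> under_times = {}"
    and m: "meet r a0 (if r then v else u)" "meet r a1 (if r then u else v)"
    and ne: "a0 \<noteq> (if r then v else u) \<or> a1 \<noteq> (if r then u else v)"
  shows False
proof -
  interpret M: transverse_curve p "\<lambda>t. - z t" L R by (rule mirror_curve)
  have sym: "M.meet r t a" if "meet r a t" for a t
    using that Ints_diff_sym[of t a] unfolding M.meet_def meet_def by auto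
  have "M.meet r u (if r then a1 else a0)" "M.meet r v (if r then a0 else a1)"
    using sym[OF m(1)] sym[OF m(2)] by (cases r; simp)+
  moreover have "u \<noteq> (if r then a1 else a0) \<or> v \<noteq> (if r then a0 else a1)" using ne by (cases r) auto
  ultimately have "card (under_times \<inter> {u<..<v}) < card (over_times \<inter> {a0<..<a1})"
    using M.minimal_bound[OF mirror_minimal[OF min] a01 _ uv, of r] under over
    unfolding mirror_times by blast
  moreover have "card (over_times \<inter> {a0<..<a1}) < card (under_times \<inter> {u<..<v})"
    by (rule minimal_bound[OF min uv over a01 under m ne])
  ultimately show False by simp
qed

end

section \<open>Crossings and pairs of passes\<close>

locale decomposed_curve = transverse_curve p z L R + decomposed over_times under_times k s f for p z L R k s f +
  assumes min: minimal
begin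

lemma s_not_crossing: "i \<le> k \<Longrightarrow> p (s i) \<notin> crossing_points p"
proof -
  have *: "p (s i) \<notin> crossing_points p" if "i < k" for i
    using step(3)[OF that] unfolding over_under_crossing by simp
  assume "i \<le> k"
  show ?thesis
  proof (cases "i = k")
    case True
    have "p (s k) = p (s 0)" unfolding s_k by (rule p_periodic)
    then show ?thesis using *[of 0] k_pos True by simp
  qed (use * \<open>i \<le> k\<close> in simp)
qed

lemma f_not_crossing: "i < k \<Longrightarrow> p (f i) \<notin> crossing_points p"
  using step(4)[of i] unfolding over_under_crossing by simp

lemma crossing_times:
  assumes x: "x \<in> crossing_points p"
  obtains a w i j where "p a = x" "p w = x" "i < k" "j < k" "a \<in> {s i..f i}" "w \<in> {f j..s (Suc j)}"
    "a \<in> over_times" "w \<in> under_times" "a - w \<notin> \<int>"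
proof -
  note conclude = that
  obtain t r where tr: "t - r \<notin> \<int>" "p t = x" "p r = x" using x by (auto simp: crossing_points_def)
  define t' r' where "t' = wrap (s 0) t" and "r' = wrap (s 0) r"
  have i: "t' - t \<in> \<int>" "r' - r \<in> \<int>" using wrap_int by (auto simp: t'_def r'_def)
  have m: "t' \<in> {s 0..<s 0 + 1}" "r' \<in> {s 0..<s 0 + 1}" using wrap_bounds by (auto simp: t'_def r'_def)
  have px: "p t' = x" "p r' = x" using p_int[OF i(1)] p_int[OF i(2)] tr by simp_all
  have n: "t' - r' \<notin> \<int>"
  proof
    assume "t' - r' \<in> \<int>"
    then have "t - r' \<in> \<int>" using Ints_diff_trans[of t t' r'] Ints_diff_sym[OF i(1)] by blast
    then have "t - r \<in> \<int>" using Ints_diff_trans[of t r' r] i(2) by blast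
    then show False using tr(1) by blast
  qed
  have n': "r' - t' \<notin> \<int>" using n Ints_diff_sym by blast
  have main: thesis if h: "a \<in> over_times" "p a = x" "p w = x" "a \<in> {s 0..<s 0 + 1}" "w \<in> {s 0..<s 0 + 1}" "a - w \<notin> \<int>" for a w
  proof -
    have wu: "w \<in> under_times" using crossing_partner_over[of a w] h by simp
    obtain i where i: "i < k" "a \<in> {s i..f i}" using A_index[OF h(1,4)] by blast
    obtain j where j: "j < k" "w \<in> {f j..s (Suc j)}" using B_index[OF wu h(5)] by blast
    show thesis by (rule conclude[OF h(2,3) i(1) j(1) i(2) j(2) h(1) wu h(6)])
  qed
  show thesis
  proof (cases "t' \<in> over_times")
    case True then show thesis using main[of t' r'] px m n by blast
  next
    case False
    have "p r' = p t'" using px by simp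
    moreover have "t' \<in> under_times" using False crossing_pointsI(1)[of p t' r'] px n over_under_crossing by auto
    ultimately have "r' \<in> over_times" using crossing_partner_over[OF _ n'] by blast
    then show thesis using main[of r' t'] px m n' by blast
  qed
qed

text \<open>The crossing and the common end of the two passes cut out a loop. One pass runs towards
  the common end and the other away from it, so this is the reversed case of \<open>meet\<close>,
  with the common end as the meeting point that is no crossing.\<close>

lemma not_adjacent:
  assumes "p a = p w" "a - w \<notin> \<int>" "a \<in> over_times" "w \<in> under_times" "a \<in> {s i..f i}" "w \<in> {f j..s (Suc j)}" "i < k" "j < k"
  shows "j \<noteq> i \<and> Suc j mod k \<noteq> i"
proof
  have X: "p a \<in> crossing_points p" "p w \<in> crossing_points p" using crossing_pointsI[OF assms(1,2)] by blast+
  show "j \<noteq> i"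
  proof
    assume ji: "j = i"
    have ne: "a \<noteq> f i" "w \<noteq> f i" using X f_not_crossing[OF assms(7)] by auto
    have l: "a < f i" "f i < w" using ne assms(5,6) ji by auto
    note win = window[OF assms(7)]
    show False
    proof (rule minimal_no_bigon[OF min, of "f i" w a "f i" True])
      show "f i < w" "a < f i" by (rule l)+
      show "w < f i + 1" "f i < a + 1" using win assms(5,6) l ji step(1,2)[OF assms(7)] by auto
      have "{f i..w} \<subseteq> {f i..s (Suc i)}" "{a..f i} \<subseteq> {s i..f i}" using assms(5,6) ji by auto
      then show "{f i..w} \<inter> over_times = {}" "{a..f i} \<inter> under_times = {}" using step(6,8)[OF assms(7)] by blast+
      show "meet True a (if True then w else f i)" "meet True (f i) (if True then f i else w)"
        using assms(1,2) f_not_crossing[OF assms(7)] by (simp_all add: meet_def)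
      show "a \<noteq> (if True then w else f i) \<or> f i \<noteq> (if True then f i else w)" using l by simp
    qed
  qed
  show "Suc j mod k \<noteq> i"
  proof
    assume ij: "Suc j mod k = i"
    \<comment> \<open>\<open>n\<close> is \<open>1\<close> if the underpass is the last one, so that the next overpass is the first one, one turn later.\<close>
    define n :: real where "n = (if Suc j = k then 1 else 0)"
    have si: "s (Suc j) = s i + n"
    proof (cases "Suc j = k")
      case True
      then have "i = 0" using ij by simp
      then show ?thesis using True s_k by (simp add: n_def)
    next
      case False
      then have "Suc j = i" using ij assms(8) by simp
      then show ?thesis using False by (simp add: n_def)
    qed
    have nI: "n \<in> \<int>" "x + n - x \<in> \<int>" for x by (auto simp: n_def)
    have pn: "p (x + n) = p x" for x by (rule p_int[OF nI(2)])
    have sn: "p (s (Suc j)) \<notin> crossing_points p" using s_not_crossing[of "Suc j"] assms(8) by simp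
    have ne: "a + n \<noteq> s (Suc j)" "w \<noteq> s (Suc j)" using X sn pn[of a] by auto
    have l: "w < s (Suc j)" "s (Suc j) < a + n" using ne assms(5,6) si by auto
    note win = window[OF assms(7)] and win' = window[OF assms(8)]
    show False
    proof (rule minimal_no_bigon[OF min, of w "s (Suc j)" "s (Suc j)" "a + n" True])
      show "w < s (Suc j)" "s (Suc j) < a + n" by (rule l)+
      show "s (Suc j) < w + 1" using win' assms(6) step(1)[OF assms(8)] by auto
      show "a + n < s (Suc j) + 1" using win assms(5) si by auto
      have "{w..s (Suc j)} \<subseteq> {f j..s (Suc j)}" using assms(6) by auto
      then show "{w..s (Suc j)} \<inter> over_times = {}" using step(8)[OF assms(8)] by blast
      have "t \<notin> under_times" if "t \<in> {s (Suc j)..a + n}" for t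
      proof -
        have "t - n \<in> {s i..f i}" using that assms(5) si by auto
        then have "t - n \<notin> under_times" using step(6)[OF assms(7)] by blast
        then show ?thesis using under_int[of t "t - n"] nI(1) by simp
      qed
      then show "{s (Suc j)..a + n} \<inter> under_times = {}" by blast
      have "a + n - w \<notin> \<int>"
      proof
        assume "a + n - w \<in> \<int>"
        then have "a - w \<in> \<int>" using Ints_diff[OF _ nI(1), of "a + n - w"] by (simp add: algebra_simps)
        then show False using assms(2) by blast
      qed
      then show "meet True (s (Suc j)) (if True then s (Suc j) else w)" "meet True (a + n) (if True then w else s (Suc j))"
        using assms(1) sn pn by (simp_all add: meet_def)
      show "s (Suc j) \<noteq> (if True then s (Suc j) else w) \<or> a + n \<noteq> (if True then w else s (Suc j))" using l by simp
    qed
  qed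
qed

text \<open>Two crossings of the same passes bound a bigon. Whether the underpass runs through them
  in the same order as the overpass decides between the two cases of \<open>meet\<close>.\<close>

lemma single_crossing:
  assumes "p a = p w" "a - w \<notin> \<int>" "p a' = p w'" "a' - w' \<notin> \<int>" "a \<in> {s i..f i}" "a' \<in> {s i..f i}"
    "w \<in> {f j..s (Suc j)}" "w' \<in> {f j..s (Suc j)}" "i < k" "j < k"
  shows "p a = p a'"
proof (rule ccontr)
  assume ne: "p a \<noteq> p a'"
  have main: False if h: "p a = p w" "a - w \<notin> \<int>" "p a' = p w'" "a' - w' \<notin> \<int>" "a \<in> {s i..f i}" "a' \<in> {s i..f i}"
    "w \<in> {f j..s (Suc j)}" "w' \<in> {f j..s (Suc j)}" "a < a'" "w \<noteq> w'" for a w a' w'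
  proof -
    have win: "f i < s i + 1" "s (Suc j) < f j + 1"
      using window[OF assms(9)] window[OF assms(10)] step(1,2)[OF assms(9)] step(1,2)[OF assms(10)] by linarith+
    have O: "{a..a'} \<inter> under_times = {}"
    proof -
      have "{a..a'} \<subseteq> {s i..f i}" using h by auto
      then show ?thesis using step(6)[OF assms(9)] by blast
    qed
    have U: "{x..y} \<inter> over_times = {}" if "x \<in> {f j..s (Suc j)}" "y \<in> {f j..s (Suc j)}" for x y
    proof -
      have "{x..y} \<subseteq> {f j..s (Suc j)}" using that by auto
      then show ?thesis using step(8)[OF assms(10)] by blast
    qed
    have l: "a' < a + 1" "w' < w + 1" "w < w' + 1" using h win by auto
    show False
    proof (cases "w < w'")
      case True
      show False
        by (rule minimal_no_bigon[OF min True l(2) U[OF h(7,8)] h(9) l(1) O, of False])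
          (use h in \<open>auto simp: meet_def\<close>)
    next
      case False
      then have gt: "w' < w" using h(10) by simp
      show False
        by (rule minimal_no_bigon[OF min gt l(3) U[OF h(8,7)] h(9) l(1) O, of True])
          (use h in \<open>auto simp: meet_def\<close>)
    qed
  qed
  have "a \<noteq> a'" using ne by auto
  moreover have "w \<noteq> w'" using ne assms(1,3) by auto
  ultimately show False using main[of a w a' w'] main[of a' w' a w] assms(1-8) by (cases "a < a'") auto
qed

lemma card_crossings_le: "card (crossing_points p) \<le> k * (k - 2)"
proof -
  let ?P = "{(i, j). i < k \<and> j < k \<and> j \<noteq> i \<and> Suc j mod k \<noteq> i}"
  let ?Q = "\<lambda>x a w i j. p a = x \<and> p w = x \<and> a - w \<notin> \<int> \<and> a \<in> {s i..f i} \<and> w \<in> {f j..s (Suc j)} \<and> i < k \<and> j < k"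
  have "\<forall>x\<in>crossing_points p. \<exists>ij. ij \<in> ?P \<and> (\<exists>a w. ?Q x a w (fst ij) (snd ij))"
  proof
    fix x assume x: "x \<in> crossing_points p"
    obtain a w i j where h: "p a = x" "p w = x" "i < k" "j < k" "a \<in> {s i..f i}" "w \<in> {f j..s (Suc j)}"
      "a \<in> over_times" "w \<in> under_times" "a - w \<notin> \<int>" using crossing_times[OF x] by blast
    have "p a = p w" using h by simp
    from not_adjacent[OF this h(9,7,8,5,6,3,4)] have "(i, j) \<in> ?P" using h(3,4) by simp
    moreover have "?Q x a w (fst (i, j)) (snd (i, j))" using h by simp
    ultimately show "\<exists>ij. ij \<in> ?P \<and> (\<exists>a w. ?Q x a w (fst ij) (snd ij))" by blast
  qed
  from bchoice[OF this] obtain g where g: "\<forall>x\<in>crossing_points p. g x \<in> ?P \<and> (\<exists>a w. ?Q x a w (fst (g x)) (snd (g x)))"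
    by (elim exE)
  have "inj_on g (crossing_points p)"
  proof (rule inj_onI)
    fix x y assume xy: "x \<in> crossing_points p" "y \<in> crossing_points p" "g x = g y"
    obtain a w where h: "?Q x a w (fst (g x)) (snd (g x))" using bspec[OF g xy(1)] by blast
    obtain a' w' where h': "?Q y a' w' (fst (g x)) (snd (g x))" using bspec[OF g xy(2)] xy(3) by force
    have "p a = p a'"
      by (rule single_crossing[of a w a' w' "fst (g x)" "snd (g x)"]) (use h h' in auto)
    then show "x = y" using h h' by simp
  qed
  moreover have "g ` crossing_points p \<subseteq> ?P"
    by (rule image_subsetI) (rule conjunct1[OF bspec[OF g]])
  moreover have "?P \<subseteq> {..<k} \<times> {..<k}" by auto
  then have "finite ?P" by (rule finite_subset) simp
  ultimately have "card (crossing_points p) \<le> card ?P" by (rule card_inj_on_le)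
  then show ?thesis using card_cyclic_nonadjacent[of k] by linarith
qed

lemma passes_le_crossings: "k \<le> card (crossing_points p)"
proof -
  have "\<forall>i\<in>{..<k}. \<exists>a. a \<in> {s i..f i} \<and> a \<in> over_times" using step(5) by blast
  from bchoice[OF this] obtain g where g: "\<forall>i\<in>{..<k}. g i \<in> {s i..f i} \<and> g i \<in> over_times" by (elim exE)
  have "inj_on (\<lambda>i. p (g i)) {..<k}"
  proof (rule inj_onI)
    fix i j assume ij: "i \<in> {..<k}" "j \<in> {..<k}" "p (g i) = p (g j)"
    have gi: "g i \<in> {s i..f i}" "g i \<in> over_times" "g j \<in> {s j..f j}" "g j \<in> over_times" using g ij by blast+
    have "g j \<notin> under_times" using gi over_under_disjoint by blast
    then have "g i - g j \<in> \<int>" using crossing_partner_over[OF ij(3)] gi(2) by blast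
    moreover have "\<bar>g i - g j\<bar> < 1" using gi(1,3) window[of i] window[of j] ij(1,2) by (auto simp: abs_less_iff)
    ultimately have "g i = g j" using sub_notin_Ints[of "g i" "g j"] by fastforce
    then show "i = j" using index_unique[of "g i" i j] gi(1,3) ij(1,2) by simp
  qed
  moreover have "(\<lambda>i. p (g i)) ` {..<k} \<subseteq> crossing_points p" using g over_under_crossing by blast
  ultimately show ?thesis using card_inj_on_le[of "\<lambda>i. p (g i)" "{..<k}" "crossing_points p"] finite_crossings by simp
qed

end

text \<open>A diagram constrains \<open>q\<close> itself only through its image in the sphere.
  Continuity, periodicity and embeddedness are pulled back from there; the regularity of the
  projection supplies the rest.\<close>

lemma knot_transverse_curve:
  assumes K: "K \<in> knots" and q: "inv_stereographic \<circ> q \<in> K" and reg: "regular_closed_curve (fst \<circ> q)"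
  shows "\<exists>L R. transverse_curve (fst \<circ> q) (snd \<circ> q) L R"
proof -
  let ?p = "fst \<circ> q" and ?z = "snd \<circ> q" and ?g = "inv_stereographic \<circ> q"
  have g: "continuous_on UNIV ?g" "\<And>t. ?g (t + 1) = ?g t" "inj_on ?g {0..<1}"
    using knot_tame[OF K q] by (auto simp: tame_circle_def embedded_circle_def)
  have qg: "q t = stereographic (?g t)" for t by (simp add: stereographic_inv)
  have cq: "continuous_on UNIV q"
  proof -
    have "continuous_on UNIV (\<lambda>t. stereographic (?g t))"
      by (rule continuous_on_compose2[OF continuous_stereographic g(1)])
        (simp only: image_subset_iff o_apply Diff_iff singleton_iff inv_stereographic_S3 inv_stereographic_neq_pole simp_thms ball_simps)
    then show ?thesis by (simp only: qg[symmetric])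
  qed
  have per: "q (t + 1) = q t" for t
  proof -
    have "q (t + 1) = stereographic (?g (t + 1))" by (rule qg)
    also have "\<dots> = q t" by (simp only: g(2) qg[symmetric])
    finally show ?thesis .
  qed
  have inj: "s - t \<in> \<int>" if "q s = q t" for s t
  proof -
    have i: "wrap 0 s - s \<in> \<int>" "wrap 0 t - t \<in> \<int>" by (rule wrap_int)+
    have "q (wrap 0 s) = q (wrap 0 t)"
      using periodic_eq[of q, OF per i(1)] periodic_eq[of q, OF per i(2)] that by simp
    then have "?g (wrap 0 s) = ?g (wrap 0 t)" by simp
    then have "wrap 0 s = wrap 0 t" using inj_onD[OF g(3)] wrap_bounds[of 0 s] wrap_bounds[of 0 t] by simp
    then show ?thesis by (rule wrap_eq_Ints)
  qed
  obtain L R where LR: "finite {t \<in> {0..<1}. L t \<noteq> R t}" "\<And>t. (?p has_vector_derivative L t) (at_left t)"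
    "\<And>t. (?p has_vector_derivative R t) (at_right t)" "\<And>t. (R \<longlongrightarrow> L t) (at_left t)" "\<And>t. (R \<longlongrightarrow> R t) (at_right t)"
    "\<And>t. 0 \<notin> closed_segment (L t) (R t)"
    using reg unfolding regular_closed_curve_def piecewise_C1_immersion_def by blast
  interpret I: immersed_curve ?p L R
    by unfold_locales (use LR per in auto)
  have "projected_curve ?p ?z"
  proof
    show "?p (t + 1) = ?p t" "?z (t + 1) = ?z t" for t using per by simp_all
    show "continuous_on UNIV ?p" "continuous_on UNIV ?z" unfolding o_def by (intro continuous_intros cq)+
    show "s - t \<in> \<int>" if "?p s = ?p t" "?z s = ?z t" for s t using inj[of s t] that by (simp add: prod_eq_iff)
    show "finite (crossing_points ?p)" using reg by (simp add: regular_closed_curve_def)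
    show "r - s \<in> \<int> \<or> s - t \<in> \<int> \<or> r - t \<in> \<int>" if "?p r = ?p s" "?p s = ?p t" for r s t
      using reg that unfolding regular_closed_curve_def by blast
  qed
  moreover have "immersed_curve ?p L R" by (rule I.immersed_curve_axioms)
  moreover have "L s = R s \<and> cross2 (R s) (R t) \<noteq> 0" if st: "?p s = ?p t" "s - t \<notin> \<int>" for s t
  proof -
    obtain A B where AB: "(?p has_vector_derivative A) (at s)" "(?p has_vector_derivative B) (at t)" "\<not> collinear {0, A, B}"
      using reg st unfolding regular_closed_curve_def by blast
    then show ?thesis using I.derivative_unique[OF AB(1)] I.derivative_unique[OF AB(2)] collinear_cross2 by simp
  qed
  ultimately have "transverse_curve ?p ?z L R"
    unfolding transverse_curve_def transverse_curve_axioms_def by blast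
  then show ?thesis by blast
qed

theorem theorem2p10:
  fixes K :: "(real \<Rightarrow> space \<times> real) set" and D :: diagram
  assumes "K \<in> knots" and "K \<noteq> trivial_knot"
    and "is_diagram_of D K" and "crossings D = crossing_number K"
  shows "1 + sqrt (1 + real (crossings D)) \<le> real (bridges D) \<and> bridges D \<le> crossings D"
proof -
  obtain q where q: "inv_stereographic \<circ> q \<in> K" "regular_closed_curve (fst \<circ> q)" "D = projection_diagram q"
    using assms(3) by (auto simp: is_diagram_of_def)
  obtain p z where pz: "p = fst \<circ> q" "z = snd \<circ> q" by blast
  have qe: "q = (\<lambda>t. (p t, z t))" by (auto simp: pz)
  obtain L R where "transverse_curve p z L R" using knot_transverse_curve[OF assms(1) q(1,2)] pz by blast
  then interpret T: transverse_curve p z L R .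
  have cD: "crossings D = card (crossing_points p)" by (simp add: crossings_def q(3) projection_diagram_def pz)
  have oD: "overs D = T.over_times" unfolding T.over_times_def by (simp add: q(3) projection_diagram_def pz)
  have curveD: "curve D = p" by (simp add: q(3) projection_diagram_def pz)
  have uD: "unders D = T.under_times"
  proof -
    have "unders D = (T.over_times \<union> T.under_times) - T.over_times"
      unfolding unders_def oD curveD T.over_under_crossing ..
    then show ?thesis using T.over_under_disjoint by blast
  qed
  have pd: "pass_decomposition D k \<longleftrightarrow> (\<exists>s f. decomposition T.over_times T.under_times k s f)" for k
    unfolding pass_decomposition_def decomposition_def oD uD by blast
  \<comment> \<open>The only place where nontriviality enters. It also excludes the default value 0
    of \<open>bridges\<close>.\<close>
  have X: "crossing_points p \<noteq> {}"
  proof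
    assume e: "crossing_points p = {}"
    have "isotopic_curves (\<lambda>t. (p t, z t)) (\<lambda>t. (cis (2 * pi * t), 0))"
    proof (rule isotopic_round_circle[OF T.p_periodic T.z_periodic T.continuous_p T.continuous_z _ T.left T.right T.no_cusp])
      fix s t assume "p s = p t"
      then show "s - t \<in> \<int>" using crossing_pointsI(1)[of p s t] e by blast
    qed
    then show False using isotopic_curves_trivial_knot[OF assms(1) q(1)] assms(2) unfolding qe by blast
  qed
  have c1: "crossings D \<noteq> 0" unfolding cD using X T.finite_crossings by simp
  have min: "T.minimal"
    unfolding T.minimal_def
  proof (intro allI impI)
    fix q' assume q': "isotopic_curves (\<lambda>t. (p t, z t)) q'" "regular_closed_curve (fst \<circ> q')"
    have "inv_stereographic \<circ> q' \<in> K" using isotopic_curves_in_knot[OF assms(1) q(1)] q'(1) unfolding qe by blast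
    then have "is_diagram_of (projection_diagram q') K" using q'(2) unfolding is_diagram_of_def by blast
    then have "crossing_number K \<le> crossings (projection_diagram q')"
      unfolding crossing_number_def by (intro cInf_lower) (auto intro: bdd_belowI[of _ 0])
    then show "card (crossing_points p) \<le> card (crossing_points (fst \<circ> q'))"
      unfolding assms(4)[symmetric] cD by (simp add: crossings_def projection_diagram_def)
  qed
  obtain x where x: "x \<in> crossing_points p" using X by blast
  then obtain s t where st: "s - t \<notin> \<int>" "p s = x" "p t = x" by (auto simp: crossing_points_def)
  have stc: "s \<in> T.over_times \<and> t \<in> T.under_times \<or> s \<in> T.under_times \<and> t \<in> T.over_times"
  proof -
    have "p s = p t" "p t = p s" "t - s \<notin> \<int>" using st Ints_diff_sym by auto
    then show ?thesis using T.crossing_partner_over[of s t] T.crossing_partner_over[of t s] st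
      crossing_pointsI(1)[of p s t] T.over_under_crossing by blast
  qed
  interpret C: two_coloured T.over_times T.under_times
  proof
    show "t + 1 \<in> T.over_times \<longleftrightarrow> t \<in> T.over_times" "t + 1 \<in> T.under_times \<longleftrightarrow> t \<in> T.under_times" for t
      using T.over_int[of "t + 1" t] T.under_int[of "t + 1" t] by simp_all
    have "finite ((T.over_times \<union> T.under_times) \<inter> {a..b})" for a b
      using T.finite_crossing_times[of a b] unfolding T.over_under_crossing by (simp add: Int_def conj_commute)
    then show "finite (T.over_times \<inter> {a..b})" "finite (T.under_times \<inter> {a..b})" for a b
      by (rule finite_subset[rotated], blast)+
    show "T.over_times \<inter> T.under_times = {}" by (rule T.over_under_disjoint)
    show "T.over_times \<noteq> {}" "T.under_times \<noteq> {}" using stc by blast+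
  qed
  obtain k s f where dec: "decomposition T.over_times T.under_times k s f" using C.decomposition_exists by blast
  have "(THE k. pass_decomposition D k) = k"
    by (rule the_equality) (use pd dec C.decomposition_unique in blast)+
  then have b: "bridges D = k" using c1 by (simp add: bridges_def)
  interpret E: decomposed_curve p z L R k s f
    by unfold_locales (rule dec, rule min)
  have up: "k \<le> crossings D" using E.passes_le_crossings by (simp add: cD)
  have lo: "crossings D \<le> k * (k - 2)" using E.card_crossings_le by (simp add: cD)
  \<comment> \<open>By truncated subtraction the bound \<open>lo\<close> is 0 for
    \<open>k < 2\<close>, but there is a crossing. From here on \<open>k - 2\<close> is the true
    difference.\<close>
  have k2: "2 \<le> k"
  proof (rule ccontr)
    assume "\<not> 2 \<le> k"
    then have "k - 2 = 0" by simp
    then show False using lo c1 by simp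
  qed
  have "real (crossings D) \<le> real (k * (k - 2))" using lo by (simp only: of_nat_le_iff)
  also have "\<dots> = real k * (real k - 2)" using k2 by (simp add: of_nat_diff)
  finally have "1 + real (crossings D) \<le> (real k - 1)\<^sup>2" by (simp add: power2_eq_square algebra_simps)
  then have "sqrt (1 + real (crossings D)) \<le> sqrt ((real k - 1)\<^sup>2)" by (rule real_sqrt_le_mono)
  also have "\<dots> = real k - 1" using k2 by simp
  finally show ?thesis using up b by simp
qed

end
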